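(* Let $p\in(1,+\infty)$. Then the solution of the discrete minimization problem $$\text{find } u_h\in V_h \text{ such that } J_h(u_h)=\min_{v_h\in V_h}J_h(v_h)$$ is unique, where $J_h:V_h\to\mathbb R$ is the discrete energy functional $$J_h(v_h)=\tfrac1p\|D_{DG}(v_h;g_D)\|_{L^p(\Omega)}^p+\tfrac1p\|[\![v_h]\!]\|_{L^p(\Gamma^o,\eta h_e^{1-p})}^p+\tfrac1p\|v_h-g_D\|_{L^p(\Gamma^D,\eta h_e^{1-p})}^p-(f,v_h)_\Omega-\langle \boldsymbol g_N\cdot\boldsymbol n,v_h\rangle_{\Gamma^N}.$$
   Context: Setting. $\frac1p+\frac1{p'}=1$. $\Omega\subset\mathbb R^d$ is a polyhedral open bounded connected set with $\partial\Omega=\Gamma^D\sqcup\Gamma^N$ and $|\Gamma^D|>0$. Data: $f\in L^{p'}(\Omega)\cap W^{-1,p'}(\Omega)$, $g_D\in W^{1/p',p}(\Gamma^D)$, $\boldsymbol g_N\cdot\boldsymbol n\in L^{p'}(\Gamma^N)\cap W^{-1/p',p'}(\Gamma^N)$. $(\cdot,\cdot)_D$ and $\langle\cdot,\cdot\rangle_e$ are the integral pairings on a domain and on a $(d-1)$-dimensional set; $\|v\|_{L^p(S,w)}=(\int_S|v|^p w)^{1/p}$. $\mathbb N$ contains $0$. Mesh. $\mathcal T_h$ is a finite partition of $\Omega$ into simplices $K$; two distinct elements are disjoint or share only part of one common face; each face is interior (distinct elements on both sides) or a boundary face contained in exactly one of $\Gamma^D,\Gamma^N$. $\Gamma^o$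 is the union of interior faces; $\boldsymbol n$ is the unit outward normal. $h_e>0$ is the shortest normal characteristic length of the face $e$ (e.g. the minimum height over $e$ of the neighboring elements). $\eta>0$ (scalar) and $\boldsymbol C_{12}\in\mathbb R^d$ are constant on each face. Spaces. For fixed $k\in\mathbb N$, $V_h=\bigoplus_{K}\mathcal P^k(K)$ and $Q_h=\Sigma_h=\bigoplus_K(\mathcal P^k(K))^d$ (piecewise polynomials of total degree at most $k$, no continuity imposed). $\nabla_h$ is the elementwise gradient. Jumps and averages. On an interior face shared by $K_1,K_2$ with outward normals $\boldsymbol n_1=-\boldsymbol n_2$: $[\![q]\!]=q_1\boldsymbol n_1+q_2\boldsymbol n_2$, $[\![\boldsymbol\varphi]\!]=\boldsymbol\varphi_1\cdot\boldsymbol n_1+\boldsymbol\varphi_2\cdot\boldsymbol n_2$, and $\{\!\{\cdot\}\!\}$ is the arithmetic mean of the two traces. On a boundary face $[\![q]\!]=q\boldsymbol n$ and $\{\!\{\boldsymbol\varphi\}\!\}=\boldsymbol\varphi$. Discrete gradient. For $v$ in the broken space $W^{1,1}(\mathcal T_h)=\{v: v|_K\in W^{1,1}(K)\ \forall K\}$ and $g\in L^1(\Gamma^D)$, $D_{DG}(v;g)\in Q_h$ is defined by: for all $\boldsymbol\zeta_h\in\Sigma_h$, $$(D_{DG}(v;g),\boldsymbol\zeta_h)_\Omega=(\nabla_hv,\boldsymbol\zeta_h)_\Omega-\langle[\![v]\!],\{\!\{\boldsymbol\zeta_h\}\!\}-\boldsymbol C_{12}[\![\boldsymbol\zeta_h]\!]\rangle_{\Gamma^o}-\langle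 v-g,\boldsymbol\zeta_h\cdot\boldsymbol n\rangle_{\Gamma^D}.$$ *)

theory Defs
  imports "HOL-Analysis.Analysis"
begin

section \<open>Domain and mesh\<close>

definition polyhedral_domain :: "(real^'n) set \<Rightarrow> bool" where
  "polyhedral_domain \<Omega> \<longleftrightarrow> open \<Omega> \<and> bounded \<Omega> \<and> connected \<Omega> \<and>
     (\<exists>\<P>. finite \<P> \<and> (\<forall>C\<in>\<P>. polytope C \<and> aff_dim C = int CARD('n) - 1) \<and> frontier \<Omega> = \<Union>\<P>)"

text \<open>Elements are closed simplices. Hanging nodes are allowed: two elements that meet do so inside
  a facet of each of them, but need not share an entire facet. The facets of an element are tested
  without their relative boundary, because neighbouring closed faces meet and so could not lie in
  disjoint parts of the boundary.\<close>

definition dg_mesh ::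
  "(real^'n) set \<Rightarrow> (real^'n) set \<Rightarrow> (real^'n) set \<Rightarrow> (real^'n) set set \<Rightarrow> bool" where
  "dg_mesh \<Omega> \<Gamma>D \<Gamma>N T \<longleftrightarrow>
     finite T \<and> (\<forall>K\<in>T. int CARD('n) simplex K \<and> interior K \<subseteq> \<Omega>) \<and> \<Union>T = closure \<Omega> \<and>
     (\<forall>K\<in>T. \<forall>K'\<in>T. K \<noteq> K' \<longrightarrow>
        K \<inter> K' = {} \<or> (\<exists>F F'. F facet_of K \<and> F' facet_of K' \<and> K \<inter> K' \<subseteq> F \<inter> F')) \<and>
     (\<forall>K\<in>T. \<forall>F. F facet_of K \<longrightarrow>
        rel_interior F \<subseteq> \<Omega> \<or> rel_interior F \<subseteq> \<Gamma>D \<or> rel_interior F \<subseteq> \<Gamma>N)"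

definition interior_faces :: "(real^'n) set set \<Rightarrow> (real^'n) set \<Rightarrow> (real^'n) set set" where
  "interior_faces T \<Omega> =
     {K \<inter> K' | K K'. K \<in> T \<and> K' \<in> T \<and> K \<noteq> K' \<and> aff_dim (K \<inter> K') = int CARD('n) - 1 \<and>
        rel_interior (K \<inter> K') \<subseteq> \<Omega>}"

text \<open>A boundary face is recorded together with its element. This fixes the trace and the outward
  normal there, also if \<open>\<Omega>\<close> lies on both sides of a part of its boundary.\<close>

definition boundary_faces ::
  "(real^'n) set set \<Rightarrow> (real^'n) set \<Rightarrow> ((real^'n) set \<times> (real^'n) set) set" where
  "boundary_faces T \<Gamma> = {(K, F). K \<in> T \<and> F facet_of K \<and> rel_interior F \<subseteq> \<Gamma>}"

definition outward_normal :: "(real^'n) set \<Rightarrow> (real^'n) set \<Rightarrow> real^'n" where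
  "outward_normal K e = (THE n. norm n = 1 \<and> (\<exists>c. (\<forall>x\<in>e. n \<bullet> x = c) \<and> (\<forall>x\<in>K. n \<bullet> x \<le> c)))"

text \<open>The \<open>(d - 1)\<close>-dimensional surface measure on a compact convex subset \<open>e\<close> of a hyperplane,
  extended by zero: the measure of \<open>A\<close> is the volume of the slab of thickness 1, centred at the
  hyperplane, whose orthogonal projection is \<open>A \<inter> e\<close>.\<close>

definition face_measure :: "(real^'n) set \<Rightarrow> (real^'n) measure" where
  "face_measure e =
     (let proj = closest_point (affine hull e) in
      completion (distr (restrict_space lborel {x. proj x \<in> e \<and> dist x (proj x) \<le> 1/2}) borel proj))"

definition boundary_area :: "(real^'n) set set \<Rightarrow> (real^'n) set \<Rightarrow> (real^'n) set \<Rightarrow> real" where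
  "boundary_area T \<Omega> \<Gamma> = (\<Sum>(K, F)\<in>boundary_faces T (frontier \<Omega>). measure (face_measure F) \<Gamma>)"


section \<open>Function spaces for the data\<close>

definition in_Lp :: "'a measure \<Rightarrow> real \<Rightarrow> ('a \<Rightarrow> real) \<Rightarrow> bool" where
  "in_Lp M p f \<longleftrightarrow> f \<in> borel_measurable M \<and> integrable M (\<lambda>x. \<bar>f x\<bar> powr p)"

definition grad :: "(real^'n \<Rightarrow> real) \<Rightarrow> real^'n \<Rightarrow> real^'n" where
  "grad q x = (\<chi> i. frechet_derivative q (at x) (axis i 1))"

coinductive C_inf :: "(real^'n \<Rightarrow> real) \<Rightarrow> bool" where
  "(\<forall>x. \<phi> differentiable (at x)) \<Longrightarrow> (\<forall>i. C_inf (\<lambda>x. grad \<phi> x $ i)) \<Longrightarrow> C_inf \<phi>"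

definition test_function :: "(real^'n) set \<Rightarrow> (real^'n \<Rightarrow> real) \<Rightarrow> bool" where
  "test_function \<Omega> \<phi> \<longleftrightarrow> C_inf \<phi> \<and> (\<exists>S. compact S \<and> S \<subseteq> \<Omega> \<and> (\<forall>x. x \<notin> S \<longrightarrow> \<phi> x = 0))"

text \<open>\<open>f\<close> lies in the dual \<open>W\<^sup>-\<^sup>1\<^sup>,\<^sup>p\<^sup>'(\<Omega>)\<close> of \<open>W\<^sub>0\<^sup>1\<^sup>,\<^sup>p(\<Omega>)\<close>. The latter is the closure of the test functions,
  so it suffices to bound the integral pairing on these; \<open>p\<close> is the exponent of the predual.\<close>

definition in_W_dual :: "(real^'n) set \<Rightarrow> real \<Rightarrow> (real^'n \<Rightarrow> real) \<Rightarrow> bool" where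
  "in_W_dual \<Omega> p f \<longleftrightarrow>
     (\<exists>C. \<forall>\<phi>. test_function \<Omega> \<phi> \<longrightarrow>
        integrable (lebesgue_on \<Omega>) (\<lambda>x. f x * \<phi> x) \<and>
        \<bar>\<integral>x. f x * \<phi> x \<partial>lebesgue_on \<Omega>\<bar>
          \<le> C * (\<integral>x. \<bar>\<phi> x\<bar> powr p + norm (grad \<phi> x) powr p \<partial>lebesgue_on \<Omega>) powr (1/p))"

text \<open>Sobolev-Slobodeckij space \<open>W\<^sup>s\<^sup>,\<^sup>p\<close> of fractional order on the union of the boundary faces in
  \<open>B\<close>, which has dimension \<open>d - 1\<close>.\<close>

definition slobodeckij_kernel :: "real \<Rightarrow> real \<Rightarrow> (real^'n \<Rightarrow> real) \<Rightarrow> (real^'n) \<times> (real^'n) \<Rightarrow> real" where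
  "slobodeckij_kernel s p g =
     (\<lambda>(x, y). \<bar>g x - g y\<bar> powr p / norm (x - y) powr (real CARD('n) - 1 + s * p))"

definition in_Wsp_faces ::
  "((real^'n) set \<times> (real^'n) set) set \<Rightarrow> real \<Rightarrow> real \<Rightarrow> (real^'n \<Rightarrow> real) \<Rightarrow> bool" where
  "in_Wsp_faces B s p g \<longleftrightarrow>
     (\<forall>(K, F)\<in>B. in_Lp (face_measure F) p g) \<and>
     (\<forall>(K, F)\<in>B. \<forall>(K', F')\<in>B.
        integrable (face_measure F \<Otimes>\<^sub>M face_measure F') (slobodeckij_kernel s p g))"

definition Wsp_faces_norm ::
  "((real^'n) set \<times> (real^'n) set) set \<Rightarrow> real \<Rightarrow> real \<Rightarrow> (real^'n \<Rightarrow> real) \<Rightarrow> real" where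
  "Wsp_faces_norm B s p g =
     ((\<Sum>(K, F)\<in>B. \<integral>x. \<bar>g x\<bar> powr p \<partial>face_measure F) +
      (\<Sum>(K, F)\<in>B. \<Sum>(K', F')\<in>B.
         \<integral>z. slobodeckij_kernel s p g z \<partial>(face_measure F \<Otimes>\<^sub>M face_measure F'))) powr (1/p)"

text \<open>The normal component \<open>g \<cdot> n\<close> of a vector field \<open>g\<close> acts as a bounded functional on \<open>W\<^sup>s\<^sup>,\<^sup>p\<close>.\<close>

definition normal_in_Wsp_faces_dual ::
  "((real^'n) set \<times> (real^'n) set) set \<Rightarrow> real \<Rightarrow> real \<Rightarrow> (real^'n \<Rightarrow> real^'n) \<Rightarrow> bool" where
  "normal_in_Wsp_faces_dual B s p g \<longleftrightarrow>
     (\<exists>C. \<forall>\<phi>. in_Wsp_faces B s p \<phi> \<longrightarrow>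
        (\<forall>(K, F)\<in>B. integrable (face_measure F) (\<lambda>x. g x \<bullet> outward_normal K F * \<phi> x)) \<and>
        \<bar>\<Sum>(K, F)\<in>B. \<integral>x. g x \<bullet> outward_normal K F * \<phi> x \<partial>face_measure F\<bar>
          \<le> C * Wsp_faces_norm B s p \<phi>)"


section \<open>Discrete spaces\<close>

text \<open>Polynomials of total degree at most \<open>k\<close>; \<open>\<alpha>\<close> runs over multi-indices.\<close>

definition poly_fun :: "nat \<Rightarrow> (real^'n \<Rightarrow> real) set" where
  "poly_fun k =
     {q. \<exists>c. \<forall>x. q x = (\<Sum>\<alpha> | (\<Sum>i\<in>UNIV. \<alpha> i) \<le> k. c \<alpha> * (\<Prod>i\<in>UNIV. (x $ i) ^ \<alpha> i))}"

text \<open>An element of the direct sum over the mesh is the family of its components, each a function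
  on a closed element; the trace on a face of \<open>K\<close> is then the restriction of the \<open>K\<close>-component.\<close>

definition V_h :: "nat \<Rightarrow> (real^'n) set set \<Rightarrow> ((real^'n) set \<Rightarrow> real^'n \<Rightarrow> real) set" where
  "V_h k T = (\<Pi>\<^sub>E K\<in>T. {restrict q K | q. q \<in> poly_fun k})"

definition Q_h :: "nat \<Rightarrow> (real^'n) set set \<Rightarrow> ((real^'n) set \<Rightarrow> real^'n \<Rightarrow> real^'n) set" where
  "Q_h k T = (\<Pi>\<^sub>E K\<in>T. {restrict q K | q. \<forall>i. (\<lambda>x. q x $ i) \<in> poly_fun k})"


section \<open>Jumps, averages and the discrete gradient\<close>

text \<open>Exactly two elements contain a given interior face.\<close>

definition neighbours :: "(real^'n) set set \<Rightarrow> (real^'n) set \<Rightarrow> (real^'n) set set" where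
  "neighbours T e = {K\<in>T. e \<subseteq> K}"

definition jump ::
  "(real^'n) set set \<Rightarrow> ((real^'n) set \<Rightarrow> real^'n \<Rightarrow> real) \<Rightarrow> (real^'n) set \<Rightarrow> real^'n \<Rightarrow> real^'n" where
  "jump T q e x = (\<Sum>K\<in>neighbours T e. q K x *\<^sub>R outward_normal K e)"

definition normal_jump ::
  "(real^'n) set set \<Rightarrow> ((real^'n) set \<Rightarrow> real^'n \<Rightarrow> real^'n) \<Rightarrow> (real^'n) set \<Rightarrow> real^'n \<Rightarrow> real" where
  "normal_jump T \<zeta> e x = (\<Sum>K\<in>neighbours T e. \<zeta> K x \<bullet> outward_normal K e)"

definition average ::
  "(real^'n) set set \<Rightarrow> ((real^'n) set \<Rightarrow> real^'n \<Rightarrow> real^'n) \<Rightarrow> (real^'n) set \<Rightarrow> real^'n \<Rightarrow> real^'n" where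
  "average T \<zeta> e x = (1/2) *\<^sub>R (\<Sum>K\<in>neighbours T e. \<zeta> K x)"

text \<open>Integrals over \<open>\<Omega>\<close> of elementwise defined functions are sums over the elements. The gradient
  is the classical one, which on polynomial components is the weak one.\<close>

definition D_DG ::
  "nat \<Rightarrow> (real^'n) set set \<Rightarrow> (real^'n) set \<Rightarrow> (real^'n) set \<Rightarrow> ((real^'n) set \<Rightarrow> real^'n) \<Rightarrow>
   ((real^'n) set \<Rightarrow> real^'n \<Rightarrow> real) \<Rightarrow> (real^'n \<Rightarrow> real) \<Rightarrow> (real^'n) set \<Rightarrow> real^'n \<Rightarrow> real^'n" where
  "D_DG k T \<Omega> \<Gamma>D C12 v g =
     (THE D. D \<in> Q_h k T \<and> (\<forall>\<zeta>\<in>Q_h k T.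
        (\<Sum>K\<in>T. \<integral>x. D K x \<bullet> \<zeta> K x \<partial>lebesgue_on K) =
          (\<Sum>K\<in>T. \<integral>x. grad (v K) x \<bullet> \<zeta> K x \<partial>lebesgue_on K)
          - (\<Sum>e\<in>interior_faces T \<Omega>.
               \<integral>x. jump T v e x \<bullet> (average T \<zeta> e x - normal_jump T \<zeta> e x *\<^sub>R C12 e) \<partial>face_measure e)
          - (\<Sum>(K, F)\<in>boundary_faces T \<Gamma>D.
               \<integral>x. (v K x - g x) * (\<zeta> K x \<bullet> outward_normal K F) \<partial>face_measure F)))"

definition J_h ::
  "nat \<Rightarrow> (real^'n) set set \<Rightarrow> (real^'n) set \<Rightarrow> (real^'n) set \<Rightarrow> (real^'n) set \<Rightarrow> real \<Rightarrow>
   ((real^'n) set \<Rightarrow> real) \<Rightarrow> ((real^'n) set \<Rightarrow> real) \<Rightarrow> ((real^'n) set \<Rightarrow> real^'n) \<Rightarrow>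
   (real^'n \<Rightarrow> real) \<Rightarrow> (real^'n \<Rightarrow> real) \<Rightarrow> (real^'n \<Rightarrow> real^'n) \<Rightarrow>
   ((real^'n) set \<Rightarrow> real^'n \<Rightarrow> real) \<Rightarrow> real" where
  "J_h k T \<Omega> \<Gamma>D \<Gamma>N p h \<eta> C12 f gD gN v =
     (1/p) * (\<Sum>K\<in>T. \<integral>x. norm (D_DG k T \<Omega> \<Gamma>D C12 v gD K x) powr p \<partial>lebesgue_on K)
     + (1/p) * (\<Sum>e\<in>interior_faces T \<Omega>.
          \<integral>x. norm (jump T v e x) powr p * (\<eta> e * h e powr (1 - p)) \<partial>face_measure e)
     + (1/p) * (\<Sum>(K, F)\<in>boundary_faces T \<Gamma>D.
          \<integral>x. \<bar>v K x - gD x\<bar> powr p * (\<eta> F * h F powr (1 - p)) \<partial>face_measure F)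
     - (\<Sum>K\<in>T. \<integral>x. f x * v K x \<partial>lebesgue_on K)
     - (\<Sum>(K, F)\<in>boundary_faces T \<Gamma>N. \<integral>x. (gN x \<bullet> outward_normal K F) * v K x \<partial>face_measure F)"

end

theory Submission
  imports Defs "HOL-Library.Function_Algebras"
begin

text \<open>Up to an affine term, \<open>J\<^sub>h\<close> is a sum of \<open>p\<close>-th powers of \<open>L\<^sup>p\<close> norms of functions that depend affinely
  on \<open>v\<close>, because the discrete gradient is the Riesz representative of an affinely varying
  functional. Such a sum is convex, and it is strictly convex and grows superlinearly along every ray
  as soon as the affine functions together determine \<open>v\<close>. In finite dimension this gives a unique
  minimizer. To see that they determine \<open>v\<close>, take the difference \<open>w\<close> of two elements with the same
  discrete gradient, jumps and Dirichlet traces. Testing the definition of the discrete gradient with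
  the broken gradient of \<open>w\<close> shows that \<open>w\<close> is constant on each element. It has no jump across
  interior faces, and these connect the whole mesh since a set of codimension two does not separate
  \<open>\<Omega>\<close>. As \<open>w\<close> vanishes on a Dirichlet face, it is zero.\<close>

section \<open>Finite-dimensional linear algebra and convex minimization\<close>

text \<open>Three obstacles shape the proof. Members of \<open>V_h\<close> and \<open>Q_h\<close>
  are not vectors, so linear algebra and minimization are carried out on families of globally
  defined polynomials, and every integral in \<open>J_h\<close> has to be shown insensitive to
  restriction. The minimization lemmas are stated for a bare real vector space, so continuity and
  compactness are expressed through coordinates over a finite basis. For \<open>p \<noteq> 2\<close>
  no quadratic structure is available. Strictness is needed only at midpoints: equality there forces
  each integrand to agree almost everywhere. Growth needs no separate coercivity estimate, since
  separating \<open>w\<close> from 0 already yields a positive coefficient of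
  \<open>t powr p\<close>. Almost-everywhere arguments meet functions that are not known to be
  measurable off an element or a face. Completeness of the Lebesgue and the face measures absorbs
  these exceptional sets. Testing with a broken gradient is possible because \<open>V_h\<close> and
  \<open>Q_h\<close> use the same degree \<open>k\<close> and differentiation does not raise the
  degree.\<close>

instantiation "fun" :: (type, real_vector) real_vector
begin

definition scaleR_fun_def: "c *\<^sub>R f = (\<lambda>x. c *\<^sub>R f x)"

instance
  by standard (simp_all add: scaleR_fun_def fun_eq_iff algebra_simps)

end

lemma scaleR_fun_apply [simp]: "(c *\<^sub>R f) x = c *\<^sub>R f x"
  by (simp add: scaleR_fun_def)

lemma sum_fun_apply: "(\<Sum>i\<in>I. f i) x = (\<Sum>i\<in>I. f i x)"
  by (induction I rule: infinite_finite_induct) auto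

lemma finite_dim_basis:
  fixes S :: "'v::real_vector set"
  assumes "subspace S" "finite G" "S \<subseteq> span G"
  obtains B where "finite B" "independent B" "S = span B"
proof -
  obtain B where B: "B \<subseteq> S" "independent B" "S \<subseteq> span B"
    using basis_exists[of S] by metis
  have "finite B"
    using independent_span_bound[OF assms(2) B(2)] B(1) assms(3) by auto
  moreover have "span B = S"
    using B assms(1) by (metis span_minimal subset_antisym)
  ultimately show thesis using B(2) that by blast
qed

text \<open>Gram-Schmidt: the span grows by one basis vector \<open>b\<close> at a time, and
  \<open>b\<close> is replaced by its component \<open>e\<close> orthogonal to the old span. The
  induction covers all functionals \<open>l\<close> at once because its hypothesis is used twice:
  for \<open>l\<close>, and for \<open>a b\<close>, whose representative is the projection of
  \<open>b\<close>.\<close>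

lemma riesz_finite_dim:
  fixes a :: "'v::real_vector \<Rightarrow> 'v \<Rightarrow> real"
  assumes S: "subspace S" "finite G" "S \<subseteq> span G"
    and add: "\<And>u v w. u \<in> S \<Longrightarrow> v \<in> S \<Longrightarrow> w \<in> S \<Longrightarrow> a (u + v) w = a u w + a v w"
    and scale: "\<And>c u w. u \<in> S \<Longrightarrow> w \<in> S \<Longrightarrow> a (c *\<^sub>R u) w = c * a u w"
    and sym: "\<And>u v. u \<in> S \<Longrightarrow> v \<in> S \<Longrightarrow> a u v = a v u"
    and pos: "\<And>u. u \<in> S \<Longrightarrow> a u u = 0 \<Longrightarrow> u = 0"
    and ladd: "\<And>u v. u \<in> S \<Longrightarrow> v \<in> S \<Longrightarrow> l (u + v) = l u + l v"
    and lscale: "\<And>c u. u \<in> S \<Longrightarrow> l (c *\<^sub>R u) = c * (l u :: real)"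
  shows "\<exists>D\<in>S. \<forall>z\<in>S. a D z = l z"
proof -
  obtain B where B: "finite B" "independent B" "S = span B"
    using finite_dim_basis[OF S] by blast
  have "\<forall>l. (\<forall>u\<in>S. \<forall>v\<in>S. l (u + v) = l u + l v) \<longrightarrow> (\<forall>c. \<forall>u\<in>S. l (c *\<^sub>R u) = c * (l u :: real)) \<longrightarrow>
      (\<exists>D\<in>span C. \<forall>z\<in>span C. a D z = l z)" if "C \<subseteq> B" for C
    using finite_subset[OF that B(1)] that
  proof (induction C rule: finite_induct)
    case empty
    have "a 0 0 = 0" "l 0 = 0" if "\<forall>c. \<forall>u\<in>S. l (c *\<^sub>R u) = c * (l u :: real)" for l
      using scale[of 0 0 0] that B(3) span_zero[of B] by (auto dest!: spec[of _ "0::real"])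
    then show ?case by auto
  next
    case (insert b C)
    have CS: "span C \<subseteq> S" using insert.prems B(3) span_mono[of C B] by auto
    have bS: "b \<in> S" using insert.prems B(3) by (auto intro: span_base)
    have b_lin: "\<forall>u\<in>S. \<forall>v\<in>S. a b (u + v) = a b u + a b v" "\<forall>c. \<forall>u\<in>S. a b (c *\<^sub>R u) = c * a b u"
      using add scale sym bS S(1) by (metis subspace_add, metis subspace_scale)
    obtain P where P: "P \<in> span C" "\<forall>z\<in>span C. a P z = a b z"
      using insert.IH insert.prems b_lin by blast
    define e where "e = b - P"
    have eS: "e \<in> S" unfolding e_def using bS P(1) CS S(1) by (auto intro: subspace_diff)
    have PS: "P \<in> S" using P(1) CS by blast
    have e_orth: "a e z = 0" "a z e = 0" if "z \<in> span C" for z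
    proof -
      have z: "z \<in> S" using that CS by blast
      have "a b z = a (P + e) z" by (simp add: e_def)
      also have "\<dots> = a P z + a e z" using add PS eS z by blast
      finally show "a e z = 0" using P(2) that by simp
      then show "a z e = 0" using sym[OF z eS] by simp
    qed
    have e_span: "\<exists>c. \<exists>w\<in>span C. z = c *\<^sub>R e + w" if zin: "z \<in> span (insert b C)" for z
    proof -
      obtain c where c: "z - c *\<^sub>R b \<in> span C" using zin unfolding span_insert by blast
      have "z = c *\<^sub>R e + ((z - c *\<^sub>R b) + c *\<^sub>R P)" by (simp add: e_def algebra_simps)
      moreover have "(z - c *\<^sub>R b) + c *\<^sub>R P \<in> span C"
        using c P(1) by (intro span_add span_scale)
      ultimately show ?thesis by blast
    qed
    have e_in: "e \<in> span (insert b C)"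
      unfolding e_def
    proof (rule span_diff)
      show "P \<in> span (insert b C)" using P(1) span_mono[of C "insert b C"] by auto
    qed (simp add: span_base)
    show ?case
    proof (intro allI impI)
      fix l :: "'v \<Rightarrow> real"
      assume l: "\<forall>u\<in>S. \<forall>v\<in>S. l (u + v) = l u + l v" "\<forall>c. \<forall>u\<in>S. l (c *\<^sub>R u) = c * l u"
      obtain D where D: "D \<in> span C" "\<forall>z\<in>span C. a D z = l z"
        using insert.IH insert.prems l by blast
      \<comment> \<open>If \<open>a e e = 0\<close>, the quotient has the default value 0; then
        \<open>e = 0\<close> by \<open>pos\<close>, so \<open>l e = 0\<close> and the next equation
        still holds.\<close>
      define t where "t = l e / a e e"
      have t: "t * a e e = l e"
      proof (cases "a e e = 0")
        case True
        then have "e = 0" using pos eS by blast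
        then have "l e = 0" using l(2) eS by (metis mult_zero_left scaleR_zero_left)
        then show ?thesis using True by simp
      qed (simp add: t_def)
      have DS: "D \<in> S" using D(1) CS by blast
      show "\<exists>D\<in>span (insert b C). \<forall>z\<in>span (insert b C). a D z = l z"
      proof (intro bexI ballI)
        show "D + t *\<^sub>R e \<in> span (insert b C)"
          using D(1) e_in span_mono[of C "insert b C"] by (auto intro!: span_add span_scale)
        fix z assume "z \<in> span (insert b C)"
        then obtain c w where z: "w \<in> span C" "z = c *\<^sub>R e + w" using e_span by blast
        have wS: "w \<in> S" using z(1) CS by blast
        have ceS: "c *\<^sub>R e \<in> S" and teS: "t *\<^sub>R e \<in> S" using eS S(1) by (auto intro: subspace_scale)
        have zS: "z \<in> S" using z(2) wS ceS S(1) by (auto intro: subspace_add)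
        have "a (D + t *\<^sub>R e) z = a D z + t * a e z"
          using add[OF DS teS zS] scale[OF eS zS] by simp
        moreover have "a D z = c * a e D + a w D"
          using sym[OF DS zS] add[OF ceS wS DS] scale[OF eS DS] z(2) by simp
        moreover have "a w D = l w" using sym[OF wS DS] D(2) z(1) by simp
        moreover have "a e D = 0" using e_orth D(1) by blast
        moreover have "a e z = c * a e e"
        proof -
          have "a e z = a (c *\<^sub>R e + w) e" using sym[OF eS zS] z(2) by simp
          also have "\<dots> = c * a e e + a w e" using add[OF ceS wS eS] scale[OF eS eS] by simp
          finally show ?thesis using e_orth z(1) by simp
        qed
        moreover have "l z = c * l e + l w" using l ceS wS eS z(2) by simp
        ultimately show "a (D + t *\<^sub>R e) z = l z" using t by (simp add: algebra_simps)
      qed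
    qed
  qed
  from this[of B] show ?thesis using B(3) ladd lscale by blast
qed

text \<open>The upper bound is Jensen's inequality; reflecting at \<open>v\<close> turns it into the lower bound.\<close>

lemma convex_on_coordinate_bound:
  fixes J :: "'v::real_vector \<Rightarrow> real"
  assumes J: "convex_on S J" and S: "subspace S" "finite B" "B \<subseteq> S" and v: "v \<in> S"
  obtains M where "0 \<le> M" "\<And>c. (\<Sum>b\<in>B. \<bar>c b\<bar>) \<le> 1 \<Longrightarrow>
    \<bar>J (v + (\<Sum>b\<in>B. c b *\<^sub>R b)) - J v\<bar> \<le> M * (\<Sum>b\<in>B. \<bar>c b\<bar>)"
proof -
  define Q where "Q = (\<Sum>b\<in>B. \<bar>J (v + b)\<bar> + \<bar>J (v - b)\<bar>)"
  define M where "M = \<bar>J v\<bar> + Q"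
  have Q0: "0 \<le> Q" unfolding Q_def by (intro sum_nonneg) auto
  then have M0: "0 \<le> M" unfolding M_def by simp
  have bnd: "J (v + sgn s *\<^sub>R b) \<le> M" if b: "b \<in> B" for s b
  proof -
    have "\<bar>J (v + b)\<bar> + \<bar>J (v - b)\<bar> \<le> Q"
      unfolding Q_def using b S(2) by (intro member_le_sum) auto
    then show ?thesis using Q0 unfolding M_def by (cases s "0::real" rule: linorder_cases) auto
  qed
  have upper: "J (v + (\<Sum>b\<in>B. c b *\<^sub>R b)) \<le> J v + 2 * M * (\<Sum>b\<in>B. \<bar>c b\<bar>)"
    if c: "(\<Sum>b\<in>B. \<bar>c b\<bar>) \<le> 1" for c
  proof -
    let ?\<delta> = "\<Sum>b\<in>B. \<bar>c b\<bar>"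
    let ?I = "insert None (Some ` B)"
    \<comment> \<open>Convex combination for Jensen: the vertex
      \<open>v + sgn (c b) *\<^sub>R b\<close> gets weight \<open>\<bar>c b\<bar>\<close>, and
      \<open>None\<close> assigns the leftover weight to \<open>v\<close>.\<close>
    define w where "w i = (case i of None \<Rightarrow> 1 - ?\<delta> | Some b \<Rightarrow> \<bar>c b\<bar>)" for i
    define y where "y i = (case i of None \<Rightarrow> v | Some b \<Rightarrow> v + sgn (c b) *\<^sub>R b)" for i
    have expand: "(\<Sum>i\<in>?I. f i) = f None + (\<Sum>b\<in>B. f (Some b))" for f :: "'v option \<Rightarrow> 'x::comm_monoid_add"
      using S(2) by (subst sum.insert) (auto simp: sum.reindex)
    have "(\<Sum>i\<in>?I. w i *\<^sub>R y i) = (1 - ?\<delta>) *\<^sub>R v + (\<Sum>b\<in>B. \<bar>c b\<bar> *\<^sub>R v + c b *\<^sub>R b)"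
      unfolding expand by (simp add: w_def y_def scaleR_add_right abs_mult_sgn)
    also have "\<dots> = v + (\<Sum>b\<in>B. c b *\<^sub>R b)"
      by (simp add: sum.distrib scaleR_left_diff_distrib flip: scaleR_sum_left)
    finally have eq: "(\<Sum>i\<in>?I. w i *\<^sub>R y i) = v + (\<Sum>b\<in>B. c b *\<^sub>R b)" .
    have "J (\<Sum>i\<in>?I. w i *\<^sub>R y i) \<le> (\<Sum>i\<in>?I. w i * J (y i))"
    proof (rule convex_on_sum[OF _ _ J])
      show "(\<Sum>i\<in>?I. w i) = 1" unfolding expand by (simp add: w_def)
      show "0 \<le> w i" if "i \<in> ?I" for i using that c by (auto simp: w_def)
      show "y i \<in> S" if "i \<in> ?I" for i
        using that v S by (auto simp: y_def intro!: subspace_add subspace_scale)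
    qed (use S in auto)
    also have "\<dots> = (1 - ?\<delta>) * J v + (\<Sum>b\<in>B. \<bar>c b\<bar> * J (v + sgn (c b) *\<^sub>R b))"
      unfolding expand by (simp add: w_def y_def)
    also have "\<dots> \<le> (1 - ?\<delta>) * J v + (\<Sum>b\<in>B. \<bar>c b\<bar> * M)"
      by (intro add_left_mono sum_mono mult_left_mono bnd) auto
    also have "\<dots> = J v + ?\<delta> * (M - J v)" unfolding sum_distrib_right[symmetric] by algebra
    also have "\<dots> \<le> J v + ?\<delta> * (2 * M)"
    proof (intro add_left_mono mult_left_mono)
      show "M - J v \<le> 2 * M" using Q0 unfolding M_def by (simp add: algebra_simps)
    qed (auto intro: sum_nonneg)
    finally show ?thesis unfolding eq by (simp only: mult_ac)
  qed
  show thesis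
  proof (rule that[of "2 * M"])
    fix c :: "'v \<Rightarrow> real" assume c: "(\<Sum>b\<in>B. \<bar>c b\<bar>) \<le> 1"
    let ?d = "\<Sum>b\<in>B. c b *\<^sub>R b"
    have d: "?d \<in> S" using S by (auto intro!: subspace_sum subspace_scale)
    have "v = (1/2) *\<^sub>R (v + ?d) + (1/2) *\<^sub>R (v - ?d)"
      by (simp add: scaleR_add_right scaleR_diff_right flip: scaleR_left_distrib)
    then have "J v = J ((1/2) *\<^sub>R (v + ?d) + (1/2) *\<^sub>R (v - ?d))" by simp
    also have "\<dots> \<le> (1/2) * J (v + ?d) + (1/2) * J (v - ?d)"
      using convex_onD[OF J, of "1/2" "v + ?d" "v - ?d"] v d S(1)
      by (auto simp: subspace_add subspace_diff)
    finally have "2 * J v \<le> J (v + ?d) + J (v - ?d)" by simp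
    moreover have "J (v - ?d) \<le> J v + 2 * M * (\<Sum>b\<in>B. \<bar>c b\<bar>)"
      using upper[of "\<lambda>b. - c b"] c by (simp add: sum_negf)
    ultimately show "\<bar>J (v + ?d) - J v\<bar> \<le> 2 * M * (\<Sum>b\<in>B. \<bar>c b\<bar>)"
      using upper[OF c] by linarith
  qed (use M0 in auto)
qed

text \<open>Bolzano-Weierstrass in one coordinate at a time; a further subsequence keeps the limits
  already obtained.\<close>

lemma bounded_coordinates_subseq:
  fixes c :: "nat \<Rightarrow> 'b \<Rightarrow> real"
  assumes "finite B" "\<And>n b. b \<in> B \<Longrightarrow> \<bar>c n b\<bar> \<le> R"
  obtains l r where "strict_mono (r :: nat \<Rightarrow> nat)" "\<And>b. b \<in> B \<Longrightarrow> (\<lambda>n. c (r n) b) \<longlonglongrightarrow> l b"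
proof -
  have "\<exists>l r. strict_mono (r :: nat \<Rightarrow> nat) \<and> (\<forall>b\<in>B. (\<lambda>n. c (r n) b) \<longlonglongrightarrow> l b)"
    using assms
  proof (induction B rule: finite_induct)
    case empty
    show ?case by (auto intro: exI[of _ id] simp: strict_mono_id)
  next
    case (insert b B)
    then obtain l r where lr: "strict_mono (r :: nat \<Rightarrow> nat)" "\<forall>b\<in>B. (\<lambda>n. c (r n) b) \<longlonglongrightarrow> l b"
      by auto
    have "bounded (range (\<lambda>n. c (r n) b))"
      using insert.prems by (auto simp: bounded_iff)
    then obtain m s where s: "strict_mono s" "((\<lambda>n. c (r n) b) \<circ> s) \<longlonglongrightarrow> m"
      using bounded_imp_convergent_subsequence by metis
    show ?case
    proof (intro exI conjI ballI)
      show "strict_mono (r \<circ> s)" using lr(1) s(1) by (rule strict_mono_o)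
      fix b' assume "b' \<in> insert b B"
      then show "(\<lambda>n. c ((r \<circ> s) n) b') \<longlonglongrightarrow> (l(b := m)) b'"
        using s LIMSEQ_subseq_LIMSEQ[OF _ s(1), of "\<lambda>n. c (r n) b'" "l b'"] lr(2) insert.hyps(2)
        by (auto simp: o_def)
    qed
  qed
  then show thesis using that by blast
qed

text \<open>Excess along every ray bounds the sublevel set of \<open>J 0\<close>: if its coordinates
  were unbounded, the normalized directions would accumulate at a nonzero direction, and convexity
  with continuity would keep \<open>J\<close> below \<open>J 0\<close> on that whole ray. A
  minimizing sequence then has a subsequence converging in coordinates.\<close>

lemma convex_on_attains_min:
  fixes J :: "'v::real_vector \<Rightarrow> real"
  assumes S: "subspace S" "finite G" "S \<subseteq> span G"
    and J: "convex_on S J"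
    and rays: "\<And>w M. w \<in> S \<Longrightarrow> w \<noteq> 0 \<Longrightarrow> \<exists>t\<ge>0. J (t *\<^sub>R w) > M"
  shows "\<exists>u\<in>S. \<forall>v\<in>S. J u \<le> J v"
proof -
  obtain B where B: "finite B" "independent B" "S = span B"
    using finite_dim_basis[OF S] by blast
  define \<phi> where "\<phi> c = (\<Sum>b\<in>B. c b *\<^sub>R b)" for c
  have \<phi>_in: "\<phi> c \<in> S" for c unfolding \<phi>_def B(3) by (intro span_sum span_scale span_base)
  have \<phi>_surj: "\<exists>c. v = \<phi> c" if "v \<in> S" for v
    using that span_finite[OF B(1)] unfolding B(3) \<phi>_def by auto
  have \<phi>_scale: "\<phi> (\<lambda>b. t * c b) = t *\<^sub>R \<phi> c" for t c
    by (simp add: \<phi>_def scaleR_sum_right)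
  have BS: "B \<subseteq> S" using B(3) span_superset by blast
  \<comment> \<open>The coordinate bound is a Lipschitz estimate at the point
    \<open>\<phi> l\<close>, which gives continuity of \<open>J\<close> with respect to
    coordinates.\<close>
  have cont: "(\<lambda>n. J (\<phi> (c n))) \<longlonglongrightarrow> J (\<phi> l)" if c: "\<And>b. b \<in> B \<Longrightarrow> (\<lambda>n. c n b) \<longlonglongrightarrow> l b" for c :: "nat \<Rightarrow> _" and l
  proof -
    obtain M where M: "0 \<le> M" "\<And>c. (\<Sum>b\<in>B. \<bar>c b\<bar>) \<le> 1 \<Longrightarrow>
      \<bar>J (\<phi> l + (\<Sum>b\<in>B. c b *\<^sub>R b)) - J (\<phi> l)\<bar> \<le> M * (\<Sum>b\<in>B. \<bar>c b\<bar>)"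
      using convex_on_coordinate_bound[OF J S(1) B(1) BS \<phi>_in[of l]] by blast
    define \<delta> where "\<delta> n = (\<Sum>b\<in>B. \<bar>c n b - l b\<bar>)" for n
    have "\<delta> \<longlonglongrightarrow> (\<Sum>b\<in>B. \<bar>l b - l b\<bar>)" unfolding \<delta>_def using c by (intro tendsto_intros)
    then have \<delta>: "\<delta> \<longlonglongrightarrow> 0" by simp
    have "\<forall>\<^sub>F n in sequentially. norm (J (\<phi> (c n)) - J (\<phi> l)) \<le> M * \<delta> n"
      using order_tendstoD(2)[OF \<delta> zero_less_one]
    proof eventually_elim
      case (elim n)
      have "\<phi> (c n) = \<phi> l + (\<Sum>b\<in>B. (c n b - l b) *\<^sub>R b)"
        by (simp add: \<phi>_def scaleR_left_diff_distrib sum_subtractf)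
      then show ?case using M(2)[of "\<lambda>b. c n b - l b"] elim by (simp add: \<delta>_def)
    qed
    moreover have "(\<lambda>n. M * \<delta> n) \<longlonglongrightarrow> 0" by (rule tendsto_mult_right_zero[OF \<delta>])
    ultimately have "(\<lambda>n. J (\<phi> (c n)) - J (\<phi> l)) \<longlonglongrightarrow> 0" by (rule Lim_null_comparison)
    then show ?thesis by (rule LIM_zero_cancel)
  qed
  have "\<exists>R. \<forall>c. J (\<phi> c) \<le> J 0 \<longrightarrow> (\<Sum>b\<in>B. \<bar>c b\<bar>) \<le> R"
  proof (rule ccontr)
    assume "\<not> ?thesis"
    then have "\<forall>n::nat. \<exists>c. J (\<phi> c) \<le> J 0 \<and> (\<Sum>b\<in>B. \<bar>c b\<bar>) > real n"
      unfolding not_ex not_all not_imp not_le by blast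
    then obtain c where c: "\<And>n. J (\<phi> (c n)) \<le> J 0" "\<And>n. (\<Sum>b\<in>B. \<bar>c n b\<bar>) > real n"
      by metis
    define s where "s n = (\<Sum>b\<in>B. \<bar>c n b\<bar>)" for n
    have s: "s n > real n" "s n > 0" for n using c(2)[of n] by (simp_all add: s_def)
    define d where "d n b = (1 / s n) * c n b" for n b
    have d1: "(\<Sum>b\<in>B. \<bar>d n b\<bar>) = 1" for n
      using s(2)[of n] by (simp add: d_def abs_mult s_def flip: sum_divide_distrib)
    have "\<bar>d n b\<bar> \<le> 1" if "b \<in> B" for n b
      using member_le_sum[of b B "\<lambda>b. \<bar>d n b\<bar>"] that B(1) d1[of n] by simp
    then obtain l r where lr: "strict_mono (r :: nat \<Rightarrow> nat)" "\<And>b. b \<in> B \<Longrightarrow> (\<lambda>n. d (r n) b) \<longlonglongrightarrow> l b"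
      using bounded_coordinates_subseq[OF B(1)] by metis
    have "(\<lambda>n. \<Sum>b\<in>B. \<bar>d (r n) b\<bar>) \<longlonglongrightarrow> (\<Sum>b\<in>B. \<bar>l b\<bar>)" using lr(2) by (intro tendsto_intros)
    then have l1: "(\<Sum>b\<in>B. \<bar>l b\<bar>) = 1" unfolding d1 by (simp add: LIMSEQ_const_iff)
    have "\<phi> l \<noteq> 0"
    proof
      assume "\<phi> l = 0"
      then have "\<forall>b\<in>B. l b = 0"
        using B(1,2) unfolding \<phi>_def by (auto simp: dependent_finite)
      then show False using l1 by simp
    qed
    then obtain t where t: "t \<ge> 0" "J (t *\<^sub>R \<phi> l) > J 0" using rays[OF \<phi>_in] by blast
    have "(\<lambda>n. J (\<phi> (\<lambda>b. t * d (r n) b))) \<longlonglongrightarrow> J (\<phi> (\<lambda>b. t * l b))"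
      using lr(2) by (intro cont tendsto_intros)
    moreover have "\<forall>\<^sub>F n in sequentially. J (\<phi> (\<lambda>b. t * d (r n) b)) \<le> J 0"
      using eventually_ge_at_top[of "nat \<lceil>t\<rceil>"]
    proof eventually_elim
      case (elim n)
      \<comment> \<open>Since \<open>s (r n) > r n \<ge> n \<ge> t\<close>, the point in question
        lies between 0 and \<open>\<phi> (c (r n))\<close>, and \<open>J\<close> is at most
        \<open>J 0\<close> at both ends.\<close>
      have "t \<le> real n" using elim by linarith
      also have "\<dots> \<le> real (r n)" using seq_suble[OF lr(1)] by simp
      finally have "t / s (r n) \<le> 1" using s[of "r n"] by simp
      moreover have "\<phi> (\<lambda>b. t * d (r n) b) = (1 - t / s (r n)) *\<^sub>R 0 + (t / s (r n)) *\<^sub>R \<phi> (c (r n))"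
        unfolding \<phi>_scale[symmetric] by (simp add: d_def)
      moreover have "0 \<le> t / s (r n)" using t(1) s(2)[of "r n"] by simp
      moreover have "0 \<in> S" using S(1) by (rule subspace_0)
      ultimately have "J (\<phi> (\<lambda>b. t * d (r n) b)) \<le> (1 - t / s (r n)) * J 0 + (t / s (r n)) * J (\<phi> (c (r n)))"
        using convex_onD[OF J, of "t / s (r n)" 0 "\<phi> (c (r n))"] \<phi>_in by auto
      also have "\<dots> \<le> (1 - t / s (r n)) * J 0 + (t / s (r n)) * J 0"
        using c(1) \<open>0 \<le> t / s (r n)\<close> by (intro add_left_mono mult_left_mono)
      finally show ?case by (simp add: algebra_simps)
    qed
    ultimately have "J (\<phi> (\<lambda>b. t * l b)) \<le> J 0"
      by (intro tendsto_upperbound) auto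
    then show False using t(2) by (simp add: \<phi>_scale)
  qed
  then obtain R where R: "\<And>c. J (\<phi> c) \<le> J 0 \<Longrightarrow> (\<Sum>b\<in>B. \<bar>c b\<bar>) \<le> R" by blast
  \<comment> \<open>Extended reals supply the infimum before \<open>J\<close> is known to be bounded
    below; its finiteness follows once it is attained.\<close>
  define A where "A = {ereal (J v) | v. v \<in> S \<and> J v \<le> J 0}"
  have "A \<noteq> {}" unfolding A_def using subspace_0[OF S(1)] by auto
  then obtain a where a: "\<forall>n. a n \<in> A" "a \<longlonglongrightarrow> Inf A" using Inf_as_limit by blast
  have "\<exists>c. a n = ereal (J (\<phi> c)) \<and> J (\<phi> c) \<le> J 0" for n :: nat
    using a(1)[rule_format, of n] \<phi>_surj unfolding A_def by blast
  then obtain c where c: "\<And>n. a n = ereal (J (\<phi> (c n)))" "\<And>n. J (\<phi> (c n)) \<le> J 0" by metis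
  have "\<bar>c n b\<bar> \<le> R" if "b \<in> B" for n b
    using member_le_sum[of b B "\<lambda>b. \<bar>c n b\<bar>"] that B(1) R[OF c(2), of n] by simp
  then obtain l r where lr: "strict_mono (r :: nat \<Rightarrow> nat)" "\<And>b. b \<in> B \<Longrightarrow> (\<lambda>n. c (r n) b) \<longlonglongrightarrow> l b"
    using bounded_coordinates_subseq[OF B(1)] by metis
  have "(\<lambda>n. a (r n)) \<longlonglongrightarrow> ereal (J (\<phi> l))"
    unfolding c(1) using cont[OF lr(2)] by simp
  moreover have "(\<lambda>n. a (r n)) \<longlonglongrightarrow> Inf A"
    using LIMSEQ_subseq_LIMSEQ[OF a(2) lr(1)] by (simp add: o_def)
  ultimately have min: "ereal (J (\<phi> l)) = Inf A" by (rule LIMSEQ_unique)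
  have below: "J (\<phi> l) \<le> J v" if "v \<in> S" "J v \<le> J 0" for v
  proof -
    have "Inf A \<le> ereal (J v)" unfolding A_def using that by (intro Inf_lower) auto
    then show ?thesis using min by (metis ereal_less_eq(3))
  qed
  have "J (\<phi> l) \<le> J v" if "v \<in> S" for v
    using below[OF that] below[OF subspace_0[OF S(1)]] by (cases "J v \<le> J 0") auto
  then show ?thesis using \<phi>_in by blast
qed

section \<open>Strict convexity and superlinear growth of \<open>p\<close>-th powers\<close>

lemma powr_gt_tangent:
  fixes s p :: real
  assumes "1 < p" "0 \<le> s" "s \<noteq> 1"
  shows "1 + p * (s - 1) < s powr p"
proof -
  have der: "((\<lambda>s. s powr p) has_real_derivative p * x powr (p - 1)) (at x)" if "x > 0" for x
    using that by (rule has_real_derivative_powr)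
  consider "s = 0" | "0 < s" "s < 1" | "1 < s" using assms by linarith
  then show ?thesis
  proof cases
    case 2
    then obtain z where z: "s < z" "z < 1" "1 powr p - s powr p = (1 - s) * (p * z powr (p - 1))"
      using MVT2[of s 1 "\<lambda>s. s powr p" "\<lambda>x. p * x powr (p - 1)"] der by force
    have "z powr (p - 1) < 1" using z 2 assms(1) powr_less_mono2[of "p - 1" z 1] by auto
    then have "(1 - s) * (p * z powr (p - 1)) < (1 - s) * (p * 1)"
      using 2 assms(1) by (intro mult_strict_left_mono) auto
    then show ?thesis using z(3) by (simp add: algebra_simps)
  next
    case 3
    then obtain z where z: "1 < z" "z < s" "s powr p - 1 powr p = (s - 1) * (p * z powr (p - 1))"
      using MVT2[of 1 s "\<lambda>s. s powr p" "\<lambda>x. p * x powr (p - 1)"] der by force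
    have "1 < z powr (p - 1)" using z assms(1) by (intro gr_one_powr) auto
    then have "(s - 1) * (p * 1) < (s - 1) * (p * z powr (p - 1))"
      using 3 assms(1) by (intro mult_strict_left_mono) auto
    then show ?thesis using z(3) by (simp add: algebra_simps)
  qed (use assms in auto)
qed

text \<open>Add the strict tangent inequalities at the midpoint \<open>m > 0\<close> for both
  arguments; the linear parts cancel because \<open>a / m + b / m = 2\<close>. This also covers a
  vanishing argument.\<close>

lemma powr_midpoint_less:
  fixes a b p :: real
  assumes "1 < p" "0 \<le> a" "0 \<le> b" "a \<noteq> b"
  shows "((a + b) / 2) powr p < (a powr p + b powr p) / 2"
proof -
  define m where "m = (a + b) / 2"
  have m: "m > 0" using assms by (auto simp: m_def)
  have tangent: "m powr p * (1 + p * (x / m - 1)) < x powr p" if "x \<ge> 0" "x \<noteq> m" for x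
  proof -
    have "1 + p * (x / m - 1) < (x / m) powr p"
      using that m assms(1) by (intro powr_gt_tangent) auto
    then have "m powr p * (1 + p * (x / m - 1)) < m powr p * (x / m) powr p"
      using m by (intro mult_strict_left_mono) auto
    then show ?thesis using that(1) m by (simp add: powr_divide)
  qed
  have "m powr p * (1 + p * (a / m - 1)) + m powr p * (1 + p * (b / m - 1)) < a powr p + b powr p"
    using assms by (intro add_strict_mono tangent) (auto simp: m_def)
  moreover have "a + b = 2 * m" by (simp add: m_def)
  then have "a / m + b / m = 2" using m unfolding add_divide_distrib[symmetric] by simp
  then have bm: "b / m = 2 - a / m" by simp
  have "m powr p * (1 + p * (r - 1)) + m powr p * (1 + p * (2 - r - 1)) = 2 * m powr p" for r
    by (simp add: algebra_simps)
  then have "m powr p * (1 + p * (a / m - 1)) + m powr p * (1 + p * (b / m - 1)) = 2 * m powr p"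
    unfolding bm .
  ultimately show ?thesis by (simp add: m_def)
qed

text \<open>\<open>powr_convex\<close> is applied to positive arguments. If one argument is 0, the
  claim reduces to \<open>r powr p \<le> r\<close> for \<open>r\<close> in the unit
  interval.\<close>

lemma powr_convex_nonneg:
  fixes a b p s :: real
  assumes p: "1 \<le> p" and "0 \<le> a" "0 \<le> b" "0 \<le> s" "s \<le> 1"
  shows "((1 - s) * a + s * b) powr p \<le> (1 - s) * a powr p + s * b powr p"
proof -
  have scale: "(r * x) powr p \<le> r * x powr p" if "0 \<le> r" "r \<le> 1" "0 \<le> x" for r x :: real
  proof -
    have "r powr p \<le> r"
      using that p powr_mono'[of 1 p r] by (cases "r = 0") auto
    then show ?thesis using that by (simp add: powr_mult mult_right_mono)
  qed
  consider "a = 0" | "b = 0" | "a > 0" "b > 0" using assms by linarith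
  then show ?thesis
  proof cases
    case 3
    then show ?thesis
      using convex_onD[OF powr_convex[OF p], of s a b] assms by simp
  qed (use assms scale[of s b] scale[of "1 - s" a] in auto)
qed

lemma norm_powr_convex:
  fixes x y :: "'e::real_normed_vector"
  assumes "1 \<le> p" "0 \<le> s" "s \<le> 1"
  shows "norm ((1 - s) *\<^sub>R x + s *\<^sub>R y) powr p \<le> (1 - s) * norm x powr p + s * norm y powr p"
proof -
  have "norm ((1 - s) *\<^sub>R x + s *\<^sub>R y) \<le> (1 - s) * norm x + s * norm y"
    using norm_triangle_ineq[of "(1 - s) *\<^sub>R x" "s *\<^sub>R y"] assms by simp
  then have "norm ((1 - s) *\<^sub>R x + s *\<^sub>R y) powr p \<le> ((1 - s) * norm x + s * norm y) powr p"
    using assms by (intro powr_mono2) auto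
  then show ?thesis using powr_convex_nonneg[of p "norm x" "norm y" s] assms by simp
qed

text \<open>For equal norms the scalar inequality is not strict, and strictness comes from the
  parallelogram law, hence the inner product. For different norms the triangle inequality reduces
  the claim to \<open>powr_midpoint_less\<close>.\<close>

lemma norm_powr_midpoint_less:
  fixes x y :: "'e::real_inner"
  assumes p: "1 < p" and "x \<noteq> y"
  shows "norm ((1/2) *\<^sub>R x + (1/2) *\<^sub>R y) powr p < (norm x powr p + norm y powr p) / 2"
proof (cases "norm x = norm y")
  case True
  have "(norm ((1/2) *\<^sub>R x + (1/2) *\<^sub>R y))\<^sup>2 < (norm x)\<^sup>2"
  proof -
    have "(norm (x + y))\<^sup>2 + (norm (x - y))\<^sup>2 = 2 * (norm x)\<^sup>2 + 2 * (norm y)\<^sup>2"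
      by (simp add: power2_norm_eq_inner inner_simps inner_commute)
    moreover have "(norm (x - y))\<^sup>2 > 0" using assms(2) by simp
    moreover have "(norm ((1/2) *\<^sub>R x + (1/2) *\<^sub>R y))\<^sup>2 = (norm (x + y))\<^sup>2 / 4"
      by (simp add: power_divide flip: scaleR_add_right)
    ultimately show ?thesis unfolding True by linarith
  qed
  then have "norm ((1/2) *\<^sub>R x + (1/2) *\<^sub>R y) < norm x"
    by (rule power2_less_imp_less) simp
  then have "norm ((1/2) *\<^sub>R x + (1/2) *\<^sub>R y) powr p < norm x powr p"
    using p by (intro powr_less_mono2) auto
  then show ?thesis using True by simp
next
  case False
  have "norm ((1/2) *\<^sub>R x + (1/2) *\<^sub>R y) \<le> (norm x + norm y) / 2"
    using norm_triangle_ineq[of "(1/2) *\<^sub>R x" "(1/2) *\<^sub>R y"] by simp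
  then have "norm ((1/2) *\<^sub>R x + (1/2) *\<^sub>R y) powr p \<le> ((norm x + norm y) / 2) powr p"
    using p by (intro powr_mono2) auto
  then show ?thesis using powr_midpoint_less[of p "norm x" "norm y"] p False by simp
qed

lemma norm_diff_powr_le:
  fixes x y :: "'e::real_normed_vector"
  assumes "0 \<le> p"
  shows "norm (x - y) powr p \<le> 2 powr p * (norm x powr p + norm y powr p)"
proof -
  have "norm (x - y) powr p \<le> (2 * max (norm x) (norm y)) powr p"
    using assms norm_triangle_ineq4[of x y] by (intro powr_mono2) auto
  also have "\<dots> = 2 powr p * max (norm x) (norm y) powr p"
    by (simp add: powr_mult)
  also have "\<dots> \<le> 2 powr p * (norm x powr p + norm y powr p)"
    by (intro mult_left_mono) (auto simp: max_def)
  finally show ?thesis .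
qed

lemma powr_superlinear:
  fixes p q C l M :: real
  assumes "1 < p" "0 < q"
  shows "\<exists>t\<ge>0. q * t powr p - C - t * l > M"
proof -
  \<comment> \<open>Chosen so that \<open>t \<ge> 1\<close> and
    \<open>t powr (p - 1) \<ge> X\<close> make the leading term at least \<open>t\<close> times the
    sum of all competing quantities; the extra 1 gives strictness.\<close>
  define X where "X = (\<bar>l\<bar> + \<bar>M\<bar> + \<bar>C\<bar> + 1) / q"
  define t where "t = max 1 (X powr (1 / (p - 1)))"
  have X: "0 < X" using assms(2) by (auto simp: X_def intro!: divide_pos_pos)
  have t: "1 \<le> t" by (simp add: t_def)
  have "X = (X powr (1 / (p - 1))) powr (p - 1)" using X assms(1) by (simp add: powr_powr)
  also have "\<dots> \<le> t powr (p - 1)" using assms(1) by (intro powr_mono2) (auto simp: t_def)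
  finally have "\<bar>l\<bar> + \<bar>M\<bar> + \<bar>C\<bar> + 1 \<le> q * t powr (p - 1)"
    using assms(2) by (simp add: X_def field_simps)
  then have "t * (\<bar>l\<bar> + \<bar>M\<bar> + \<bar>C\<bar> + 1) \<le> t * (q * t powr (p - 1))"
    using t by (intro mult_left_mono) auto
  also have "\<dots> = q * t powr p" using t powr_mult_base[of t "p - 1"] by (simp add: algebra_simps)
  finally have "t * \<bar>l\<bar> + t * (\<bar>M\<bar> + \<bar>C\<bar> + 1) \<le> q * t powr p" by (simp add: algebra_simps)
  moreover have "\<bar>M\<bar> + \<bar>C\<bar> + 1 \<le> t * (\<bar>M\<bar> + \<bar>C\<bar> + 1)"
    using t mult_right_mono[of 1 t "\<bar>M\<bar> + \<bar>C\<bar> + 1"] by simp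
  moreover have "t * l \<le> t * \<bar>l\<bar>" using t by (intro mult_left_mono) auto
  moreover have "M \<le> \<bar>M\<bar>" "C \<ge> - \<bar>C\<bar>" "C \<le> \<bar>C\<bar>" by auto
  ultimately have "q * t powr p - C - t * l > M" by linarith
  then show ?thesis using t by (intro exI[of _ t]) auto
qed

text \<open>Each index stands for one integral of the energy. The maps \<open>a j\<close> are affine
  rather than linear because the Dirichlet data enter them. Individual terms may be degenerate;
  \<open>sep\<close> says that jointly they are not, and it is the source of both growth and
  uniqueness.\<close>

theorem ex1_minimizer_p_energy:
  fixes a :: "'j \<Rightarrow> 'v::real_vector \<Rightarrow> 'x \<Rightarrow> 'e::euclidean_space" and M :: "'j \<Rightarrow> 'x measure"
  assumes S: "subspace S" "finite G" "S \<subseteq> span G" and I: "finite I" and p: "1 < p"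
    and c: "\<And>j. j \<in> I \<Longrightarrow> 0 < c j"
    and aff: "\<And>j u v s x. j \<in> I \<Longrightarrow> u \<in> S \<Longrightarrow> v \<in> S \<Longrightarrow>
      a j ((1 - s) *\<^sub>R u + s *\<^sub>R v) x = (1 - s) *\<^sub>R a j u x + s *\<^sub>R a j v x"
    and meas: "\<And>j v. j \<in> I \<Longrightarrow> v \<in> S \<Longrightarrow> a j v \<in> borel_measurable (M j)"
    and int: "\<And>j v. j \<in> I \<Longrightarrow> v \<in> S \<Longrightarrow> integrable (M j) (\<lambda>x. norm (a j v x) powr p)"
    and sep: "\<And>u v. u \<in> S \<Longrightarrow> v \<in> S \<Longrightarrow> (\<And>j. j \<in> I \<Longrightarrow> AE x in M j. a j u x = a j v x) \<Longrightarrow> u = v"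
    and ladd: "\<And>u v. u \<in> S \<Longrightarrow> v \<in> S \<Longrightarrow> L (u + v) = L u + L v"
    and lscale: "\<And>s u. u \<in> S \<Longrightarrow> L (s *\<^sub>R u) = s * (L u :: real)"
    and \<Phi>: "\<And>v. v \<in> S \<Longrightarrow> \<Phi> v = (\<Sum>j\<in>I. c j * (\<integral>x. norm (a j v x) powr p \<partial>M j)) - L v"
  shows "\<exists>!u. u \<in> S \<and> (\<forall>v\<in>S. \<Phi> u \<le> \<Phi> v)"
proof -
  define E where "E j v = (\<integral>x. norm (a j v x) powr p \<partial>M j)" for j v
  have comb: "(1 - s) *\<^sub>R u + s *\<^sub>R v \<in> S" if "u \<in> S" "v \<in> S" for u v s
    using S(1) that by (intro subspace_add subspace_scale)
  have L_comb: "L ((1 - s) *\<^sub>R u + s *\<^sub>R v) = (1 - s) * L u + s * L v" if "u \<in> S" "v \<in> S" for u v s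
    using that S(1) by (simp add: ladd lscale subspace_scale)
  have E_conv: "E j ((1 - s) *\<^sub>R u + s *\<^sub>R v) \<le> (1 - s) * E j u + s * E j v"
    if j: "j \<in> I" and uv: "u \<in> S" "v \<in> S" and s: "0 \<le> s" "s \<le> 1" for j u v s
  proof -
    have "E j ((1 - s) *\<^sub>R u + s *\<^sub>R v) \<le>
        (\<integral>x. (1 - s) * norm (a j u x) powr p + s * norm (a j v x) powr p \<partial>M j)"
      unfolding E_def
    proof (rule integral_mono)
      show "norm (a j ((1 - s) *\<^sub>R u + s *\<^sub>R v) x) powr p \<le>
          (1 - s) * norm (a j u x) powr p + s * norm (a j v x) powr p" for x
        unfolding aff[OF j uv] using p s by (intro norm_powr_convex) auto
    qed (use int[OF j] uv comb in auto)
    also have "\<dots> = (1 - s) * E j u + s * E j v"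
      unfolding E_def using int[OF j] uv by simp
    finally show ?thesis .
  qed
  \<comment> \<open>The convexity defect \<open>g\<close> is nonnegative with integral zero, so it
    vanishes almost everywhere, and it is positive wherever the two values differ.\<close>
  have E_strict: "AE x in M j. a j u x = a j v x"
    if j: "j \<in> I" and uv: "u \<in> S" "v \<in> S"
      and eq: "E j ((1/2) *\<^sub>R u + (1/2) *\<^sub>R v) = (E j u + E j v) / 2" for j u v
  proof -
    define g where "g x = (norm (a j u x) powr p + norm (a j v x) powr p) / 2 -
        norm (a j ((1/2) *\<^sub>R u + (1/2) *\<^sub>R v) x) powr p" for x
    have mid: "(1/2) *\<^sub>R u + (1/2) *\<^sub>R v \<in> S" using comb[OF uv, of "1/2"] by simp
    have a_mid: "a j ((1/2) *\<^sub>R u + (1/2) *\<^sub>R v) x = (1/2) *\<^sub>R a j u x + (1/2) *\<^sub>R a j v x" for x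
      using aff[OF j uv, of "1/2"] by simp
    have g0: "0 \<le> g x" for x
      using norm_powr_convex[of p "1/2" "a j u x" "a j v x"] p by (simp add: g_def a_mid)
    have gint: "integrable (M j) g" unfolding g_def using int[OF j] uv mid by simp
    have "integral\<^sup>L (M j) g = (E j u + E j v) / 2 - E j ((1/2) *\<^sub>R u + (1/2) *\<^sub>R v)"
      unfolding g_def E_def using int[OF j] uv mid by simp
    then have "integral\<^sup>L (M j) g = 0" using eq by simp
    then have "AE x in M j. g x = 0"
      using integral_nonneg_eq_0_iff_AE[OF gint] g0 by simp
    then show ?thesis
    proof eventually_elim
      case (elim x)
      then show ?case using norm_powr_midpoint_less[OF p, of "a j u x" "a j v x"]
        by (cases "a j u x = a j v x") (auto simp: g_def a_mid)
    qed
  qed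
  have \<Phi>_eq: "\<Phi> v = (\<Sum>j\<in>I. c j * E j v) - L v" if "v \<in> S" for v using \<Phi>[OF that] by (simp add: E_def)
  have \<Phi>_conv: "\<Phi> ((1 - s) *\<^sub>R u + s *\<^sub>R v) \<le> (1 - s) * \<Phi> u + s * \<Phi> v"
    if uv: "u \<in> S" "v \<in> S" and s: "0 \<le> s" "s \<le> 1" for u v s
  proof -
    have "(\<Sum>j\<in>I. c j * E j ((1 - s) *\<^sub>R u + s *\<^sub>R v)) \<le> (\<Sum>j\<in>I. c j * ((1 - s) * E j u + s * E j v))"
      using E_conv uv s c by (intro sum_mono mult_left_mono) (auto simp: less_imp_le)
    also have "\<dots> = (1 - s) * (\<Sum>j\<in>I. c j * E j u) + s * (\<Sum>j\<in>I. c j * E j v)"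
      by (simp add: sum_distrib_left sum.distrib[symmetric] algebra_simps)
    finally show ?thesis
      unfolding \<Phi>_eq[OF comb[OF uv]] \<Phi>_eq[OF uv(1)] \<Phi>_eq[OF uv(2)] L_comb[OF uv]
      by (simp add: right_diff_distrib)
  qed
  have conv: "convex_on S \<Phi>"
    using \<Phi>_conv S(1) by (intro convex_onI subspace_imp_convex) auto
  have "\<exists>t\<ge>0. \<Phi> (t *\<^sub>R w) > K" if w: "w \<in> S" "w \<noteq> 0" for w K
  proof -
    have S0: "0 \<in> S" using S(1) by (rule subspace_0)
    define N where "N j = (\<integral>x. norm (a j w x - a j 0 x) powr p \<partial>M j)" for j
    have Nint: "integrable (M j) (\<lambda>x. norm (a j w x - a j 0 x) powr p)" if j: "j \<in> I" for j
    proof (rule Bochner_Integration.integrable_bound)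
      show "integrable (M j) (\<lambda>x. 2 powr p * (norm (a j w x) powr p + norm (a j 0 x) powr p))"
        using int[OF j] w(1) S0 by simp
      show "(\<lambda>x. norm (a j w x - a j 0 x) powr p) \<in> borel_measurable (M j)"
        using meas[OF j w(1)] meas[OF j S0] by measurable
      show "AE x in M j. norm (norm (a j w x - a j 0 x) powr p) \<le>
          norm (2 powr p * (norm (a j w x) powr p + norm (a j 0 x) powr p))"
        using norm_diff_powr_le[of p] p by auto
    qed
    have N0: "0 \<le> N j" for j unfolding N_def by simp
    \<comment> \<open>Affinity makes the increment \<open>a j (t *\<^sub>R w) x - a j 0 x\<close>
      exactly \<open>t\<close> times the one for \<open>w\<close>, so its \<open>p\<close>-th power
      scales by \<open>t powr p\<close>; the factor \<open>2 powr p\<close> is the price of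
      splitting the difference.\<close>
    have growth: "t powr p * N j \<le> 2 powr p * (E j (t *\<^sub>R w) + E j 0)" if j: "j \<in> I" and t: "0 \<le> t" for j t
    proof -
      have tw: "t *\<^sub>R w \<in> S" using S(1) w(1) by (rule subspace_scale)
      have diff: "t *\<^sub>R (a j w x - a j 0 x) = a j (t *\<^sub>R w) x - a j 0 x" for x
        using aff[OF j S0 w(1), of t x] by (simp add: algebra_simps)
      have "t powr p * N j = (\<integral>x. norm (a j (t *\<^sub>R w) x - a j 0 x) powr p \<partial>M j)"
        unfolding N_def using t by (simp add: powr_mult flip: diff)
      also have "\<dots> \<le> (\<integral>x. 2 powr p * (norm (a j (t *\<^sub>R w) x) powr p + norm (a j 0 x) powr p) \<partial>M j)"
      proof (rule integral_mono)
        have "integrable (M j) (\<lambda>x. t powr p * norm (a j w x - a j 0 x) powr p)"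
          using Nint[OF j] by simp
        then show "integrable (M j) (\<lambda>x. norm (a j (t *\<^sub>R w) x - a j 0 x) powr p)"
          using t by (simp add: powr_mult flip: diff)
      qed (use int[OF j] tw S0 p norm_diff_powr_le[of p] in auto)
      also have "\<dots> = 2 powr p * (E j (t *\<^sub>R w) + E j 0)"
        unfolding E_def using int[OF j] tw S0 by simp
      finally show ?thesis .
    qed
    \<comment> \<open>One index with a nonzero increment is enough, as all other terms are
      nonnegative.\<close>
    obtain i where i: "i \<in> I" "\<not> (AE x in M i. a i w x = a i 0 x)"
      using sep[OF w(1) S0] w(2) by blast
    have "N i \<noteq> 0"
    proof
      assume "N i = 0"
      then have "AE x in M i. norm (a i w x - a i 0 x) powr p = 0"
        using integral_nonneg_eq_0_iff_AE[OF Nint[OF i(1)]] by (simp add: N_def)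
      then show False using i(2) by simp
    qed
    then have "0 < c i * N i" using c[OF i(1)] N0[of i] by simp
    then have pos: "0 < (\<Sum>j\<in>I. c j * N j)"
      using I i(1) c N0 by (intro sum_pos2[of I i]) (auto simp: less_imp_le)
    define q where "q = (\<Sum>j\<in>I. c j * N j) / 2 powr p"
    have q: "0 < q" using pos by (simp add: q_def)
    obtain t where t: "t \<ge> 0" "q * t powr p - (\<Sum>j\<in>I. c j * E j 0) - t * L w > K"
      using powr_superlinear[OF p q] by blast
    have "q * t powr p = (\<Sum>j\<in>I. c j * ((t powr p * N j) / 2 powr p))"
      by (simp add: q_def sum_distrib_left sum_divide_distrib mult_ac)
    also have "\<dots> \<le> (\<Sum>j\<in>I. c j * (E j (t *\<^sub>R w) + E j 0))"
      using growth t(1) c by (intro sum_mono mult_left_mono) (auto simp: field_simps less_imp_le)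
    finally have "q * t powr p \<le> (\<Sum>j\<in>I. c j * E j (t *\<^sub>R w)) + (\<Sum>j\<in>I. c j * E j 0)"
      by (simp add: sum.distrib algebra_simps)
    then have "\<Phi> (t *\<^sub>R w) > K"
      using t(2) w(1) S(1) by (simp add: \<Phi>_eq lscale subspace_scale)
    then show ?thesis using t(1) by blast
  qed
  then obtain u where u: "u \<in> S" "\<And>v. v \<in> S \<Longrightarrow> \<Phi> u \<le> \<Phi> v"
    using convex_on_attains_min[OF S conv] by blast
  have "u' = u" if u': "u' \<in> S" "\<And>v. v \<in> S \<Longrightarrow> \<Phi> u' \<le> \<Phi> v" for u'
  proof (rule sep[OF u'(1) u(1)])
    \<comment> \<open>The midpoint of two minimizers cannot have lower energy, so the summed
      convexity inequality is an equality, and hence so is every summand; positivity of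
      \<open>c j\<close> then removes the weights.\<close>
    let ?m = "(1/2) *\<^sub>R u' + (1/2) *\<^sub>R u"
    have m: "?m \<in> S" using comb[OF u'(1) u(1), of "1/2"] by simp
    have le: "c j * E j ?m \<le> c j * ((E j u' + E j u) / 2)" if "j \<in> I" for j
      using E_conv[OF that u'(1) u(1), of "1/2"] c[OF that] by (intro mult_left_mono) auto
    have "\<Phi> u' = \<Phi> u" using u u' by (intro antisym) auto
    then have "(\<Phi> u' + \<Phi> u) / 2 \<le> \<Phi> ?m" using u(2)[OF m] by simp
    then have "((\<Sum>j\<in>I. c j * E j u') + (\<Sum>j\<in>I. c j * E j u)) / 2 \<le> (\<Sum>j\<in>I. c j * E j ?m)"
      using L_comb[OF u'(1) u(1), of "1/2"]
      unfolding \<Phi>_eq[OF m] \<Phi>_eq[OF u(1)] \<Phi>_eq[OF u'(1)] by (simp add: diff_divide_distrib add_divide_distrib)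
    then have "(\<Sum>j\<in>I. c j * ((E j u' + E j u) / 2)) \<le> (\<Sum>j\<in>I. c j * E j ?m)"
      by (simp add: sum.distrib[symmetric] sum_divide_distrib algebra_simps)
    then have "(\<Sum>j\<in>I. c j * E j ?m) = (\<Sum>j\<in>I. c j * ((E j u' + E j u) / 2))"
      using sum_mono[of I, OF le] by (intro antisym) auto
    then have "\<And>j. j \<in> I \<Longrightarrow> c j * E j ?m = c j * ((E j u' + E j u) / 2)"
      by (rule sum_mono_inv[OF _ le _ I])
    then have "E j ?m = (E j u' + E j u) / 2" if "j \<in> I" for j
      using that c[OF that] by (metis less_irrefl mult_cancel_left)
    then show "AE x in M j. a j u' x = a j u x" if "j \<in> I" for j
      using E_strict[OF that u'(1) u(1)] that by blast
  qed
  then show ?thesis using u by blast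
qed


section \<open>Polynomials\<close>

definition monom_fun :: "('n::finite \<Rightarrow> nat) \<Rightarrow> real^'n \<Rightarrow> real" where
  "monom_fun \<alpha> x = (\<Prod>i\<in>UNIV. (x $ i) ^ \<alpha> i)"

lemma finite_multi_indices: "finite {\<alpha> :: 'n::finite \<Rightarrow> nat. (\<Sum>i\<in>UNIV. \<alpha> i) \<le> k}"
proof (rule finite_subset)
  show "{\<alpha> :: 'n \<Rightarrow> nat. (\<Sum>i\<in>UNIV. \<alpha> i) \<le> k} \<subseteq> (\<Pi>\<^sub>E i\<in>UNIV. {..k})"
  proof
    fix \<alpha> :: "'n \<Rightarrow> nat" assume "\<alpha> \<in> {\<alpha>. (\<Sum>i\<in>UNIV. \<alpha> i) \<le> k}"
    then have "\<alpha> i \<le> k" for i using member_le_sum[of i UNIV \<alpha>] by simp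
    then show "\<alpha> \<in> (\<Pi>\<^sub>E i\<in>UNIV. {..k})" by auto
  qed
  show "finite (\<Pi>\<^sub>E i\<in>(UNIV :: 'n set). {..k})" by (intro finite_PiE) auto
qed

text \<open>Source of the subspace property, of a finite spanning set and of induction over
  monomials.\<close>

lemma poly_fun_eq_span:
  "poly_fun k = span (monom_fun ` {\<alpha> :: 'n::finite \<Rightarrow> nat. (\<Sum>i\<in>UNIV. \<alpha> i) \<le> k})" (is "_ = span (_ ` ?A)")
proof
  show "poly_fun k \<subseteq> span (monom_fun ` ?A)"
  proof
    fix q :: "real^'n \<Rightarrow> real" assume "q \<in> poly_fun k"
    then obtain c where "\<forall>x. q x = (\<Sum>\<alpha>\<in>?A. c \<alpha> * monom_fun \<alpha> x)"
      by (auto simp: poly_fun_def monom_fun_def)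
    then have "q = (\<Sum>\<alpha>\<in>?A. c \<alpha> *\<^sub>R monom_fun \<alpha>)"
      by (auto simp: fun_eq_iff sum_fun_apply)
    then show "q \<in> span (monom_fun ` ?A)" by (auto intro!: span_sum span_scale intro: span_base)
  qed
  have "subspace (poly_fun k :: (real^'n \<Rightarrow> real) set)"
  proof (rule subspaceI)
    show "0 \<in> (poly_fun k :: (real^'n \<Rightarrow> real) set)"
      by (auto simp: poly_fun_def intro!: exI[of _ "\<lambda>_. 0"])
    show "q + r \<in> poly_fun k" if qr: "q \<in> poly_fun k" "r \<in> poly_fun k" for q r :: "real^'n \<Rightarrow> real"
    proof -
      obtain c d where "\<forall>x. q x = (\<Sum>\<alpha>\<in>?A. c \<alpha> * monom_fun \<alpha> x)" "\<forall>x. r x = (\<Sum>\<alpha>\<in>?A. d \<alpha> * monom_fun \<alpha> x)"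
        using qr by (auto simp: poly_fun_def monom_fun_def)
      then have "\<forall>x. (q + r) x = (\<Sum>\<alpha>\<in>?A. (c \<alpha> + d \<alpha>) * monom_fun \<alpha> x)"
        by (simp add: sum.distrib distrib_right)
      then show ?thesis unfolding poly_fun_def monom_fun_def mem_Collect_eq
        by (intro exI[of _ "\<lambda>\<alpha>. c \<alpha> + d \<alpha>"])
    qed
    show "s *\<^sub>R q \<in> poly_fun k" if q: "q \<in> poly_fun k" for s and q :: "real^'n \<Rightarrow> real"
    proof -
      obtain c where "\<forall>x. q x = (\<Sum>\<alpha>\<in>?A. c \<alpha> * monom_fun \<alpha> x)"
        using q by (auto simp: poly_fun_def monom_fun_def)
      then have "\<forall>x. (s *\<^sub>R q) x = (\<Sum>\<alpha>\<in>?A. (s * c \<alpha>) * monom_fun \<alpha> x)"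
        by (simp add: sum_distrib_left mult_ac)
      then show ?thesis unfolding poly_fun_def monom_fun_def mem_Collect_eq
        by (intro exI[of _ "\<lambda>\<alpha>. s * c \<alpha>"])
    qed
  qed
  moreover have "monom_fun \<alpha> \<in> poly_fun k" if "\<alpha> \<in> ?A" for \<alpha>
    unfolding poly_fun_def mem_Collect_eq
  proof (intro exI allI)
    fix x :: "real^'n"
    show "monom_fun \<alpha> x = (\<Sum>\<beta>\<in>?A. (if \<beta> = \<alpha> then 1 else 0) * (\<Prod>i\<in>UNIV. (x $ i) ^ \<beta> i))"
      using that finite_multi_indices[of k, where 'n='n] by (simp add: if_distrib if_distribR monom_fun_def sum.delta cong: if_cong)
  qed
  ultimately show "span (monom_fun ` ?A) \<subseteq> poly_fun k"
    by (intro span_minimal) auto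
qed

lemma subspace_poly_fun: "subspace (poly_fun k)"
  by (simp add: poly_fun_eq_span)

lemma monom_fun_in_poly_fun: "(\<Sum>i\<in>UNIV. \<alpha> i) \<le> k \<Longrightarrow> monom_fun \<alpha> \<in> poly_fun k"
  unfolding poly_fun_eq_span by (auto intro: span_base)

lemma poly_fun_induct [consumes 1, case_names zero add monom]:
  assumes "q \<in> poly_fun k"
    and zero: "P 0" and add: "\<And>q r. P q \<Longrightarrow> P r \<Longrightarrow> P (q + r)"
    and monom: "\<And>c \<alpha>. (\<Sum>i\<in>UNIV. \<alpha> i) \<le> k \<Longrightarrow> P (c *\<^sub>R monom_fun \<alpha>)"
  shows "P q"
proof -
  have "q \<in> span (monom_fun ` {\<alpha>. (\<Sum>i\<in>UNIV. \<alpha> i) \<le> k})"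
    using assms(1) by (simp add: poly_fun_eq_span)
  then show ?thesis
  proof (rule span_induct_alt[where h = P])
    show "P (c *\<^sub>R m + r)" if "m \<in> monom_fun ` {\<alpha>. (\<Sum>i\<in>UNIV. \<alpha> i) \<le> k}" "P r" for c m r
      using that by (auto intro: add monom)
  qed (rule zero)
qed

lemma real_polynomial_function_monom_fun: "real_polynomial_function (monom_fun \<alpha>)"
  unfolding monom_fun_def[abs_def]
  by (intro real_polynomial_function_prod real_polynomial_function_power)
     (auto intro!: real_polynomial_function.intros(1) simp: bounded_linear_vec_nth)

lemma real_polynomial_function_poly_fun:
  assumes "q \<in> poly_fun k"
  shows "real_polynomial_function q"
  using assms
proof (induction rule: poly_fun_induct)
  case zero
  then show ?case by (simp add: zero_fun_def real_polynomial_function.intros(2))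
next
  case (add q r)
  then show ?case by (simp add: plus_fun_def real_polynomial_function.intros(3))
next
  case (monom c \<alpha>)
  have "real_polynomial_function (\<lambda>x. c * monom_fun \<alpha> x)"
    by (intro real_polynomial_function.intros(4) real_polynomial_function.intros(2) real_polynomial_function_monom_fun)
  then show ?case by (simp add: scaleR_fun_def)
qed

lemma continuous_on_poly_fun: "q \<in> poly_fun k \<Longrightarrow> continuous_on S q"
  using real_polynomial_function_poly_fun
  by (metis continuous_on_polymonial_function real_polynomial_function_eq)

lemma differentiable_poly_fun: "q \<in> poly_fun k \<Longrightarrow> q differentiable (at x)"
  using real_polynomial_function_poly_fun differentiable_at_real_polynomial_function by blast

section \<open>Gradients of polynomials\<close>

lemma grad_eqI: "(q has_derivative D) (at x) \<Longrightarrow> grad q x $ i = D (axis i 1)"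
  using frechet_derivative_at by (fastforce simp: grad_def)

lemma grad_eq_on_open:
  assumes "open U" "x \<in> U" "\<And>y. y \<in> U \<Longrightarrow> q y = r y" "r differentiable (at x)"
  shows "grad q x = grad r x"
proof -
  obtain D where D: "(r has_derivative D) (at x)" using assms(4) by (auto simp: differentiable_def)
  then have "(q has_derivative D) (at x)"
    using has_derivative_transform_within_open[OF D assms(1,2)] assms(3) by fastforce
  then show ?thesis using D by (simp add: vec_eq_iff grad_eqI)
qed

lemma grad_add:
  assumes "q differentiable (at x)" "r differentiable (at x)"
  shows "grad (q + r) x = grad q x + grad r x"
proof -
  obtain D D' where D: "(q has_derivative D) (at x)" "(r has_derivative D') (at x)"
    using assms by (auto simp: differentiable_def)
  then have "((q + r) has_derivative (\<lambda>h. D h + D' h)) (at x)"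
    unfolding plus_fun_def by (rule has_derivative_add)
  then show ?thesis using D by (simp add: vec_eq_iff grad_eqI)
qed

lemma grad_scaleR:
  assumes "q differentiable (at x)"
  shows "grad (c *\<^sub>R q) x = c *\<^sub>R grad q x"
proof -
  obtain D where D: "(q has_derivative D) (at x)"
    using assms by (auto simp: differentiable_def)
  then have "((c *\<^sub>R q) has_derivative (\<lambda>h. c *\<^sub>R D h)) (at x)"
    unfolding scaleR_fun_def by (rule has_derivative_scaleR_right)
  then show ?thesis using D by (simp add: vec_eq_iff grad_eqI)
qed

text \<open>The subtraction is truncated: for \<open>\<alpha> i = 0\<close> the exponent stays 0,
  and the factor \<open>real (\<alpha> i)\<close> makes the right-hand side vanish as it
  should.\<close>

lemma grad_monom_fun: "grad (monom_fun \<alpha>) x $ i = real (\<alpha> i) * monom_fun (\<alpha>(i := \<alpha> i - 1)) x"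
proof -
  have "(monom_fun \<alpha> has_derivative (\<lambda>y. \<Sum>j\<in>UNIV. (real (\<alpha> j) * (y $ j) * (x $ j) ^ (\<alpha> j - 1)) *
      (\<Prod>l\<in>UNIV - {j}. (x $ l) ^ \<alpha> l))) (at x)"
    unfolding monom_fun_def[abs_def]
  proof (rule has_derivative_prod)
    fix j
    have "((\<lambda>x::real^'a. x $ j) has_derivative (\<lambda>x. x $ j)) (at x)"
      by (intro bounded_linear.has_derivative[OF bounded_linear_vec_nth] has_derivative_ident)
    from has_derivative_power[OF this]
    show "((\<lambda>x. (x $ j) ^ \<alpha> j) has_derivative (\<lambda>y. real (\<alpha> j) * (y $ j) * (x $ j) ^ (\<alpha> j - 1))) (at x)"
      by simp
  qed
  from grad_eqI[OF this, of i]
  have "grad (monom_fun \<alpha>) x $ i = (\<Sum>j\<in>UNIV. (real (\<alpha> j) * (axis i 1 $ j) * (x $ j) ^ (\<alpha> j - 1)) *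
      (\<Prod>l\<in>UNIV - {j}. (x $ l) ^ \<alpha> l))" .
  also have "\<dots> = (\<Sum>j\<in>UNIV. if j = i then
      real (\<alpha> j) * (x $ j) ^ (\<alpha> j - 1) * (\<Prod>l\<in>UNIV - {j}. (x $ l) ^ \<alpha> l) else 0)"
    by (intro sum.cong refl) (simp add: axis_def)
  also have "\<dots> = real (\<alpha> i) * ((x $ i) ^ (\<alpha> i - 1) * (\<Prod>l\<in>UNIV - {i}. (x $ l) ^ \<alpha> l))"
    by simp
  also have "(x $ i) ^ (\<alpha> i - 1) * (\<Prod>l\<in>UNIV - {i}. (x $ l) ^ \<alpha> l) = monom_fun (\<alpha>(i := \<alpha> i - 1)) x"
    unfolding monom_fun_def by (subst prod.remove[of UNIV i]) (auto intro!: prod.cong)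
  finally show ?thesis .
qed

text \<open>Lowering one exponent never raises the total degree. This makes broken gradients of
  members of \<open>V_h\<close> admissible test functions for the discrete gradient.\<close>

lemma grad_in_poly_fun:
  assumes "q \<in> poly_fun k"
  shows "(\<lambda>x. grad q x $ i) \<in> poly_fun k"
proof -
  \<comment> \<open>Membership of \<open>q\<close> itself is carried through the induction because
    splitting the gradient of a sum needs differentiability of both summands.\<close>
  have "q \<in> poly_fun k \<and> (\<lambda>x. grad q x $ i) \<in> poly_fun k"
    using assms
  proof (induction rule: poly_fun_induct)
    case zero
    have "(\<lambda>x. grad 0 x $ i) = (0 :: real^'a \<Rightarrow> real)"
      by (rule ext) (simp add: zero_fun_def grad_eqI[OF has_derivative_const])
    then show ?case using subspace_0[OF subspace_poly_fun] by metis
  next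
    case (add q r)
    have "q differentiable (at x)" "r differentiable (at x)" for x
      using add differentiable_poly_fun by blast+
    then have "(\<lambda>x. grad (q + r) x $ i) = (\<lambda>x. grad q x $ i) + (\<lambda>x. grad r x $ i)"
      by (intro ext) (simp add: grad_add)
    then show ?case using add subspace_add[OF subspace_poly_fun] by metis
  next
    case (monom c \<alpha>)
    have \<alpha>: "monom_fun \<alpha> \<in> poly_fun k" using monom by (rule monom_fun_in_poly_fun)
    have "(\<Sum>j\<in>UNIV. (\<alpha>(i := \<alpha> i - 1)) j) \<le> (\<Sum>j\<in>UNIV. \<alpha> j)" by (intro sum_mono) auto
    then have "monom_fun (\<alpha>(i := \<alpha> i - 1)) \<in> poly_fun k"
      using monom by (intro monom_fun_in_poly_fun) auto
    then have "(c * real (\<alpha> i)) *\<^sub>R monom_fun (\<alpha>(i := \<alpha> i - 1)) \<in> poly_fun k"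
      by (rule subspace_scale[OF subspace_poly_fun])
    moreover have "(\<lambda>x. grad (c *\<^sub>R monom_fun \<alpha>) x $ i) = (c * real (\<alpha> i)) *\<^sub>R monom_fun (\<alpha>(i := \<alpha> i - 1))"
      by (intro ext) (simp add: grad_scaleR[OF differentiable_poly_fun[OF \<alpha>]] grad_monom_fun)
    ultimately show ?case using \<alpha> subspace_scale[OF subspace_poly_fun] by metis
  qed
  then show ?thesis by blast
qed

text \<open>On the line from \<open>a\<close> to \<open>y\<close> the polynomial becomes univariate
  and has infinitely many zeros near parameter 0, so all its coefficients vanish; parameter 1 is the
  point \<open>y\<close>.\<close>

lemma real_polynomial_function_eq_0:
  fixes q :: "'a::real_normed_vector \<Rightarrow> real"
  assumes q: "real_polynomial_function q" and U: "open U" "a \<in> U" and 0: "\<And>x. x \<in> U \<Longrightarrow> q x = 0"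
  shows "q y = 0"
proof -
  define g where "g t = q (a + t *\<^sub>R (y - a))" for t :: real
  have lin: "polynomial_function (\<lambda>t::real. a + t *\<^sub>R (y - a))"
    by (intro polynomial_function_add polynomial_function_const polynomial_function_bounded_linear)
       (rule bounded_linear_scaleR_left)
  have "real_polynomial_function g"
    using real_polynomial_function_compose[OF lin q] by (simp add: g_def[abs_def] o_def)
  then obtain c n where c: "g = (\<lambda>t. \<Sum>i\<le>n. c i * t ^ i)"
    by (auto simp: real_polynomial_function_iff_sum)
  have "((\<lambda>t. a + t *\<^sub>R (y - a)) \<longlongrightarrow> a + 0 *\<^sub>R (y - a)) (at (0::real))"
    by (intro tendsto_intros)
  then have "\<forall>\<^sub>F t in at 0. a + t *\<^sub>R (y - a) \<in> U"
    using topological_tendstoD U by fastforce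
  then obtain d where d: "d > 0" "\<And>t. t \<noteq> 0 \<Longrightarrow> \<bar>t\<bar> < d \<Longrightarrow> g t = 0"
    using 0 by (auto simp: eventually_at dist_real_def g_def)
  have "{0<..<d} \<subseteq> {t. (\<Sum>i\<le>n. c i * t ^ i) = 0}" using d(2) c by auto
  then have "\<not> finite {t. (\<Sum>i\<le>n. c i * t ^ i) = 0}"
    using d(1) finite_subset infinite_Ioo by blast
  then have "c i = 0" if "i \<le> n" for i
    using polyfun_finite_roots[of c n] that by simp
  then have "g 1 = 0" unfolding c by simp
  then show ?thesis by (simp add: g_def)
qed

text \<open>The part of the interior where \<open>q\<close> is nonzero is both open and negligible,
  hence empty; a polynomial vanishing on a nonempty open set vanishes everywhere.\<close>

lemma poly_fun_eq_0_AE: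
  fixes q :: "real^'n \<Rightarrow> real"
  assumes q: "q \<in> poly_fun k" and K: "K \<in> sets lebesgue" "interior K \<noteq> {}"
    and 0: "AE x in lebesgue_on K. q x = 0"
  shows "q y = 0"
proof -
  have "AE x in lebesgue. x \<in> K \<longrightarrow> q x = 0"
    using 0 K(1) by (simp add: AE_restrict_space_iff)
  then have "negligible {x. \<not> (x \<in> K \<longrightarrow> q x = 0)}"
    by (simp add: negligible_iff_null_sets completion.AE_iff_null_sets)
  then have "negligible (interior K \<inter> {x. q x \<noteq> 0})"
    by (rule negligible_subset) (use interior_subset in blast)
  moreover have "open (interior K \<inter> {x. q x \<noteq> 0})"
    by (intro open_Int open_interior open_Collect_neq continuous_on_poly_fun[OF q] continuous_on_const)
  ultimately have U: "interior K \<inter> {x. q x \<noteq> 0} = {}"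
    using open_not_negligible by blast
  obtain a where "a \<in> interior K" using K(2) by blast
  then show ?thesis
    by (rule real_polynomial_function_eq_0[OF real_polynomial_function_poly_fun[OF q] open_interior]) (use U in auto)
qed

lemma poly_fun_constant:
  fixes q :: "real^'n \<Rightarrow> real"
  assumes q: "q \<in> poly_fun k" and 0: "\<And>x. grad q x = 0"
  shows "q x = q y"
proof -
  have "(q has_derivative (\<lambda>h. 0)) (at z)" for z
  proof -
    obtain D where D: "(q has_derivative D) (at z)"
      using differentiable_poly_fun[OF q] by (auto simp: differentiable_def)
    have lin: "linear D" using D by (rule has_derivative_linear)
    have "D (axis i 1) = 0" for i using grad_eqI[OF D, of i] 0 by simp
    then have "D = (\<lambda>h. 0)"
      by (intro linear_eq_stdbasis[OF lin module_hom_zero]) (auto simp: Basis_vec_def)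
    then show ?thesis using D by simp
  qed
  then show ?thesis
    by (intro has_derivative_zero_unique[of UNIV q]) auto
qed


section \<open>Surface measure on faces\<close>

text \<open>Completeness makes subsets of null sets measurable. Integrands can therefore be changed
  off a face, or on the frontier of an element, without a measurability check for the changed
  function.\<close>

lemma (in complete_measure) borel_measurable_AE_eq:
  fixes u v :: "'a \<Rightarrow> 'b::topological_space"
  assumes u: "u \<in> borel_measurable M" and uv: "AE x in M. u x = v x"
  shows "v \<in> borel_measurable M"
proof (rule measurableI)
  fix A :: "'b set" assume A: "A \<in> sets borel"
  have uA: "u -` A \<inter> space M \<in> sets M" using measurable_sets[OF u A] .
  have "AE x in M. x \<in> u -` A \<inter> space M \<longleftrightarrow> x \<in> v -` A \<inter> space M"
    using uv by eventually_elim simp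
  then show "v -` A \<inter> space M \<in> sets M" using uA by (rule in_sets_AE) simp
qed simp

lemma (in complete_measure) integrable_AE_eq:
  fixes f g :: "'a \<Rightarrow> 'b::{banach, second_countable_topology}"
  assumes f: "integrable M f" and ae: "AE x in M. f x = g x"
  shows "integrable M g"
  using f borel_measurable_AE_eq[OF borel_measurable_integrable[OF f] ae] ae by (rule integrable_cong_AE_imp)

lemma (in complete_measure) integral_AE_eq:
  fixes f g :: "'a \<Rightarrow> 'b::{banach, second_countable_topology}"
  assumes ae: "AE x in M. f x = g x"
  shows "integral\<^sup>L M f = integral\<^sup>L M g"
proof (cases "integrable M f")
  case True
  then show ?thesis
    using borel_measurable_integrable[OF integrable_AE_eq[OF True ae]] ae by (intro integral_cong_AE) auto
next
  case False
  \<comment> \<open>Neither function is integrable, and both integrals take the default value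
    0.\<close>
  then have "\<not> integrable M g" using integrable_AE_eq[OF _ AE_symmetric[OF ae]] by blast
  then show ?thesis using False by (simp add: not_integrable_integral_eq)
qed

lemma complete_measure_lebesgue_on:
  assumes "S \<in> sets lebesgue"
  shows "complete_measure (lebesgue_on S)"
proof
  fix A B assume "B \<subseteq> A" "A \<in> null_sets (lebesgue_on S)"
  then have "B \<subseteq> S" "B \<in> null_sets lebesgue"
    using assms by (auto simp: null_sets_restrict_space intro: completion.complete2)
  then have "B \<in> null_sets (lebesgue_on S)" using assms by (simp add: null_sets_restrict_space)
  then show "B \<in> sets (lebesgue_on S)" by (rule null_setsD2)
qed

text \<open>The common ground of facets of elements and of interior faces
  \<open>K \<inter> K'\<close>; with hanging nodes the latter need not be facets of either
  element.\<close>

definition flat_face :: "(real^'n) set \<Rightarrow> bool" where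
  "flat_face e \<longleftrightarrow> convex e \<and> compact e \<and> aff_dim e = int CARD('n) - 1"

lemma flat_faceE:
  fixes e :: "(real^'n) set"
  assumes "flat_face e"
  obtains n c where "norm n = 1" "affine hull e = {x. n \<bullet> x = c}"
proof -
  have "aff_dim e = int (DIM(real^'n) - 1)"
    using assms of_nat_diff[of 1 "CARD('n)", where 'a = int] zero_less_card_finite[where 'a = 'n]
    by (simp add: flat_face_def)
  then obtain a b where a: "a \<noteq> 0" "affine hull e = {x. a \<bullet> x = b}"
    unfolding aff_dim_eq_hyperplane by blast
  have "{x. a \<bullet> x = b} = {x. ((1 / norm a) *\<^sub>R a) \<bullet> x = b / norm a}"
    using a(1) by simp
  then have "affine hull e = {x. ((1 / norm a) *\<^sub>R a) \<bullet> x = b / norm a}" using a(2) by (rule trans[rotated])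
  moreover have "norm ((1 / norm a) *\<^sub>R a) = 1" using a(1) by simp
  ultimately show thesis by (rule that[rotated])
qed

lemma flat_face_nonempty: "flat_face e \<Longrightarrow> e \<noteq> {}"
  for e :: "(real^'n) set"
  using zero_less_card_finite[where 'a='n] by (auto simp: flat_face_def)

lemma flat_face_rel_interior_nonempty: "flat_face e \<Longrightarrow> rel_interior e \<noteq> {}"
  using flat_face_nonempty[of e] rel_interior_eq_empty[of e] by (simp add: flat_face_def)

lemma flat_face_closed: "flat_face e \<Longrightarrow> closed e"
  by (simp add: flat_face_def compact_imp_closed)

lemma closest_point_hyperplane:
  fixes n :: "'a::euclidean_space"
  assumes n: "norm n = 1"
  shows "closest_point {x. n \<bullet> x = c} x = x - (n \<bullet> x - c) *\<^sub>R n"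
proof (rule sym, rule closest_point_unique)
  have nn: "n \<bullet> n = 1" using n by (simp add: norm_eq_1)
  show "convex {x. n \<bullet> x = c}" "closed {x. n \<bullet> x = c}" by (auto intro: convex_hyperplane closed_hyperplane)
  show "x - (n \<bullet> x - c) *\<^sub>R n \<in> {x. n \<bullet> x = c}" by (simp add: inner_diff_right nn)
  show "\<forall>z\<in>{x. n \<bullet> x = c}. dist x (x - (n \<bullet> x - c) *\<^sub>R n) \<le> dist x z"
  proof
    fix z assume z: "z \<in> {x. n \<bullet> x = c}"
    have "\<bar>n \<bullet> x - c\<bar> = \<bar>n \<bullet> (x - z)\<bar>" using z by (simp add: inner_diff_right)
    also have "\<dots> \<le> norm (x - z)" using Cauchy_Schwarz_ineq2[of n "x - z"] n by simp
    finally show "dist x (x - (n \<bullet> x - c) *\<^sub>R n) \<le> dist x z" using n by (simp add: dist_norm)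
  qed
qed

definition face_slab :: "(real^'n) set \<Rightarrow> (real^'n) set" where
  "face_slab e = {x. closest_point (affine hull e) x \<in> e \<and> dist x (closest_point (affine hull e) x) \<le> 1/2}"

lemma face_measure_alt:
  "face_measure e = completion (distr (restrict_space lborel (face_slab e)) borel (closest_point (affine hull e)))"
  by (simp add: face_measure_def face_slab_def Let_def)

lemma space_face_measure [simp]: "space (face_measure e) = UNIV"
  by (simp add: face_measure_alt)

lemma borel_measurable_face_measure:
  "f \<in> borel_measurable borel \<Longrightarrow> f \<in> borel_measurable (face_measure e)"
  unfolding face_measure_alt by (intro measurable_completion) simp

context
  fixes e :: "(real^'n) set"
  assumes e: "flat_face e"
begin

lemma continuous_on_face_proj: "continuous_on UNIV (closest_point (affine hull e))"
  using flat_face_nonempty[OF e] by (intro continuous_on_closest_point) auto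

lemma borel_measurable_face_proj: "closest_point (affine hull e) \<in> borel_measurable borel"
  using continuous_on_face_proj by (rule borel_measurable_continuous_onI)

lemma face_slab_borel: "face_slab e \<in> sets borel"
proof -
  have "closed (closest_point (affine hull e) -` e)"
    using continuous_closed_preimage[OF continuous_on_face_proj closed_UNIV flat_face_closed[OF e]] by simp
  moreover have "closed {x. dist x (closest_point (affine hull e) x) \<le> 1/2}"
    using continuous_on_face_proj by (intro closed_Collect_le continuous_intros)
  ultimately have "closed (closest_point (affine hull e) -` e \<inter> {x. dist x (closest_point (affine hull e) x) \<le> 1/2})"
    by (rule closed_Int)
  also have "\<dots> = face_slab e" by (auto simp: face_slab_def)
  finally show ?thesis by (rule borel_closed)
qed

lemma emeasure_face_measure:
  assumes "A \<in> sets borel"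
  shows "emeasure (face_measure e) A = emeasure lborel (closest_point (affine hull e) -` A \<inter> face_slab e)"
proof -
  have m: "closest_point (affine hull e) \<in> measurable (restrict_space lborel (face_slab e)) borel"
    using borel_measurable_face_proj by (simp add: measurable_restrict_space1)
  have "emeasure (face_measure e) A =
      emeasure (restrict_space lborel (face_slab e)) (closest_point (affine hull e) -` A \<inter> face_slab e)"
    using assms m by (simp add: face_measure_alt emeasure_distr space_restrict_space)
  also have "\<dots> = emeasure lborel (closest_point (affine hull e) -` A \<inter> face_slab e)"
    using face_slab_borel by (intro emeasure_restrict_space) auto
  finally show ?thesis .
qed

lemma finite_measure_face_measure: "finite_measure (face_measure e)"
proof
  obtain B where B: "\<And>x. x \<in> e \<Longrightarrow> norm x \<le> B"
    using e compact_imp_bounded by (force simp: flat_face_def bounded_iff)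
  have "bounded (face_slab e)"
    unfolding bounded_iff
  proof (intro exI ballI)
    fix x assume "x \<in> face_slab e"
    then have "norm (closest_point (affine hull e) x) \<le> B" "norm (x - closest_point (affine hull e) x) \<le> 1/2"
      using B by (auto simp: face_slab_def dist_norm)
    then show "norm x \<le> B + 1/2" using norm_triangle_sub[of x "closest_point (affine hull e) x"] by linarith
  qed
  then have "emeasure lborel (face_slab e) < \<infinity>"
    by (rule emeasure_bounded_finite)
  then show "emeasure (face_measure e) (space (face_measure e)) \<noteq> \<infinity>"
    by (simp add: emeasure_face_measure)
qed

text \<open>The mesh assigns faces to \<open>\<Omega>\<close>, \<open>\<Gamma>D\<close> or
  \<open>\<Gamma>N\<close> only on their relative interiors, so the relative boundary has to be
  recognized as null for the surface measure.\<close>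

lemma AE_face_measure_rel_interior: "AE x in face_measure e. x \<in> rel_interior e"
proof -
  obtain n c where nc: "norm n = 1" "affine hull e = {x. n \<bullet> x = c}" using flat_faceE[OF e] .
  define P where "P = closest_point (affine hull e)"
  have P: "P x = x - (n \<bullet> x - c) *\<^sub>R n" for x
    unfolding P_def nc(2) using nc(1) by (rule closest_point_hyperplane)
  have nn: "n \<bullet> n = 1" using nc(1) by (simp add: norm_eq_1)
  \<comment> \<open>The relative boundary of \<open>e\<close> pulls back into the frontier of the convex cylinder \<open>P -` e\<close>, which is null.\<close>
  have cone: "convex (P -` e)"
  proof (rule convexI)
    fix x y and u v :: real assume xy: "x \<in> P -` e" "y \<in> P -` e" and uv: "0 \<le> u" "0 \<le> v" "u + v = 1"
    have "u * c + v * c = c" using uv(3) by (metis distrib_right mult_1)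
    then have "n \<bullet> (u *\<^sub>R x + v *\<^sub>R y) - c = u * (n \<bullet> x - c) + v * (n \<bullet> y - c)"
      by (simp add: inner_add_right right_diff_distrib)
    then have "P (u *\<^sub>R x + v *\<^sub>R y) = u *\<^sub>R P x + v *\<^sub>R P y"
      unfolding P by (simp add: scaleR_add_left scaleR_diff_right)
    also have "\<dots> \<in> e"
      using e xy uv by (intro convexD) (auto simp: flat_face_def)
    finally show "u *\<^sub>R x + v *\<^sub>R y \<in> P -` e" by simp
  qed
  have P_cont: "continuous_on UNIV P" unfolding P_def by (rule continuous_on_face_proj)
  have cl: "closed (P -` e)"
    using continuous_closed_preimage[OF P_cont closed_UNIV flat_face_closed[OF e]] by simp
  have int: "P x \<in> rel_interior e" if x: "x \<in> interior (P -` e)" for x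
  proof -
    obtain r where r: "r > 0" "ball x r \<subseteq> P -` e" using x unfolding mem_interior by blast
    have Px: "P x \<in> e" using subsetD[OF r(2), of x] r(1) by simp
    \<comment> \<open>A point \<open>y\<close> of the hyperplane close to \<open>P x\<close> is the
      projection of the translate \<open>x + (y - P x)\<close>, which stays in the ball around
      \<open>x\<close>.\<close>
    have "ball (P x) r \<inter> affine hull e \<subseteq> e"
    proof
      fix y assume y: "y \<in> ball (P x) r \<inter> affine hull e"
      then have "x + (y - P x) \<in> ball x r" by (simp add: dist_norm norm_minus_commute)
      then have "P (x + (y - P x)) \<in> e" using r(2) by auto
      moreover have "n \<bullet> P x = c" by (simp add: P inner_diff_right nn)
      then have "n \<bullet> (x + (y - P x)) = n \<bullet> x" using y nc(2) by (simp add: inner_add_right inner_diff_right)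
      then have "P (x + (y - P x)) = y" unfolding P[of "x + (y - P x)"] by (simp add: P)
      ultimately show "y \<in> e" by simp
    qed
    then show ?thesis using Px r(1) by (auto simp: mem_rel_interior_ball)
  qed
  have "P -` (e - rel_interior e) \<subseteq> frontier (P -` e)"
  proof
    fix x assume "x \<in> P -` (e - rel_interior e)"
    then have "x \<in> P -` e" "x \<notin> interior (P -` e)" using int[of x] by auto
    then show "x \<in> frontier (P -` e)" unfolding frontier_def closure_closed[OF cl] by blast
  qed
  then have neg: "negligible (P -` (e - rel_interior e) \<inter> face_slab e)"
    by (intro negligible_subset[OF negligible_convex_frontier[OF cone]]) blast
  have ri: "rel_interior e \<in> sets borel"
  proof -
    obtain U where "open U" "rel_interior e = affine hull e \<inter> U"
      using openin_rel_interior[of e] by (auto simp: openin_open)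
    then show ?thesis using borel_closed[OF closed_affine_hull[of e]] by (simp add: sets.Int)
  qed
  have "P -` (- rel_interior e) \<inter> face_slab e = P -` (e - rel_interior e) \<inter> face_slab e"
    by (auto simp: face_slab_def P_def)
  moreover have "P -` (- rel_interior e) \<inter> face_slab e \<in> sets borel"
    using measurable_sets[OF borel_measurable_face_proj borel_comp[OF ri]]
    unfolding P_def by (intro sets.Int face_slab_borel) simp
  ultimately have "P -` (- rel_interior e) \<inter> face_slab e \<in> null_sets lborel"
    using neg by (simp add: negligible_iff_null_sets null_sets_completion_iff)
  then have "emeasure lborel (P -` (- rel_interior e) \<inter> face_slab e) = 0"
    by (rule null_setsD1)
  then have "emeasure (face_measure e) (- rel_interior e) = 0"
    using ri by (simp add: emeasure_face_measure P_def)
  moreover have "- rel_interior e \<in> sets (face_measure e)"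
    unfolding face_measure_alt by (intro sets_completionI_sets) (simp add: borel_comp[OF ri])
  ultimately show ?thesis
    by (intro AE_I[where N = "- rel_interior e"]) auto
qed

lemma AE_face_measure: "AE x in face_measure e. x \<in> e"
  using AE_face_measure_rel_interior by eventually_elim (use rel_interior_subset in blast)

text \<open>Turns almost-everywhere equality of traces into equality at one point, where elementwise
  constants can be compared. The face measure is not zero because the slab contains a nonempty open
  set over the relative interior.\<close>

lemma AE_face_measure_imp_ex:
  assumes "AE x in face_measure e. Q x"
  shows "\<exists>x\<in>e. Q x"
proof (rule ccontr)
  assume no: "\<not> ?thesis"
  have "AE x in face_measure e. False"
    using assms AE_face_measure by eventually_elim (use no in blast)
  then have "emeasure (face_measure e) UNIV = 0"
    using AE_iff_measurable[of UNIV "face_measure e" "\<lambda>_. False"] sets.top[of "face_measure e"] by auto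
  then have 0: "emeasure lborel (face_slab e) = 0" by (simp add: emeasure_face_measure)
  obtain z where z: "z \<in> rel_interior e" using flat_face_rel_interior_nonempty[OF e] by blast
  obtain U where U: "open U" "rel_interior e = affine hull e \<inter> U"
    using openin_rel_interior[of e] by (auto simp: openin_open)
  let ?P = "closest_point (affine hull e)"
  let ?O = "?P -` U \<inter> {x. dist x (?P x) < 1/2}"
  have "open (?P -` U)"
    using continuous_open_preimage[OF continuous_on_face_proj open_UNIV U(1)] by simp
  note PU = this
  have "open ?O"
    using continuous_on_face_proj by (intro open_Int[OF PU] open_Collect_less continuous_intros)
  moreover have "z \<in> ?O"
  proof -
    have "?P z = z" using z rel_interior_subset[of e] hull_subset[of e affine] by (intro closest_point_self) auto
    then show ?thesis using z U(2) by auto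
  qed
  ultimately have "emeasure lborel ?O \<noteq> 0"
    using open_not_negligible[of ?O] by (auto simp: negligible_iff_null_sets null_sets_completion_iff null_sets_def)
  moreover have "?O \<subseteq> face_slab e"
  proof
    fix x assume x: "x \<in> ?O"
    have "?P x \<in> affine hull e"
      using flat_face_nonempty[OF e] by (intro closest_point_in_set) auto
    then have "?P x \<in> e" using x U(2) rel_interior_subset[of e] by auto
    then show "x \<in> face_slab e" using x by (auto simp: face_slab_def)
  qed
  then have "emeasure lborel ?O \<le> emeasure lborel (face_slab e)"
    using face_slab_borel by (intro emeasure_mono) auto
  ultimately show False using 0 by simp
qed

lemma integral_face_measure_cong:
  fixes f g :: "real^'n \<Rightarrow> 'b::{banach, second_countable_topology}"
  assumes eq: "\<And>x. x \<in> e \<Longrightarrow> f x = g x"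
  shows "(\<integral>x. f x \<partial>face_measure e) = (\<integral>x. g x \<partial>face_measure e)"
proof -
  have "AE x in face_measure e. f x = g x" using AE_face_measure by eventually_elim (rule eq)
  then show ?thesis unfolding face_measure_alt by (rule completion.integral_AE_eq)
qed

lemma integrable_face_measure_continuous:
  fixes f :: "real^'n \<Rightarrow> 'b::{banach, second_countable_topology}"
  assumes "continuous_on UNIV f"
  shows "integrable (face_measure e) f"
proof -
  have "compact (f ` e)"
    using e continuous_on_subset[OF assms subset_UNIV] by (simp add: flat_face_def compact_continuous_image)
  then obtain B where "\<And>x. x \<in> e \<Longrightarrow> norm (f x) \<le> B"
    using compact_imp_bounded by (force simp: bounded_iff)
  then have "AE x in face_measure e. norm (f x) \<le> B"
    using AE_face_measure by (auto elim: eventually_mono)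
  then show ?thesis
    by (intro finite_measure.integrable_const_bound[OF finite_measure_face_measure]
        borel_measurable_face_measure borel_measurable_continuous_onI assms)
qed

lemma integrable_face_measure_mult:
  fixes f g :: "real^'n \<Rightarrow> real"
  assumes f: "integrable (face_measure e) f" and g: "continuous_on UNIV g"
  shows "integrable (face_measure e) (\<lambda>x. f x * g x)"
proof -
  have "compact (g ` e)"
    using e continuous_on_subset[OF g subset_UNIV] by (simp add: flat_face_def compact_continuous_image)
  then obtain B where B: "\<And>x. x \<in> e \<Longrightarrow> norm (g x) \<le> B"
    using compact_imp_bounded by (force simp: bounded_iff)
  show ?thesis
  proof (rule Bochner_Integration.integrable_bound)
    show "integrable (face_measure e) (\<lambda>x. B * f x)" using f by simp
    show "(\<lambda>x. f x * g x) \<in> borel_measurable (face_measure e)"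
      using f g by (intro borel_measurable_times borel_measurable_integrable
          borel_measurable_face_measure borel_measurable_continuous_onI)
    show "AE x in face_measure e. norm (f x * g x) \<le> norm (B * f x)"
      using AE_face_measure
    proof eventually_elim
      case (elim x)
      have "norm (g x) \<le> \<bar>B\<bar>" using B[OF elim] by linarith
      then show ?case
        using mult_left_mono[of "norm (g x)" "\<bar>B\<bar>" "\<bar>f x\<bar>"] by (simp add: abs_mult mult.commute)
    qed
  qed
qed

end

lemma integrable_in_Lp:
  assumes "finite_measure M" "in_Lp M p f" "1 \<le> p"
  shows "integrable M f"
proof (rule Bochner_Integration.integrable_bound)
  interpret finite_measure M by fact
  show "integrable M (\<lambda>x. 1 + \<bar>f x\<bar> powr p)" using assms(2) by (simp add: in_Lp_def)
  show "f \<in> borel_measurable M" using assms(2) by (simp add: in_Lp_def)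
  show "AE x in M. norm (f x) \<le> norm (1 + \<bar>f x\<bar> powr p)"
  proof (rule AE_I2)
    fix x
    have "\<bar>f x\<bar> \<le> 1 + \<bar>f x\<bar> powr p"
    proof (cases "\<bar>f x\<bar> \<le> 1")
      case False
      then have "\<bar>f x\<bar> powr 1 \<le> \<bar>f x\<bar> powr p" using assms(3) by (intro powr_mono) auto
      then show ?thesis using False by simp
    qed (simp add: add_increasing2)
    then show "norm (f x) \<le> norm (1 + \<bar>f x\<bar> powr p)" by simp
  qed
qed


section \<open>Geometry of the mesh\<close>

text \<open>The component \<open>y\<close> of \<open>n\<close> orthogonal to \<open>a\<close>
  vanishes: moving along \<open>y\<close> stays in the hyperplane, so
  \<open>n \<bullet> y = 0\<close>, and therefore \<open>y \<bullet> y = 0\<close>.\<close>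

lemma unit_normals_of_hyperplane:
  fixes a n :: "'a::real_inner"
  assumes a: "norm a = 1" and n: "norm n = 1" and sub: "\<And>x. a \<bullet> x = b \<Longrightarrow> n \<bullet> x = c"
  shows "n = a \<or> n = - a"
proof -
  have aa: "a \<bullet> a = 1" and nn: "n \<bullet> n = 1" using a n by (simp_all add: norm_eq_1)
  define y where "y = n - (a \<bullet> n) *\<^sub>R a"
  have ay: "a \<bullet> y = 0" by (simp add: y_def inner_diff_right aa)
  have "n \<bullet> (b *\<^sub>R a) = c" "n \<bullet> (b *\<^sub>R a + y) = c"
    by (rule sub; simp add: inner_add_right aa ay)+
  then have ny: "n \<bullet> y = 0" by (simp add: inner_add_right)
  have "y \<bullet> y = n \<bullet> y - (a \<bullet> n) * (a \<bullet> y)" unfolding y_def by (simp add: inner_diff_left)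
  then have "y = 0" using ay ny by simp
  then have eq: "n = (a \<bullet> n) *\<^sub>R a" by (simp add: y_def)
  then have "norm n = \<bar>a \<bullet> n\<bar> * norm a" by (metis norm_scaleR)
  then have "a \<bullet> n = 1 \<or> a \<bullet> n = - 1" using a n by (auto simp: abs_if split: if_splits)
  then show ?thesis using eq by (metis scaleR_minus1_left scaleR_one)
qed

text \<open>Any two candidates are unit normals of the same hyperplane, hence equal or opposite.
  Opposite ones would confine \<open>K\<close> to a hyperplane, contradicting its nonempty
  interior.\<close>

lemma outward_normal_eqI:
  assumes e: "flat_face e" and K: "interior K \<noteq> {}"
    and n: "norm n = 1" "\<And>x. x \<in> e \<Longrightarrow> n \<bullet> x = c" "\<And>x. x \<in> K \<Longrightarrow> n \<bullet> x \<le> c"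
  shows "outward_normal K e = n"
  unfolding outward_normal_def
proof (rule the_equality)
  show "norm n = 1 \<and> (\<exists>c. (\<forall>x\<in>e. n \<bullet> x = c) \<and> (\<forall>x\<in>K. n \<bullet> x \<le> c))" using n by blast
  fix m assume "norm m = 1 \<and> (\<exists>c. (\<forall>x\<in>e. m \<bullet> x = c) \<and> (\<forall>x\<in>K. m \<bullet> x \<le> c))"
  then obtain d where m: "norm m = 1" "\<And>x. x \<in> e \<Longrightarrow> m \<bullet> x = d" "\<And>x. x \<in> K \<Longrightarrow> m \<bullet> x \<le> d" by blast
  obtain a b where ab: "norm a = 1" "affine hull e = {x. a \<bullet> x = b}" using flat_faceE[OF e] .
  have sub: "affine hull e \<subseteq> {x. n \<bullet> x = c}" "affine hull e \<subseteq> {x. m \<bullet> x = d}"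
    using n(2) m(2) by (intro hull_minimal affine_hyperplane; blast)+
  have "n = a \<or> n = - a"
    using sub(1) unfolding ab(2) by (intro unit_normals_of_hyperplane[OF ab(1) n(1), of b c]) blast
  moreover have "m = a \<or> m = - a"
    using sub(2) unfolding ab(2) by (intro unit_normals_of_hyperplane[OF ab(1) m(1), of b d]) blast
  ultimately consider "m = n" | "m = - n" by auto
  then show "m = n"
  proof cases
    case 2
    obtain z where "z \<in> e" using flat_face_nonempty[OF e] by blast
    then have "d = - c" using n(2) m(2) 2 by (metis inner_minus_left)
    then have "K \<subseteq> {x. n \<bullet> x = c}" using n(3) m(3) 2 by (force intro: antisym)
    then have "interior K \<subseteq> interior {x. n \<bullet> x = c}" by (rule interior_mono)
    then show ?thesis using K n(1) by (metis interior_hyperplane norm_zero subset_empty zero_neq_one)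
  qed
qed

lemma finite_interior_faces: "finite T \<Longrightarrow> finite (interior_faces T \<Omega>)"
  by (rule finite_subset[of _ "(\<lambda>(K, K'). K \<inter> K') ` (T \<times> T)"]) (auto simp: interior_faces_def)

section \<open>Elements, normals and connectivity of a mesh\<close>

context
  fixes \<Omega> \<Gamma>D \<Gamma>N :: "(real^'n) set" and T :: "(real^'n) set set"
  assumes mesh: "dg_mesh \<Omega> \<Gamma>D \<Gamma>N T"
begin

lemma finite_mesh: "finite T"
  using mesh by (simp add: dg_mesh_def)

lemma mesh_element:
  assumes "K \<in> T"
  shows "convex K" "compact K" "closed K" "polytope K" "aff_dim K = int CARD('n)" "interior K \<subseteq> \<Omega>"
    "interior K \<noteq> {}" "closure (interior K) = K"
proof -
  have s: "int CARD('n) simplex K" using mesh assms by (simp add: dg_mesh_def)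
  show c: "convex K" "compact K" "closed K" "polytope K" and d: "aff_dim K = int CARD('n)"
    using s by (simp_all add: convex_simplex compact_simplex closed_simplex simplex_imp_polytope aff_dim_simplex)
  show "interior K \<subseteq> \<Omega>" using mesh assms by (simp add: dg_mesh_def)
  have "rel_interior K = interior K" using d aff_dim_eq_full[of K] by (intro rel_interior_interior) simp
  moreover have "K \<noteq> {}" using d by auto
  ultimately show i: "interior K \<noteq> {}" using rel_interior_eq_empty c(1) by metis
  show "closure (interior K) = K" using convex_closure_interior[OF c(1) i] c(3) by simp
qed

lemma mesh_meet:
  assumes "K \<in> T" "K' \<in> T" "K \<noteq> K'" "K \<inter> K' \<noteq> {}"
  obtains F where "F facet_of K" "K \<inter> K' \<subseteq> F"
  using mesh assms unfolding dg_mesh_def by (metis le_inf_iff)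

lemma mesh_facet:
  assumes "K \<in> T" "F facet_of K"
  shows "flat_face F" "F \<subseteq> K"
  using assms mesh_element[OF assms(1)]
  by (auto simp: flat_face_def facet_of_def face_of_imp_convex face_of_imp_compact face_of_imp_subset)

lemma mesh_facet_position:
  assumes "K \<in> T" "F facet_of K"
  shows "rel_interior F \<subseteq> \<Omega> \<or> rel_interior F \<subseteq> \<Gamma>D \<or> rel_interior F \<subseteq> \<Gamma>N"
  using mesh assms by (simp add: dg_mesh_def)

text \<open>A common interior point would put a nonempty open set inside a facet, which has lower
  dimension. An open set that misses \<open>interior K'\<close> also misses its closure, which is
  \<open>K'\<close>.\<close>

lemma mesh_interiors_disjoint:
  assumes "K \<in> T" "K' \<in> T" "K \<noteq> K'"
  shows "interior K \<inter> K' = {}"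
proof -
  have "interior K \<inter> interior K' = {}"
  proof (rule ccontr)
    assume ne: "interior K \<inter> interior K' \<noteq> {}"
    then have "K \<inter> K' \<noteq> {}" using interior_subset by blast
    then obtain F where F: "F facet_of K" "K \<inter> K' \<subseteq> F" using mesh_meet assms by metis
    then have "interior K \<inter> interior K' \<subseteq> interior F"
      by (intro interior_maximal) (use interior_subset in blast)+
    then have "aff_dim F = int DIM(real^'n)" using ne aff_dim_nonempty_interior by blast
    then show False using mesh_facet(1)[OF assms(1) F(1)] by (simp add: flat_face_def)
  qed
  then have "interior K \<inter> closure (interior K') = {}" by (simp add: open_Int_closure_eq_empty)
  then show ?thesis using mesh_element(8)[OF assms(2)] by simp
qed

text \<open>A hyperplane separating the two interiors has the elements on opposite closed sides and
  so contains every common face; its unit normal serves both elements up to sign.\<close>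

lemma mesh_opposite_normals:
  assumes K: "K \<in> T" "K' \<in> T" "K \<noteq> K'" and e: "flat_face e" "e \<subseteq> K" "e \<subseteq> K'"
  shows "norm (outward_normal K e) = 1" "outward_normal K' e = - outward_normal K e"
proof -
  note el = mesh_element[OF K(1)] mesh_element[OF K(2)]
  have "interior K \<inter> interior K' = {}"
    using mesh_interiors_disjoint[OF K] interior_subset by blast
  then obtain a b where ab: "a \<noteq> 0" "\<forall>x\<in>interior K. a \<bullet> x \<le> b" "\<forall>x\<in>interior K'. a \<bullet> x \<ge> b"
    using separating_hyperplane_sets[of "interior K" "interior K'"] el by (auto simp: convex_interior)
  have "closure (interior K) \<subseteq> {x. a \<bullet> x \<le> b}"
    using ab(2) by (intro closure_minimal closed_halfspace_le) blast
  moreover have "closure (interior K') \<subseteq> {x. a \<bullet> x \<ge> b}"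
    using ab(3) by (intro closure_minimal closed_halfspace_ge) blast
  ultimately have KK: "\<And>x. x \<in> K \<Longrightarrow> a \<bullet> x \<le> b" "\<And>x. x \<in> K' \<Longrightarrow> b \<le> a \<bullet> x"
    unfolding el(8) el(16) by blast+
  define n c where "n = (1 / norm a) *\<^sub>R a" and "c = b / norm a"
  have n: "norm n = 1" "\<And>x. x \<in> K \<Longrightarrow> n \<bullet> x \<le> c" "\<And>x. x \<in> K' \<Longrightarrow> c \<le> n \<bullet> x"
    using ab(1) KK by (auto simp: n_def c_def divide_right_mono)
  have ne: "n \<bullet> x = c" if "x \<in> e" for x
    using n(2)[of x] n(3)[of x] e that by fastforce
  have 1: "outward_normal K e = n" using el n ne by (intro outward_normal_eqI[OF e(1), of K n c]) auto
  have 2: "outward_normal K' e = - n" using el n ne by (intro outward_normal_eqI[OF e(1), of K' "- n" "- c"]) auto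
  show "norm (outward_normal K e) = 1" "outward_normal K' e = - outward_normal K e"
    using 1 2 n by auto
qed

lemma interior_faceE:
  assumes "e \<in> interior_faces T \<Omega>"
  obtains K K' where "K \<in> T" "K' \<in> T" "K \<noteq> K'" "e = K \<inter> K'" "flat_face e"
proof -
  obtain K K' where K: "K \<in> T" "K' \<in> T" "K \<noteq> K'" "e = K \<inter> K'" "aff_dim e = int CARD('n) - 1"
    using assms by (auto simp: interior_faces_def)
  then show thesis
    using that mesh_element[of K] mesh_element[of K'] by (simp add: flat_face_def convex_Int compact_Int)
qed

text \<open>A third element containing \<open>e\<close> would have a normal opposite to each of two
  mutually opposite ones, so a unit normal would equal its own negative. Hence the sums in
  \<open>jump\<close> and \<open>average\<close> have exactly two terms.\<close>

lemma interior_face_neighbours: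
  assumes K: "K \<in> T" "K' \<in> T" "K \<noteq> K'" and e: "flat_face e" "e \<subseteq> K" "e \<subseteq> K'"
  shows "neighbours T e = {K, K'}"
proof -
  have "K'' = K \<or> K'' = K'" if K'': "K'' \<in> T" "e \<subseteq> K''" for K''
  proof (rule ccontr)
    assume ne: "\<not> ?thesis"
    have "outward_normal K' e = - outward_normal K e" using mesh_opposite_normals(2)[OF K e] .
    moreover have "outward_normal K'' e = - outward_normal K e"
      using mesh_opposite_normals(2)[OF K(1) K''(1) _ e(1,2) K''(2)] ne by blast
    moreover have "outward_normal K'' e = - outward_normal K' e"
      using mesh_opposite_normals(2)[OF K(2) K''(1) _ e(1,3) K''(2)] ne by blast
    ultimately have "outward_normal K e = - outward_normal K e" by simp
    then have "outward_normal K e = 0" by (simp only: eq_neg_iff_add_eq_0 scaleR_2[symmetric]) simp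
    then show False using mesh_opposite_normals(1)[OF K e] by simp
  qed
  then show ?thesis using K e by (auto simp: neighbours_def)
qed

lemma boundary_face:
  assumes "(K, F) \<in> boundary_faces T \<Gamma>"
  shows "K \<in> T" "F \<subseteq> K" "flat_face F"
  using assms mesh_facet by (auto simp: boundary_faces_def)

lemma finite_boundary_faces: "finite (boundary_faces T \<Gamma>)"
proof (rule finite_subset)
  show "boundary_faces T \<Gamma> \<subseteq> (SIGMA K:T. {F. F facet_of K})" by (auto simp: boundary_faces_def)
  show "finite (SIGMA K:T. {F. F facet_of K})"
    using finite_mesh mesh_element(4) finite_polytope_facets by blast
qed

text \<open>Otherwise the two parts of the mesh meet inside \<open>\<Omega>\<close> only in finitely many sets of codimension two,
  and a generic short segment from one part to the other misses all of them.\<close>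

lemma mesh_connected:
  assumes dom: "open \<Omega>" "connected \<Omega>" and bd: "frontier \<Omega> = \<Gamma>D \<union> \<Gamma>N"
    and A: "A \<subseteq> T" "A \<noteq> {}"
    and step: "\<And>K K'. K \<in> A \<Longrightarrow> K' \<in> T \<Longrightarrow> K \<noteq> K' \<Longrightarrow> K \<inter> K' \<in> interior_faces T \<Omega> \<Longrightarrow> K' \<in> A"
  shows "A = T"
proof (rule ccontr)
  assume "A \<noteq> T"
  define B where "B = T - A"
  have B: "B \<subseteq> T" "B \<noteq> {}" "A \<union> B = T" using A \<open>A \<noteq> T\<close> by (auto simp: B_def)
  have fin: "finite A" "finite B" using finite_mesh A B finite_subset by metis+
  have closed: "closed (\<Union>A)" "closed (\<Union>B)"
    using fin A B mesh_element(3) by (auto intro!: closed_Union)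
  have cover: "\<Omega> \<subseteq> \<Union>A \<union> \<Union>B"
  proof -
    have "\<Union>T = closure \<Omega>" using mesh unfolding dg_mesh_def by (elim conjE)
    then have "\<Omega> \<subseteq> \<Union>T" using closure_subset[of \<Omega>] by metis
    then show ?thesis unfolding B(3)[symmetric] Union_Un_distrib .
  qed
  \<comment> \<open>Two closed sets that cover a connected set and both meet it must meet each other
    inside it. This is used for \<open>\<Omega>\<close> and then for a segment.\<close>
  have meet: "\<Omega>' \<inter> \<Union>A \<inter> \<Union>B \<noteq> {}"
    if "connected \<Omega>'" "\<Omega>' \<subseteq> \<Omega>" "\<Union>A \<inter> \<Omega>' \<noteq> {}" "\<Union>B \<inter> \<Omega>' \<noteq> {}" for \<Omega>'
  proof
    assume "\<Omega>' \<inter> \<Union>A \<inter> \<Union>B = {}"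
    then have "closed (\<Union>A) \<and> closed (\<Union>B) \<and> \<Omega>' \<subseteq> \<Union>A \<union> \<Union>B \<and> \<Union>A \<inter> \<Union>B \<inter> \<Omega>' = {} \<and>
        \<Union>A \<inter> \<Omega>' \<noteq> {} \<and> \<Union>B \<inter> \<Omega>' \<noteq> {}"
      using that closed cover by (simp add: Int_ac subset_trans)
    then show False using that(1) unfolding connected_closed by (elim notE) (intro exI)
  qed
  \<comment> \<open>A contact of codimension one would be full-dimensional in a facet
    \<open>F\<close>. That facet cannot lie on the boundary, since its closure would take the
    contact point out of \<open>\<Omega>\<close>; so the contact would be an interior face and
    \<open>step\<close> would put \<open>K'\<close> into \<open>A\<close>.\<close>
  have lowdim: "aff_dim (K \<inter> K') \<le> int CARD('n) - 2"
    if K: "K \<in> A" "K' \<in> B" "K \<inter> K' \<inter> \<Omega> \<noteq> {}" for K K'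
  proof (rule ccontr)
    assume high: "\<not> ?thesis"
    have KT: "K \<in> T" "K' \<in> T" "K \<noteq> K'" using K A B by (auto simp: B_def)
    obtain F where F: "F facet_of K" "K \<inter> K' \<subseteq> F" using mesh_meet KT K(3) by blast
    note flat = mesh_facet[OF KT(1) F(1)]
    have dim: "aff_dim (K \<inter> K') = aff_dim F" "aff_dim F = int CARD('n) - 1"
      using high aff_dim_subset[OF F(2)] flat(1) by (auto simp: flat_face_def)
    have "rel_interior (K \<inter> K') \<subseteq> rel_interior F"
      using dim(1) F(2) by (intro subset_rel_interior) (auto simp: aff_dim_eq_full_gen)
    moreover have "rel_interior F \<subseteq> \<Omega> \<or> rel_interior F \<subseteq> frontier \<Omega>"
      using mesh_facet_position[OF KT(1) F(1)] bd by blast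
    moreover have "\<not> rel_interior F \<subseteq> frontier \<Omega>"
    proof
      assume "rel_interior F \<subseteq> frontier \<Omega>"
      then have "closure (rel_interior F) \<subseteq> frontier \<Omega>" by (intro closure_minimal) auto
      moreover have "closure (rel_interior F) = F"
        using flat(1) by (simp add: convex_closure_rel_interior flat_face_def compact_imp_closed)
      moreover have "\<Omega> \<inter> frontier \<Omega> = {}" using dom(1) by (simp add: frontier_def interior_open)
      ultimately show False using K(3) F(2) by blast
    qed
    ultimately have "rel_interior (K \<inter> K') \<subseteq> \<Omega>" by blast
    then have "K \<inter> K' \<in> interior_faces T \<Omega>"
      using KT dim unfolding interior_faces_def mem_Collect_eq by (intro exI[of _ K] exI[of _ K']) simp
    then show False using step K KT by (auto simp: B_def)
  qed
  obtain Ka Kb where Kab: "Ka \<in> A" "Kb \<in> B" using A B by blast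
  have "\<Union>A \<inter> \<Omega> \<noteq> {}" "\<Union>B \<inter> \<Omega> \<noteq> {}"
    using mesh_element(6,7)[of Ka] mesh_element(6,7)[of Kb] interior_subset[of Ka] interior_subset[of Kb] A B Kab
    by blast+
  then obtain x Kx Kx' where x: "x \<in> \<Omega>" "x \<in> Kx" "Kx \<in> A" "x \<in> Kx'" "Kx' \<in> B"
    using meet[OF dom(2)] by blast
  obtain r where r: "r > 0" "ball x r \<subseteq> \<Omega>" using dom(1) x(1) open_contains_ball by blast
  have near: "interior K \<inter> ball x r \<noteq> {}" if "K \<in> T" "x \<in> K" for K
  proof -
    have "x \<in> closure (interior K)" using mesh_element(8) that by blast
    then show ?thesis using r(1) by (auto simp: closure_approachable dist_commute disjoint_iff)
  qed
  obtain a where a: "a \<in> interior Kx" "a \<in> ball x r" using near[of Kx] x A by blast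
  define L where "L = {K \<inter> K' | K K'. K \<in> A \<and> K' \<in> B \<and> K \<inter> K' \<inter> \<Omega> \<noteq> {}}"
  have "finite L"
    by (rule finite_subset[of _ "(\<lambda>(K, K'). K \<inter> K') ` (A \<times> B)"]) (use fin in \<open>auto simp: L_def\<close>)
  \<comment> \<open>Adding the point \<open>a\<close> to a set of codimension two gives an affine
    hull of dimension at most \<open>d - 1\<close>. Finitely many such hulls leave room to choose
    \<open>b\<close> outside all of them.\<close>
  moreover have "negligible (affine hull (insert a l))" if "l \<in> L" for l
  proof -
    have "aff_dim l \<le> int CARD('n) - 2" using that lowdim by (auto simp: L_def)
    then have "aff_dim (affine hull (insert a l)) < int DIM(real^'n)" by (simp add: aff_dim_insert)
    then have "interior (affine hull (insert a l)) = {}" using aff_dim_nonempty_interior by force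
    then show ?thesis by (simp add: negligible_convex_interior affine_imp_convex)
  qed
  ultimately have neg: "negligible (\<Union>l\<in>L. affine hull (insert a l))"
    by (intro negligible_Union) auto
  have "open (interior Kx' \<inter> ball x r)" by auto
  moreover have "interior Kx' \<inter> ball x r \<noteq> {}" using near[of Kx'] x B by blast
  ultimately have "\<not> interior Kx' \<inter> ball x r \<subseteq> (\<Union>l\<in>L. affine hull (insert a l))"
    using neg negligible_subset open_not_negligible by metis
  then obtain b where b: "b \<in> interior Kx'" "b \<in> ball x r" "\<And>l. l \<in> L \<Longrightarrow> b \<notin> affine hull (insert a l)"
    by blast
  have seg: "closed_segment a b \<subseteq> \<Omega>"
    using r(2) closed_segment_subset[OF a(2) b(2) convex_ball] by blast
  have "\<Union>A \<inter> closed_segment a b \<noteq> {}" "\<Union>B \<inter> closed_segment a b \<noteq> {}"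
    using a(1) b(1) x interior_subset[of Kx] interior_subset[of Kx'] by auto
  then obtain z where z: "z \<in> closed_segment a b" "z \<in> \<Union>A" "z \<in> \<Union>B"
    using meet[OF _ seg] by blast
  then obtain l where l: "l \<in> L" "z \<in> l" using seg unfolding L_def by blast
  obtain t where t: "z = (1 - t) *\<^sub>R a + t *\<^sub>R b" using z(1) by (auto simp: closed_segment_def)
  \<comment> \<open>The interior of \<open>Kx\<close> meets no other element, so \<open>z\<close>
    differs from \<open>a\<close>. The line through \<open>a\<close> and \<open>z\<close> then
    passes through \<open>b\<close>, which puts \<open>b\<close> in one of the excluded
    hulls.\<close>
  have "t \<noteq> 0"
  proof
    assume "t = 0"
    then have "a \<in> \<Union>B" using z(3) t by simp
    then obtain K where K: "K \<in> B" "a \<in> K" by blast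
    then show False using mesh_interiors_disjoint[of Kx K] a(1) x(3) A B by (auto simp: B_def)
  qed
  then have "b = (1 - 1 / t) *\<^sub>R a + (1 / t) *\<^sub>R z"
    unfolding t by (simp add: algebra_simps)
  also have "\<dots> \<in> affine hull (insert a l)"
    using l(2) by (intro mem_affine[OF affine_affine_hull]) (auto intro: hull_inc)
  finally show False using b(3) l(1) by blast
qed

text \<open>Positive area yields a boundary facet on which \<open>\<Gamma>D\<close> has positive
  measure. Its relative interior lies neither in \<open>\<Omega>\<close> nor in
  \<open>\<Gamma>N\<close>, and the mesh leaves only \<open>\<Gamma>D\<close>.\<close>

lemma ex_Dirichlet_face:
  assumes dom: "open \<Omega>" and bd: "frontier \<Omega> = \<Gamma>D \<union> \<Gamma>N" "\<Gamma>D \<inter> \<Gamma>N = {}"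
    and area: "boundary_area T \<Omega> \<Gamma>D > 0"
  shows "\<exists>K F. (K, F) \<in> boundary_faces T \<Gamma>D"
proof -
  have "\<exists>KF\<in>boundary_faces T (frontier \<Omega>). measure (face_measure (snd KF)) \<Gamma>D > 0"
  proof (rule ccontr)
    assume "\<not> ?thesis"
    then have "boundary_area T \<Omega> \<Gamma>D \<le> 0"
      unfolding boundary_area_def by (intro sum_nonpos) (auto simp: not_less)
    then show False using area by simp
  qed
  then obtain K F where KF: "(K, F) \<in> boundary_faces T (frontier \<Omega>)" "measure (face_measure F) \<Gamma>D > 0"
    by auto
  note face = boundary_face[OF KF(1)]
  have facet: "F facet_of K" "rel_interior F \<subseteq> frontier \<Omega>" using KF(1) by (auto simp: boundary_faces_def)
  have "\<not> rel_interior F \<subseteq> \<Omega>"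
    using facet(2) flat_face_rel_interior_nonempty[OF face(3)] dom by (auto simp: frontier_def interior_open)
  moreover have "\<not> rel_interior F \<subseteq> \<Gamma>N"
  proof
    assume "rel_interior F \<subseteq> \<Gamma>N"
    then have "AE x in face_measure F. x \<notin> \<Gamma>D"
      using AE_face_measure_rel_interior[OF face(3)] bd(2) by (auto elim!: eventually_mono)
    \<comment> \<open>Measurability of \<open>\<Gamma>D\<close> for the face measure comes out of
      completeness here.\<close>
    then have "\<Gamma>D \<in> null_sets (face_measure F)"
      unfolding face_measure_alt by (subst completion.null_sets_iff_AE) auto
    then show False using KF(2) by (simp add: measure_eq_0_null_sets)
  qed
  ultimately have "rel_interior F \<subseteq> \<Gamma>D" using mesh_facet_position face(1) facet(1) by blast
  then show ?thesis using face(1) facet(1) unfolding boundary_faces_def by blast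
qed

end


section \<open>Broken polynomial spaces\<close>

text \<open>The elements of \<open>V\<^sub>h\<close> and \<open>Q\<^sub>h\<close> are extensional functions and hence do not form subspaces of a type
  of functions. They correspond to families of polynomials on the whole space, which are zero outside
  the mesh.\<close>

definition mesh_family :: "'a set \<Rightarrow> 'v::real_vector set \<Rightarrow> ('a \<Rightarrow> 'v) set" where
  "mesh_family T P = {w. (\<forall>K\<in>T. w K \<in> P) \<and> (\<forall>K. K \<notin> T \<longrightarrow> w K = 0)}"

lemma subspace_mesh_family: "subspace P \<Longrightarrow> subspace (mesh_family T P)"
  by (rule subspaceI) (auto simp: mesh_family_def subspace_0 subspace_add subspace_scale)

lemma mesh_family_span:
  fixes P :: "'v::real_vector set" and T :: "'a set"
  assumes "finite T" "finite G" "P \<subseteq> span G"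
  shows "\<exists>H. finite H \<and> mesh_family T P \<subseteq> span H"
proof -
  define \<iota> :: "'a \<Rightarrow> 'v \<Rightarrow> 'a \<Rightarrow> 'v" where "\<iota> K v = (\<lambda>L. if L = K then v else 0)" for K v
  have lin: "linear (\<iota> K)" for K
    by (rule linearI) (auto simp: \<iota>_def fun_eq_iff)
  define H where "H = (\<Union>K\<in>T. \<iota> K ` G)"
  have "mesh_family T P \<subseteq> span H"
  proof
    fix w assume w: "w \<in> mesh_family T P"
    have "w = (\<Sum>K\<in>T. \<iota> K (w K))"
      using w assms(1) by (auto simp: fun_eq_iff sum_fun_apply \<iota>_def mesh_family_def)
    also have "\<dots> \<in> span H"
    proof (rule span_sum)
      fix K assume K: "K \<in> T"
      then have "\<iota> K (w K) \<in> \<iota> K ` span G" using w assms(3) by (auto simp: mesh_family_def)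
      also have "\<dots> = span (\<iota> K ` G)" using linear_span_image[OF lin] by simp
      also have "\<dots> \<subseteq> span H" using K by (intro span_mono) (auto simp: H_def)
      finally show "\<iota> K (w K) \<in> span H" .
    qed
    finally show "w \<in> span H" .
  qed
  moreover have "finite H" using assms by (auto simp: H_def)
  ultimately show ?thesis by blast
qed

definition vec_poly_fun :: "nat \<Rightarrow> (real^'n \<Rightarrow> real^'n) set" where
  "vec_poly_fun k = {q. \<forall>i. (\<lambda>x. q x $ i) \<in> poly_fun k}"

lemma subspace_vec_poly_fun: "subspace (vec_poly_fun k)"
proof (rule subspaceI)
  have eq: "(\<lambda>x. (0 :: real^'n \<Rightarrow> real^'n) x $ i) = 0" "(\<lambda>x. (q + r) x $ i) = (\<lambda>x. q x $ i) + (\<lambda>x. r x $ i)"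
    "(\<lambda>x. (s *\<^sub>R q) x $ i) = s *\<^sub>R (\<lambda>x. q x $ i)" for i and q r :: "real^'n \<Rightarrow> real^'n" and s
    by (simp_all add: fun_eq_iff)
  show "(0 :: real^'n \<Rightarrow> real^'n) \<in> vec_poly_fun k"
    unfolding vec_poly_fun_def mem_Collect_eq eq using subspace_0[OF subspace_poly_fun] by blast
  show "q + r \<in> vec_poly_fun k" if "q \<in> vec_poly_fun k" "r \<in> vec_poly_fun k" for q r :: "real^'n \<Rightarrow> real^'n"
    using that unfolding vec_poly_fun_def mem_Collect_eq eq by (metis subspace_add[OF subspace_poly_fun])
  show "s *\<^sub>R q \<in> vec_poly_fun k" if "q \<in> vec_poly_fun k" for s and q :: "real^'n \<Rightarrow> real^'n"
    using that unfolding vec_poly_fun_def mem_Collect_eq eq by (metis subspace_scale[OF subspace_poly_fun])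
qed

lemma vec_poly_fun_span: "\<exists>G. finite G \<and> vec_poly_fun k \<subseteq> span (G :: (real^'n \<Rightarrow> real^'n) set)"
proof -
  define M where "M = monom_fun ` {\<alpha> :: 'n \<Rightarrow> nat. (\<Sum>i\<in>UNIV. \<alpha> i) \<le> k}"
  have M: "finite M" "poly_fun k = span M"
    using finite_multi_indices poly_fun_eq_span by (auto simp: M_def)
  define \<iota> :: "'n \<Rightarrow> (real^'n \<Rightarrow> real) \<Rightarrow> real^'n \<Rightarrow> real^'n" where "\<iota> i q = (\<lambda>x. q x *\<^sub>R axis i 1)" for i q
  have lin: "linear (\<iota> i)" for i
    by (rule linearI) (auto simp: \<iota>_def fun_eq_iff algebra_simps)
  define G where "G = (\<Union>i\<in>UNIV. \<iota> i ` M)"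
  have "vec_poly_fun k \<subseteq> span G"
  proof
    fix q :: "real^'n \<Rightarrow> real^'n" assume q: "q \<in> vec_poly_fun k"
    have "q x = (\<Sum>i\<in>UNIV. \<iota> i (\<lambda>x. q x $ i)) x" for x
      using basis_expansion[of "q x"] by (simp add: \<iota>_def sum_fun_apply scalar_mult_eq_scaleR)
    then have "q = (\<Sum>i\<in>UNIV. \<iota> i (\<lambda>x. q x $ i))" by blast
    also have "\<dots> \<in> span G"
    proof (rule span_sum)
      fix i
      have "\<iota> i (\<lambda>x. q x $ i) \<in> \<iota> i ` span M" using q M(2) by (auto simp: vec_poly_fun_def)
      also have "\<dots> = span (\<iota> i ` M)" using linear_span_image[OF lin] by simp
      also have "\<dots> \<subseteq> span G" by (intro span_mono) (auto simp: G_def)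
      finally show "\<iota> i (\<lambda>x. q x $ i) \<in> span G" .
    qed
    finally show "q \<in> span G" .
  qed
  moreover have "finite G" using M(1) by (auto simp: G_def)
  ultimately show ?thesis by blast
qed

lemma continuous_on_vec_poly_fun: "q \<in> vec_poly_fun k \<Longrightarrow> continuous_on S q"
  unfolding continuous_on_componentwise[of S q] vec_poly_fun_def
  by (auto simp: Basis_vec_def inner_axis intro: continuous_on_poly_fun)

lemma grad_in_vec_poly_fun: "q \<in> poly_fun k \<Longrightarrow> grad q \<in> vec_poly_fun k"
  by (simp add: vec_poly_fun_def grad_in_poly_fun)

lemma vec_poly_fun_eq_0_AE:
  assumes q: "q \<in> vec_poly_fun k" and K: "K \<in> sets lebesgue" "interior K \<noteq> {}"
    and 0: "AE x in lebesgue_on K. q x = 0"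
  shows "q = 0"
proof
  fix x
  have "AE x in lebesgue_on K. q x $ i = 0" for i using 0 by eventually_elim simp
  then have "q x $ i = 0" for i
    using q K by (intro poly_fun_eq_0_AE[of "\<lambda>x. q x $ i" k K]) (auto simp: vec_poly_fun_def)
  then show "q x = 0 x" by (simp add: vec_eq_iff)
qed

section \<open>Passage between polynomial families and extensional families\<close>

definition restrict_family :: "'a set set \<Rightarrow> ('a set \<Rightarrow> 'a \<Rightarrow> 'b) \<Rightarrow> 'a set \<Rightarrow> 'a \<Rightarrow> 'b" where
  "restrict_family T w = (\<lambda>K\<in>T. restrict (w K) K)"

lemma restrict_family_apply [simp]: "K \<in> T \<Longrightarrow> x \<in> K \<Longrightarrow> restrict_family T w K x = w K x"
  by (simp add: restrict_family_def)

text \<open>The value \<open>undefined\<close> outside the mesh is replaced by 0, so that the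
  representing families form a vector space.\<close>

lemma PiE_restrict_eq_image:
  fixes P :: "('a \<Rightarrow> 'b::real_vector) set"
  shows "(\<Pi>\<^sub>E K\<in>T. {restrict q K | q. q \<in> P}) = restrict_family T ` mesh_family T P"
proof safe
  fix v assume v: "v \<in> (\<Pi>\<^sub>E K\<in>T. {restrict q K | q. q \<in> P})"
  then have "\<forall>K\<in>T. \<exists>q. q \<in> P \<and> v K = restrict q K" by (auto simp: PiE_iff)
  then obtain w where w: "\<And>K. K \<in> T \<Longrightarrow> w K \<in> P \<and> v K = restrict (w K) K" by metis
  define w' where "w' K = (if K \<in> T then w K else 0)" for K
  have "v = restrict_family T w'"
  proof
    fix K
    show "v K = restrict_family T w' K"
      using v w by (cases "K \<in> T") (auto simp: restrict_family_def w'_def PiE_iff extensional_def)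
  qed
  moreover have "w' \<in> mesh_family T P" using w by (auto simp: mesh_family_def w'_def)
  ultimately show "v \<in> restrict_family T ` mesh_family T P" by blast
qed (auto simp: mesh_family_def restrict_family_def)

lemma V_h_eq: "V_h k T = restrict_family T ` mesh_family T (poly_fun k)"
  unfolding V_h_def by (rule PiE_restrict_eq_image)

lemma Q_h_eq: "Q_h k T = restrict_family T ` mesh_family T (vec_poly_fun k)"
  unfolding Q_h_def PiE_restrict_eq_image[symmetric] vec_poly_fun_def by simp

lemma neighbours_iff: "K \<in> neighbours T e \<longleftrightarrow> K \<in> T \<and> e \<subseteq> K"
  by (simp add: neighbours_def)

lemma face_terms_restrict_family:
  assumes "x \<in> e"
  shows "jump T (restrict_family T w) e x = jump T w e x"
    "normal_jump T (restrict_family T z) e x = normal_jump T z e x"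
    "average T (restrict_family T z) e x = average T z e x"
  using assms by (auto simp: jump_def normal_jump_def average_def neighbours_iff subset_iff
      intro!: sum.cong arg_cong[where f = "scaleR (1/2)"])

lemma face_terms_linear:
  "jump T (s *\<^sub>R u + t *\<^sub>R v) e x = s *\<^sub>R jump T u e x + t *\<^sub>R jump T v e x"
  "normal_jump T (s *\<^sub>R y + t *\<^sub>R z) e x = s * normal_jump T y e x + t * normal_jump T z e x"
  "average T (s *\<^sub>R y + t *\<^sub>R z) e x = s *\<^sub>R average T y e x + t *\<^sub>R average T z e x"
  by (simp_all add: jump_def normal_jump_def average_def scaleR_sum_right sum_distrib_left
      inner_add_left sum.distrib[symmetric] algebra_simps)

lemma integrable_lebesgue_on_continuous:
  fixes f :: "'a::euclidean_space \<Rightarrow> 'b::euclidean_space"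
  assumes K: "compact K" and f: "continuous_on UNIV f"
  shows "integrable (lebesgue_on K) f"
proof -
  have "compact (f ` K)"
    using K continuous_on_subset[OF f subset_UNIV] by (rule compact_continuous_image[rotated])
  then obtain B where B: "\<And>x. x \<in> K \<Longrightarrow> norm (f x) \<le> B"
    using compact_imp_bounded by (force simp: bounded_iff)
  have Km: "K \<in> lmeasurable" using K by (rule lmeasurable_compact)
  have "f \<in> borel_measurable (lebesgue_on K)"
    using Km continuous_on_subset[OF f subset_UNIV]
    by (intro continuous_imp_measurable_on_sets_lebesgue) auto
  then show ?thesis
    using B by (intro finite_measure.integrable_const_bound[OF finite_measure_lebesgue_on[OF Km], of _ B] AE_I2)
       auto
qed

lemma integral_lincomb:
  fixes f g h :: "'a \<Rightarrow> real"
  assumes "integrable M f" "integrable M g" "\<And>x. h x = s * f x + t * g x"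
  shows "(\<integral>x. h x \<partial>M) = s * (\<integral>x. f x \<partial>M) + t * (\<integral>x. g x \<partial>M)"
  using assms by simp


section \<open>The discrete gradient\<close>

definition dg_form ::
  "(real^'n) set set \<Rightarrow> ((real^'n) set \<Rightarrow> real^'n \<Rightarrow> real^'n) \<Rightarrow> ((real^'n) set \<Rightarrow> real^'n \<Rightarrow> real^'n) \<Rightarrow> real" where
  "dg_form T y z = (\<Sum>K\<in>T. \<integral>x. y K x \<bullet> z K x \<partial>lebesgue_on K)"

definition dg_rhs ::
  "(real^'n) set set \<Rightarrow> (real^'n) set \<Rightarrow> (real^'n) set \<Rightarrow> ((real^'n) set \<Rightarrow> real^'n) \<Rightarrow> (real^'n \<Rightarrow> real) \<Rightarrow>
   ((real^'n) set \<Rightarrow> real^'n \<Rightarrow> real) \<Rightarrow> ((real^'n) set \<Rightarrow> real^'n \<Rightarrow> real^'n) \<Rightarrow> real" where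
  "dg_rhs T \<Omega> \<Gamma>D C12 g w z =
     (\<Sum>K\<in>T. \<integral>x. grad (w K) x \<bullet> z K x \<partial>lebesgue_on K)
     - (\<Sum>e\<in>interior_faces T \<Omega>.
          \<integral>x. jump T w e x \<bullet> (average T z e x - normal_jump T z e x *\<^sub>R C12 e) \<partial>face_measure e)
     - (\<Sum>(K, F)\<in>boundary_faces T \<Gamma>D.
          \<integral>x. (w K x - g x) * (z K x \<bullet> outward_normal K F) \<partial>face_measure F)"

lemma D_DG_alt:
  "D_DG k T \<Omega> \<Gamma>D C12 v g =
     (THE D. D \<in> Q_h k T \<and> (\<forall>\<zeta>\<in>Q_h k T. dg_form T D \<zeta> = dg_rhs T \<Omega> \<Gamma>D C12 g v \<zeta>))"
  by (simp add: D_DG_def dg_form_def dg_rhs_def)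

lemma dg_form_commute: "dg_form T y z = dg_form T z y"
  by (simp add: dg_form_def inner_commute)

lemma W_D: "w \<in> mesh_family T (poly_fun k) \<Longrightarrow> K \<in> T \<Longrightarrow> w K \<in> poly_fun k"
  by (simp add: mesh_family_def)

lemma Y_D: "y \<in> mesh_family T (vec_poly_fun k) \<Longrightarrow> K \<in> T \<Longrightarrow> y K \<in> vec_poly_fun k"
  by (simp add: mesh_family_def)

lemmas W_cont = continuous_on_poly_fun[OF W_D]
lemmas Y_cont = continuous_on_vec_poly_fun[OF Y_D]

context
  fixes \<Omega> \<Gamma>D \<Gamma>N :: "(real^'n) set" and T :: "(real^'n) set set" and k :: nat
  assumes mesh: "dg_mesh \<Omega> \<Gamma>D \<Gamma>N T"
begin

lemma element_integrable:
  fixes f :: "real^'n \<Rightarrow> 'b::euclidean_space"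
  shows "K \<in> T \<Longrightarrow> continuous_on UNIV f \<Longrightarrow> integrable (lebesgue_on K) f"
  using mesh_element(2)[OF mesh] by (rule integrable_lebesgue_on_continuous)

lemma interior_face_flat: "e \<in> interior_faces T \<Omega> \<Longrightarrow> flat_face e"
  using interior_faceE[OF mesh] by blast

lemma form_integrable:
  assumes "y \<in> mesh_family T (vec_poly_fun k)" "z \<in> mesh_family T (vec_poly_fun k)" "K \<in> T"
  shows "integrable (lebesgue_on K) (\<lambda>x. y K x \<bullet> z K x)"
  by (intro element_integrable assms(3) continuous_on_inner Y_cont[OF assms(1,3)] Y_cont[OF assms(2,3)])

lemma gradient_term_integrable:
  assumes "w \<in> mesh_family T (poly_fun k)" "z \<in> mesh_family T (vec_poly_fun k)" "K \<in> T"
  shows "integrable (lebesgue_on K) (\<lambda>x. grad (w K) x \<bullet> z K x)"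
  by (intro element_integrable assms(3) continuous_on_inner Y_cont[OF assms(2,3)]
      continuous_on_vec_poly_fun[OF grad_in_vec_poly_fun[OF W_D[OF assms(1,3)]]])

lemma jump_continuous:
  assumes "w \<in> mesh_family T (poly_fun k)"
  shows "continuous_on UNIV (jump T w e)"
  unfolding jump_def[abs_def]
  by (intro continuous_intros W_cont[OF assms]) (auto simp: neighbours_iff)

lemma jump_term_integrable:
  assumes "w \<in> mesh_family T (poly_fun k)" "z \<in> mesh_family T (vec_poly_fun k)" "e \<in> interior_faces T \<Omega>"
  shows "integrable (face_measure e) (\<lambda>x. jump T w e x \<bullet> (average T z e x - normal_jump T z e x *\<^sub>R C12 e))"
proof (rule integrable_face_measure_continuous[OF interior_face_flat[OF assms(3)]])
  have "continuous_on UNIV (average T z e)" "continuous_on UNIV (normal_jump T z e)"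
    unfolding average_def[abs_def] normal_jump_def[abs_def]
    by (intro continuous_intros Y_cont[OF assms(2)]; simp add: neighbours_iff)+
  then show "continuous_on UNIV (\<lambda>x. jump T w e x \<bullet> (average T z e x - normal_jump T z e x *\<^sub>R C12 e))"
    by (intro continuous_intros jump_continuous assms(1))
qed

lemma dg_form_lincomb:
  assumes "y \<in> mesh_family T (vec_poly_fun k)" "y' \<in> mesh_family T (vec_poly_fun k)"
    "z \<in> mesh_family T (vec_poly_fun k)"
  shows "dg_form T (s *\<^sub>R y + t *\<^sub>R y') z = s * dg_form T y z + t * dg_form T y' z"
  unfolding dg_form_def sum_distrib_left sum.distrib[symmetric]
proof (rule sum.cong[OF refl])
  fix K assume "K \<in> T"
  then show "(\<integral>x. (s *\<^sub>R y + t *\<^sub>R y') K x \<bullet> z K x \<partial>lebesgue_on K) =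
      s * (\<integral>x. y K x \<bullet> z K x \<partial>lebesgue_on K) + t * (\<integral>x. y' K x \<bullet> z K x \<partial>lebesgue_on K)"
    using assms by (intro integral_lincomb form_integrable) (simp_all add: inner_add_left)
qed

text \<open>Definiteness of the broken \<open>L\<^sup>2\<close> product: all summands are
  nonnegative, and a polynomial that vanishes almost everywhere on an element is zero on the whole
  space.\<close>

lemma dg_form_eq_0:
  assumes y: "y \<in> mesh_family T (vec_poly_fun k)" and 0: "dg_form T y y = 0"
  shows "y = 0"
proof
  fix K
  show "y K = 0 K"
  proof (cases "K \<in> T")
    case True
    have "(\<integral>x. y K x \<bullet> y K x \<partial>lebesgue_on K) = 0"
      using 0 True finite_mesh[OF mesh] unfolding dg_form_def
      by (subst (asm) sum_nonneg_eq_0_iff) (auto intro!: Bochner_Integration.integral_nonneg)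
    then have "AE x in lebesgue_on K. y K x \<bullet> y K x = 0"
      using integral_nonneg_eq_0_iff_AE[OF form_integrable[OF y y True]] by simp
    then have "AE x in lebesgue_on K. y K x = 0" by simp
    moreover have "K \<in> sets lebesgue" using mesh_element(3)[OF mesh True] by simp
    ultimately show ?thesis
      using vec_poly_fun_eq_0_AE[OF Y_D[OF y True]] mesh_element(7)[OF mesh True] by simp
  qed (use y in \<open>simp add: mesh_family_def\<close>)
qed

context
  fixes g :: "real^'n \<Rightarrow> real" and C12 :: "(real^'n) set \<Rightarrow> real^'n"
  assumes g: "\<And>K F. (K, F) \<in> boundary_faces T \<Gamma>D \<Longrightarrow> integrable (face_measure F) g"
begin

lemma Dirichlet_term_integrable:
  assumes "w \<in> mesh_family T (poly_fun k)" "z \<in> mesh_family T (vec_poly_fun k)"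
    and KF: "(K, F) \<in> boundary_faces T \<Gamma>D"
  shows "integrable (face_measure F) (\<lambda>x. (w K x - g x) * (z K x \<bullet> outward_normal K F))"
proof -
  note face = boundary_face[OF mesh KF]
  have "integrable (face_measure F) (w K)"
    by (rule integrable_face_measure_continuous[OF face(3) W_cont[OF assms(1) face(1)]])
  moreover have "continuous_on UNIV (\<lambda>x. z K x \<bullet> outward_normal K F)"
    by (intro continuous_intros Y_cont[OF assms(2) face(1)])
  ultimately show ?thesis
    by (intro integrable_face_measure_mult[OF face(3)] Bochner_Integration.integrable_diff g[OF KF])
qed

lemma dg_rhs_lincomb:
  assumes w: "w \<in> mesh_family T (poly_fun k)"
    and z: "z \<in> mesh_family T (vec_poly_fun k)" "z' \<in> mesh_family T (vec_poly_fun k)"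
  shows "dg_rhs T \<Omega> \<Gamma>D C12 g w (s *\<^sub>R z + t *\<^sub>R z') =
    s * dg_rhs T \<Omega> \<Gamma>D C12 g w z + t * dg_rhs T \<Omega> \<Gamma>D C12 g w z'"
proof -
  have "(\<integral>x. grad (w K) x \<bullet> (s *\<^sub>R z + t *\<^sub>R z') K x \<partial>lebesgue_on K) =
      s * (\<integral>x. grad (w K) x \<bullet> z K x \<partial>lebesgue_on K) + t * (\<integral>x. grad (w K) x \<bullet> z' K x \<partial>lebesgue_on K)"
    if "K \<in> T" for K
    using w z that by (intro integral_lincomb gradient_term_integrable) (simp_all add: inner_add_right)
  moreover have "(\<integral>x. jump T w e x \<bullet> (average T (s *\<^sub>R z + t *\<^sub>R z') e x -
        normal_jump T (s *\<^sub>R z + t *\<^sub>R z') e x *\<^sub>R C12 e) \<partial>face_measure e) =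
      s * (\<integral>x. jump T w e x \<bullet> (average T z e x - normal_jump T z e x *\<^sub>R C12 e) \<partial>face_measure e) +
      t * (\<integral>x. jump T w e x \<bullet> (average T z' e x - normal_jump T z' e x *\<^sub>R C12 e) \<partial>face_measure e)"
    if "e \<in> interior_faces T \<Omega>" for e
    using w z that
    by (intro integral_lincomb jump_term_integrable) (simp_all add: face_terms_linear inner_simps algebra_simps)
  moreover have "(\<integral>x. (w K x - g x) * ((s *\<^sub>R z + t *\<^sub>R z') K x \<bullet> outward_normal K F) \<partial>face_measure F) =
      s * (\<integral>x. (w K x - g x) * (z K x \<bullet> outward_normal K F) \<partial>face_measure F) +
      t * (\<integral>x. (w K x - g x) * (z' K x \<bullet> outward_normal K F) \<partial>face_measure F)"
    if "(K, F) \<in> boundary_faces T \<Gamma>D" for K F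
    using w z that
    by (intro integral_lincomb Dirichlet_term_integrable) (simp_all add: inner_simps algebra_simps)
  ultimately show ?thesis
    unfolding dg_rhs_def
    by (simp add: case_prod_unfold sum.distrib algebra_simps flip: sum_distrib_left cong: sum.cong)
qed

text \<open>Weights with sum one are essential: they reproduce the fixed datum \<open>g\<close> in
  the Dirichlet term.\<close>

lemma dg_rhs_affine:
  assumes w: "u \<in> mesh_family T (poly_fun k)" "v \<in> mesh_family T (poly_fun k)"
    and z: "z \<in> mesh_family T (vec_poly_fun k)"
  shows "dg_rhs T \<Omega> \<Gamma>D C12 g ((1 - s) *\<^sub>R u + s *\<^sub>R v) z =
    (1 - s) * dg_rhs T \<Omega> \<Gamma>D C12 g u z + s * dg_rhs T \<Omega> \<Gamma>D C12 g v z"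
proof -
  have "(\<integral>x. grad (((1 - s) *\<^sub>R u + s *\<^sub>R v) K) x \<bullet> z K x \<partial>lebesgue_on K) =
      (1 - s) * (\<integral>x. grad (u K) x \<bullet> z K x \<partial>lebesgue_on K) + s * (\<integral>x. grad (v K) x \<bullet> z K x \<partial>lebesgue_on K)"
    if K: "K \<in> T" for K
  proof (rule integral_lincomb[OF gradient_term_integrable[OF w(1) z K] gradient_term_integrable[OF w(2) z K]])
    fix x
    have d: "u K differentiable (at x)" "v K differentiable (at x)"
      using differentiable_poly_fun[OF W_D[OF w(1) K]] differentiable_poly_fun[OF W_D[OF w(2) K]] .
    have "(r *\<^sub>R q) differentiable (at x)" if "q differentiable (at x)" for r and q :: "real^'n \<Rightarrow> real"
      unfolding scaleR_fun_def using that by (rule differentiable_scaleR[OF differentiable_const])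
    then show "grad (((1 - s) *\<^sub>R u + s *\<^sub>R v) K) x \<bullet> z K x =
        (1 - s) * (grad (u K) x \<bullet> z K x) + s * (grad (v K) x \<bullet> z K x)"
      using d by (simp add: grad_add grad_scaleR inner_add_left)
  qed
  moreover have "(\<integral>x. jump T ((1 - s) *\<^sub>R u + s *\<^sub>R v) e x \<bullet> (average T z e x - normal_jump T z e x *\<^sub>R C12 e) \<partial>face_measure e) =
      (1 - s) * (\<integral>x. jump T u e x \<bullet> (average T z e x - normal_jump T z e x *\<^sub>R C12 e) \<partial>face_measure e) +
      s * (\<integral>x. jump T v e x \<bullet> (average T z e x - normal_jump T z e x *\<^sub>R C12 e) \<partial>face_measure e)"
    if "e \<in> interior_faces T \<Omega>" for e
    using w z that
    by (intro integral_lincomb jump_term_integrable) (simp_all only: face_terms_linear inner_add_left inner_scaleR_left)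
  moreover have "(\<integral>x. (((1 - s) *\<^sub>R u + s *\<^sub>R v) K x - g x) * (z K x \<bullet> outward_normal K F) \<partial>face_measure F) =
      (1 - s) * (\<integral>x. (u K x - g x) * (z K x \<bullet> outward_normal K F) \<partial>face_measure F) +
      s * (\<integral>x. (v K x - g x) * (z K x \<bullet> outward_normal K F) \<partial>face_measure F)"
    if "(K, F) \<in> boundary_faces T \<Gamma>D" for K F
    using w z that
    by (intro integral_lincomb Dirichlet_term_integrable) (simp_all add: algebra_simps)
  ultimately show ?thesis
    unfolding dg_rhs_def
    by (simp only: case_prod_unfold sum.distrib right_diff_distrib sum_distrib_left prod.collapse cong: sum.cong)
qed

text \<open>Existence is Riesz representation; for uniqueness the difference of two solutions is
  itself used as test function.\<close>

lemma ex1_discrete_gradient: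
  assumes "w \<in> mesh_family T (poly_fun k)"
  shows "\<exists>!y. y \<in> mesh_family T (vec_poly_fun k) \<and>
    (\<forall>z\<in>mesh_family T (vec_poly_fun k). dg_form T y z = dg_rhs T \<Omega> \<Gamma>D C12 g w z)"
proof (rule ex_ex1I)
  let ?Y = "mesh_family T (vec_poly_fun k :: (real^'n \<Rightarrow> real^'n) set)"
  have sub: "subspace ?Y" by (intro subspace_mesh_family subspace_vec_poly_fun)
  obtain G where G: "finite (G :: (real^'n \<Rightarrow> real^'n) set)" "vec_poly_fun k \<subseteq> span G"
    using vec_poly_fun_span by blast
  then obtain H where H: "finite H" "?Y \<subseteq> span H"
    using mesh_family_span[OF finite_mesh[OF mesh]] by blast
  have 1: "dg_form T (y + y') z = dg_form T y z + dg_form T y' z"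
    "dg_rhs T \<Omega> \<Gamma>D C12 g w (y + y') = dg_rhs T \<Omega> \<Gamma>D C12 g w y + dg_rhs T \<Omega> \<Gamma>D C12 g w y'"
    if "y \<in> ?Y" "y' \<in> ?Y" "z \<in> ?Y" for y y' z
    using dg_form_lincomb[OF that, of 1 1] dg_rhs_lincomb[OF assms that(1,2), of 1 1] by simp_all
  have 2: "dg_form T (c *\<^sub>R y) z = c * dg_form T y z"
    "dg_rhs T \<Omega> \<Gamma>D C12 g w (c *\<^sub>R y) = c * dg_rhs T \<Omega> \<Gamma>D C12 g w y"
    if "y \<in> ?Y" "z \<in> ?Y" for c y z
    using dg_form_lincomb[OF that(1,1,2), of c 0] dg_rhs_lincomb[OF assms that(1,1), of c 0] by simp_all
  have "\<exists>D\<in>?Y. \<forall>z\<in>?Y. dg_form T D z = dg_rhs T \<Omega> \<Gamma>D C12 g w z"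
    by (rule riesz_finite_dim[OF sub H]) (rule 1(1) 2(1) dg_form_commute dg_form_eq_0 1(2) 2(2); assumption?)+
  then show "\<exists>y. y \<in> ?Y \<and> (\<forall>z\<in>?Y. dg_form T y z = dg_rhs T \<Omega> \<Gamma>D C12 g w z)" by blast
  fix y y'
  assume y: "y \<in> ?Y \<and> (\<forall>z\<in>?Y. dg_form T y z = dg_rhs T \<Omega> \<Gamma>D C12 g w z)"
    and y': "y' \<in> ?Y \<and> (\<forall>z\<in>?Y. dg_form T y' z = dg_rhs T \<Omega> \<Gamma>D C12 g w z)"
  have d: "y - y' \<in> ?Y" using y y' sub by (blast intro: subspace_diff)
  have "dg_form T (1 *\<^sub>R y + (- 1) *\<^sub>R y') (y - y') = 0"
    using y y' d by (subst dg_form_lincomb) auto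
  then have "y - y' = 0" using d by (intro dg_form_eq_0) simp_all
  then show "y = y'" by simp
qed

text \<open>Counterpart of \<open>D_DG\<close> on unrestricted polynomial families, where linear
  algebra is available; \<open>D_DG_restrict_family\<close> connects the two.\<close>

definition discrete_gradient :: "((real^'n) set \<Rightarrow> real^'n \<Rightarrow> real) \<Rightarrow> (real^'n) set \<Rightarrow> real^'n \<Rightarrow> real^'n" where
  "discrete_gradient w = (THE y. y \<in> mesh_family T (vec_poly_fun k) \<and>
    (\<forall>z\<in>mesh_family T (vec_poly_fun k). dg_form T y z = dg_rhs T \<Omega> \<Gamma>D C12 g w z))"

lemma discrete_gradient:
  assumes "w \<in> mesh_family T (poly_fun k)"
  shows "discrete_gradient w \<in> mesh_family T (vec_poly_fun k)"
    "z \<in> mesh_family T (vec_poly_fun k) \<Longrightarrow> dg_form T (discrete_gradient w) z = dg_rhs T \<Omega> \<Gamma>D C12 g w z"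
  using theI'[OF ex1_discrete_gradient[OF assms]] unfolding discrete_gradient_def by blast+

lemma discrete_gradient_affine:
  assumes w: "u \<in> mesh_family T (poly_fun k)" "v \<in> mesh_family T (poly_fun k)"
  shows "discrete_gradient ((1 - s) *\<^sub>R u + s *\<^sub>R v) = (1 - s) *\<^sub>R discrete_gradient u + s *\<^sub>R discrete_gradient v"
proof -
  let ?W = "mesh_family T (poly_fun k :: (real^'n \<Rightarrow> real) set)"
    and ?Y = "mesh_family T (vec_poly_fun k :: (real^'n \<Rightarrow> real^'n) set)"
  have sub: "subspace ?W" "subspace ?Y"
    by (intro subspace_mesh_family subspace_vec_poly_fun subspace_poly_fun)+
  have uv: "(1 - s) *\<^sub>R u + s *\<^sub>R v \<in> ?W" using w sub(1) by (intro subspace_add subspace_scale)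
  have Y: "(1 - s) *\<^sub>R discrete_gradient u + s *\<^sub>R discrete_gradient v \<in> ?Y"
    using discrete_gradient(1) w sub(2) by (intro subspace_add subspace_scale)
  show ?thesis
    using ex1_discrete_gradient[OF uv]
  proof (rule ex1E)
    fix y
    assume uniq: "\<forall>y'. y' \<in> ?Y \<and> (\<forall>z\<in>?Y. dg_form T y' z = dg_rhs T \<Omega> \<Gamma>D C12 g ((1 - s) *\<^sub>R u + s *\<^sub>R v) z) \<longrightarrow> y' = y"
    have "discrete_gradient ((1 - s) *\<^sub>R u + s *\<^sub>R v) = y"
      using uniq discrete_gradient[OF uv] by blast
    moreover have "\<forall>z\<in>?Y. dg_form T ((1 - s) *\<^sub>R discrete_gradient u + s *\<^sub>R discrete_gradient v) z =
        dg_rhs T \<Omega> \<Gamma>D C12 g ((1 - s) *\<^sub>R u + s *\<^sub>R v) z"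
      using discrete_gradient[OF w(1)] discrete_gradient[OF w(2)]
      by (simp add: dg_form_lincomb dg_rhs_affine w)
    then have "(1 - s) *\<^sub>R discrete_gradient u + s *\<^sub>R discrete_gradient v = y" using uniq Y by blast
    ultimately show ?thesis by simp
  qed
qed

lemma dg_form_restrict_family:
  "dg_form T (restrict_family T y) (restrict_family T z) = dg_form T y z"
  unfolding dg_form_def
  by (intro sum.cong refl Bochner_Integration.integral_cong) (auto simp: space_restrict_space)

text \<open>The gradient is local, so restriction preserves it in the interior of an element. On the
  frontier the restricted function has no controlled derivative, but the frontier of a convex set is
  null. Face terms only see values on the face.\<close>

lemma dg_rhs_restrict_family:
  assumes w: "w \<in> mesh_family T (poly_fun k)"
  shows "dg_rhs T \<Omega> \<Gamma>D C12 g (restrict_family T w) (restrict_family T z) = dg_rhs T \<Omega> \<Gamma>D C12 g w z"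
proof -
  have "(\<integral>x. grad (restrict_family T w K) x \<bullet> restrict_family T z K x \<partial>lebesgue_on K) =
      (\<integral>x. grad (w K) x \<bullet> z K x \<partial>lebesgue_on K)" if K: "K \<in> T" for K
  proof (rule complete_measure.integral_AE_eq[OF complete_measure_lebesgue_on])
    show Km: "K \<in> sets lebesgue" using mesh_element(3)[OF mesh K] by simp
    have eq: "grad (restrict_family T w K) x \<bullet> restrict_family T z K x = grad (w K) x \<bullet> z K x"
      if x: "x \<in> interior K" for x
    proof -
      have "grad (restrict_family T w K) x = grad (w K) x"
        using K x interior_subset[of K] differentiable_poly_fun[OF W_D[OF w K]]
        by (intro grad_eq_on_open[OF open_interior x]) auto
      then show ?thesis using K x interior_subset[of K] by auto
    qed
    have "negligible (frontier K)" using mesh_element(1)[OF mesh K] by (rule negligible_convex_frontier)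
    then have "AE x in lebesgue. x \<notin> frontier K"
      by (simp add: negligible_iff_null_sets AE_not_in)
    then have "AE x in lebesgue. x \<in> K \<longrightarrow> x \<in> interior K"
      by eventually_elim (use closure_subset[of K] in \<open>auto simp: frontier_def\<close>)
    then have "AE x in lebesgue_on K. x \<in> interior K"
      using Km by (simp add: AE_restrict_space_iff)
    then show "AE x in lebesgue_on K.
        grad (restrict_family T w K) x \<bullet> restrict_family T z K x = grad (w K) x \<bullet> z K x"
      by eventually_elim (rule eq)
  qed
  moreover have "(\<integral>x. jump T (restrict_family T w) e x \<bullet> (average T (restrict_family T z) e x -
        normal_jump T (restrict_family T z) e x *\<^sub>R C12 e) \<partial>face_measure e) =
      (\<integral>x. jump T w e x \<bullet> (average T z e x - normal_jump T z e x *\<^sub>R C12 e) \<partial>face_measure e)"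
    if "e \<in> interior_faces T \<Omega>" for e
    using interior_face_flat[OF that] by (intro integral_face_measure_cong) (simp_all add: face_terms_restrict_family)
  moreover have "(\<integral>x. (restrict_family T w K x - g x) * (restrict_family T z K x \<bullet> outward_normal K F) \<partial>face_measure F) =
      (\<integral>x. (w K x - g x) * (z K x \<bullet> outward_normal K F) \<partial>face_measure F)"
    if "(K, F) \<in> boundary_faces T \<Gamma>D" for K F
    using boundary_face[OF mesh that] by (intro integral_face_measure_cong) (auto simp: subset_iff)
  ultimately show ?thesis
    unfolding dg_rhs_def by (simp add: case_prod_unfold cong: sum.cong)
qed

lemma D_DG_restrict_family:
  assumes w: "w \<in> mesh_family T (poly_fun k)"
  shows "D_DG k T \<Omega> \<Gamma>D C12 (restrict_family T w) g = restrict_family T (discrete_gradient w)"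
  unfolding D_DG_alt
proof (rule the_equality)
  show "restrict_family T (discrete_gradient w) \<in> Q_h k T \<and>
      (\<forall>\<zeta>\<in>Q_h k T. dg_form T (restrict_family T (discrete_gradient w)) \<zeta> =
        dg_rhs T \<Omega> \<Gamma>D C12 g (restrict_family T w) \<zeta>)"
    using discrete_gradient[OF w] by (auto simp: Q_h_eq dg_form_restrict_family dg_rhs_restrict_family[OF w])
  fix D
  assume D: "D \<in> Q_h k T \<and> (\<forall>\<zeta>\<in>Q_h k T. dg_form T D \<zeta> = dg_rhs T \<Omega> \<Gamma>D C12 g (restrict_family T w) \<zeta>)"
  then obtain y where y: "y \<in> mesh_family T (vec_poly_fun k)" "D = restrict_family T y"
    by (auto simp: Q_h_eq)
  then have "\<forall>z\<in>mesh_family T (vec_poly_fun k). dg_form T y z = dg_rhs T \<Omega> \<Gamma>D C12 g w z"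
    using D by (auto simp: Q_h_eq dg_form_restrict_family dg_rhs_restrict_family[OF w])
  then have "y = discrete_gradient w"
    using ex1_discrete_gradient[OF w] discrete_gradient[OF w] y(1) by blast
  then show "D = restrict_family T (discrete_gradient w)" using y(2) by simp
qed

end

end


section \<open>Unique minimizer of the discrete energy\<close>

text \<open>Supplies the hypothesis \<open>sep\<close> of the abstract minimization theorem.\<close>

lemma broken_function_eqI:
  fixes \<Omega> \<Gamma>D \<Gamma>N :: "(real^'n) set"
  assumes mesh: "dg_mesh \<Omega> \<Gamma>D \<Gamma>N T" and dom: "open \<Omega>" "connected \<Omega>"
    and bd: "frontier \<Omega> = \<Gamma>D \<union> \<Gamma>N"
    and KF: "(K0, F0) \<in> boundary_faces T \<Gamma>D"
    and g: "\<And>K F. (K, F) \<in> boundary_faces T \<Gamma>D \<Longrightarrow> integrable (face_measure F) g"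
    and u: "u \<in> mesh_family T (poly_fun k)" and v: "v \<in> mesh_family T (poly_fun k)"
    and grad: "\<And>K. K \<in> T \<Longrightarrow> AE x in lebesgue_on K.
      discrete_gradient \<Omega> \<Gamma>D T k g C12 u K x = discrete_gradient \<Omega> \<Gamma>D T k g C12 v K x"
    and jumps: "\<And>e. e \<in> interior_faces T \<Omega> \<Longrightarrow> AE x in face_measure e. jump T u e x = jump T v e x"
    and traces: "\<And>K F. (K, F) \<in> boundary_faces T \<Gamma>D \<Longrightarrow> AE x in face_measure F. u K x = v K x"
  shows "u = v"
proof -
  let ?Y = "mesh_family T (vec_poly_fun k :: (real^'n \<Rightarrow> real^'n) set)"
  note dG = discrete_gradient[OF mesh g, where k = k and ?C12.0 = C12]
  \<comment> \<open>The face terms of \<open>dg_rhs\<close> coincide for \<open>u\<close> and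
    \<open>v\<close>, so equality of the discrete gradients leaves only the volume terms, and for
    this test family their difference is \<open>dg_form T z z\<close>.\<close>
  define z where "z K = (if K \<in> T then (\<lambda>x. grad (u K) x - grad (v K) x) else 0)" for K
  have uK: "u K \<in> poly_fun k" and vK: "v K \<in> poly_fun k" if "K \<in> T" for K
    using u v that by (auto simp: mesh_family_def)
  have "grad (u K) - grad (v K) \<in> vec_poly_fun k" if "K \<in> T" for K
    using subspace_diff[OF subspace_vec_poly_fun grad_in_vec_poly_fun grad_in_vec_poly_fun] uK vK that by blast
  then have zY: "z \<in> ?Y" by (simp add: mesh_family_def z_def fun_diff_def)
  have "dg_rhs T \<Omega> \<Gamma>D C12 g u z = dg_rhs T \<Omega> \<Gamma>D C12 g v z"
  proof -
    have "dg_form T (discrete_gradient \<Omega> \<Gamma>D T k g C12 u) z = dg_form T (discrete_gradient \<Omega> \<Gamma>D T k g C12 v) z"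
      unfolding dg_form_def
    proof (rule sum.cong[OF refl])
      fix K assume K: "K \<in> T"
      have "K \<in> sets lebesgue" using mesh_element(3)[OF mesh K] by simp
      then show "(\<integral>x. discrete_gradient \<Omega> \<Gamma>D T k g C12 u K x \<bullet> z K x \<partial>lebesgue_on K) =
          (\<integral>x. discrete_gradient \<Omega> \<Gamma>D T k g C12 v K x \<bullet> z K x \<partial>lebesgue_on K)"
        using grad[OF K]
        by (intro complete_measure.integral_AE_eq[OF complete_measure_lebesgue_on]) (auto elim!: eventually_mono)
    qed
    then show ?thesis using dG(2)[OF _ u zY] dG(2)[OF _ v zY] by simp
  qed
  moreover have "(\<integral>x. jump T u e x \<bullet> q x \<partial>face_measure e) = (\<integral>x. jump T v e x \<bullet> q x \<partial>face_measure e)"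
    if "e \<in> interior_faces T \<Omega>" for e q
    using jumps[OF that] unfolding face_measure_alt
    by (intro completion.integral_AE_eq) (auto elim!: eventually_mono)
  moreover have "(\<integral>x. (u K x - g x) * q x \<partial>face_measure F) = (\<integral>x. (v K x - g x) * q x \<partial>face_measure F)"
    if "(K, F) \<in> boundary_faces T \<Gamma>D" for K F q
    using traces[OF that] unfolding face_measure_alt
    by (intro completion.integral_AE_eq) (auto elim!: eventually_mono)
  ultimately have "(\<Sum>K\<in>T. \<integral>x. grad (u K) x \<bullet> z K x \<partial>lebesgue_on K) =
      (\<Sum>K\<in>T. \<integral>x. grad (v K) x \<bullet> z K x \<partial>lebesgue_on K)"
    unfolding dg_rhs_def by (simp add: case_prod_unfold cong: sum.cong)
  moreover have "dg_form T z z = (\<Sum>K\<in>T. \<integral>x. grad (u K) x \<bullet> z K x \<partial>lebesgue_on K) -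
      (\<Sum>K\<in>T. \<integral>x. grad (v K) x \<bullet> z K x \<partial>lebesgue_on K)"
    unfolding dg_form_def sum_subtractf[symmetric]
  proof (rule sum.cong[OF refl])
    fix K assume K: "K \<in> T"
    have "(\<integral>x. z K x \<bullet> z K x \<partial>lebesgue_on K) = (\<integral>x. grad (u K) x \<bullet> z K x - grad (v K) x \<bullet> z K x \<partial>lebesgue_on K)"
      using K by (intro Bochner_Integration.integral_cong) (simp_all add: z_def inner_diff_left)
    then show "(\<integral>x. z K x \<bullet> z K x \<partial>lebesgue_on K) =
        (\<integral>x. grad (u K) x \<bullet> z K x \<partial>lebesgue_on K) - (\<integral>x. grad (v K) x \<bullet> z K x \<partial>lebesgue_on K)"
      using gradient_term_integrable[OF mesh u zY K] gradient_term_integrable[OF mesh v zY K] by simp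
  qed
  ultimately have "dg_form T z z = 0" by simp
  then have z0: "z = 0" using dg_form_eq_0[OF mesh zY] by simp
  have grad_eq: "grad (u K) x = grad (v K) x" if "K \<in> T" for K x
    using fun_cong[OF fun_cong[OF z0, of K], of x] that by (simp add: z_def)
  define w where "w K = u K - v K" for K
  have wK: "w K \<in> poly_fun k" if "K \<in> T" for K
    unfolding w_def using subspace_diff[OF subspace_poly_fun uK vK] that by blast
  have const: "w K x = w K y" if K: "K \<in> T" for K x y
  proof (rule poly_fun_constant[OF wK[OF K]])
    fix x
    have "v K + w K = u K" by (simp add: w_def)
    then have "grad (u K) x = grad (v K) x + grad (w K) x"
      using grad_add[OF differentiable_poly_fun[OF vK[OF K]] differentiable_poly_fun[OF wK[OF K]], of x] by simp
    then show "grad (w K) x = 0" using grad_eq[OF K, of x] by simp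
  qed
  define A where "A = {K\<in>T. w K = 0}"
  have "A = T"
  proof (rule mesh_connected[OF mesh dom bd])
    note face = boundary_face[OF mesh KF]
    obtain x where "x \<in> F0" "u K0 x = v K0 x"
      using AE_face_measure_imp_ex[OF face(3) traces[OF KF]] by blast
    then have "w K0 y = 0" for y using const[OF face(1), of y x] by (simp add: w_def)
    then have "w K0 = 0" by (simp add: fun_eq_iff)
    then show "A \<noteq> {}" using face(1) by (auto simp: A_def)
    show "K' \<in> A" if K: "K \<in> A" "K' \<in> T" "K \<noteq> K'" "K \<inter> K' \<in> interior_faces T \<Omega>" for K K'
    proof -
      have KT: "K \<in> T" "w K = 0" using K(1) by (auto simp: A_def)
      have flat: "flat_face (K \<inter> K')" using interior_face_flat[OF mesh] K(4) by blast
      note nb = interior_face_neighbours[OF mesh KT(1) K(2,3) flat Int_lower1 Int_lower2]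
      obtain x where x: "jump T u (K \<inter> K') x = jump T v (K \<inter> K') x"
        using AE_face_measure_imp_ex[OF flat jumps[OF K(4)]] by blast
      have "u K x = v K x" using fun_cong[OF KT(2), of x] by (simp add: w_def)
      \<comment> \<open>The jump has only the contributions of \<open>K\<close> and
        \<open>K'\<close>, and those of \<open>K\<close> cancel.\<close>
      then have "u K' x *\<^sub>R outward_normal K' (K \<inter> K') = v K' x *\<^sub>R outward_normal K' (K \<inter> K')"
        using x K(3) unfolding jump_def nb by simp
      moreover have "outward_normal K' (K \<inter> K') \<noteq> 0"
        using mesh_opposite_normals[OF mesh KT(1) K(2,3) flat Int_lower1 Int_lower2] by auto
      ultimately have "w K' x = 0" by (simp add: w_def)
      then have "w K' y = 0" for y using const[OF K(2), of y x] by simp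
      then have "w K' = 0" by (simp add: fun_eq_iff)
      then show ?thesis using K(2) by (simp add: A_def)
    qed
  qed (auto simp: A_def)
  show "u = v"
  proof
    fix K
    show "u K = v K"
    proof (cases "K \<in> T")
      case True
      then have "w K = 0" using \<open>A = T\<close> by (auto simp: A_def)
      then show ?thesis by (simp add: w_def)
    qed (use u v in \<open>simp add: mesh_family_def\<close>)
  qed
qed

text \<open>On the bounded set \<open>\<Omega>\<close>, \<open>f\<close> is integrable. An element
  can leave \<open>\<Omega>\<close> only along its own frontier, which is null, so integrability
  passes to the closed element; \<open>q\<close> is bounded there.\<close>

lemma integrable_on_element:
  fixes f :: "real^'n \<Rightarrow> real"
  assumes \<Omega>: "open \<Omega>" "bounded \<Omega>" and f: "in_Lp (lebesgue_on \<Omega>) p f" "1 \<le> p"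
    and K: "convex K" "compact K" "interior K \<subseteq> \<Omega>" and q: "continuous_on UNIV q"
  shows "integrable (lebesgue_on K) (\<lambda>x. f x * q x)"
proof -
  have \<Omega>m: "\<Omega> \<in> lmeasurable" using \<Omega> by (simp add: bounded_set_imp_lmeasurable)
  have Km: "K \<in> sets lebesgue" using compact_imp_closed[OF K(2)] by simp
  have "integrable (lebesgue_on \<Omega>) f"
    using integrable_in_Lp[OF finite_measure_lebesgue_on[OF \<Omega>m] f] .
  then have "integrable lebesgue (\<lambda>x. indicator \<Omega> x *\<^sub>R f x)"
    using \<Omega>m by (simp add: integrable_restrict_space)
  then have "integrable lebesgue (\<lambda>x. indicator (interior K) x *\<^sub>R (indicator \<Omega> x *\<^sub>R f x))"
    by (rule integrable_mult_indicator[rotated]) simp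
  moreover have "AE x in lebesgue. indicator (interior K) x *\<^sub>R (indicator \<Omega> x *\<^sub>R f x) = indicator K x *\<^sub>R f x"
  proof -
    have "negligible (frontier K)" using K(1) by (rule negligible_convex_frontier)
    then have "AE x in lebesgue. x \<notin> frontier K"
      by (simp add: negligible_iff_null_sets AE_not_in)
    then show ?thesis
    proof eventually_elim
      case (elim x)
      then have "x \<in> interior K \<longleftrightarrow> x \<in> K"
        using closure_subset[of K] interior_subset[of K] by (auto simp: frontier_def)
      then show ?case using K(3) by (auto simp: indicator_def)
    qed
  qed
  ultimately have "integrable lebesgue (\<lambda>x. indicator K x *\<^sub>R f x)"
    by (rule completion.integrable_AE_eq)
  then have fK: "integrable (lebesgue_on K) f"
    using Km by (simp add: integrable_restrict_space)
  have "compact (q ` K)"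
    using K(2) continuous_on_subset[OF q subset_UNIV] by (rule compact_continuous_image[rotated])
  then obtain B where B: "\<And>x. x \<in> K \<Longrightarrow> norm (q x) \<le> B"
    using compact_imp_bounded by (force simp: bounded_iff)
  show ?thesis
  proof (rule Bochner_Integration.integrable_bound)
    show "integrable (lebesgue_on K) (\<lambda>x. B * f x)" using fK by simp
    show "(\<lambda>x. f x * q x) \<in> borel_measurable (lebesgue_on K)"
      using borel_measurable_integrable[OF fK] borel_measurable_integrable[OF integrable_lebesgue_on_continuous[OF K(2) q]]
      by (rule borel_measurable_times)
    show "AE x in lebesgue_on K. norm (f x * q x) \<le> norm (B * f x)"
    proof (rule AE_I2)
      fix x assume "x \<in> space (lebesgue_on K)"
      then have "norm (q x) \<le> \<bar>B\<bar>" using B[of x] by simp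
      then show "norm (f x * q x) \<le> norm (B * f x)"
        using mult_left_mono[of "norm (q x)" "\<bar>B\<bar>" "\<bar>f x\<bar>"] by (simp add: abs_mult mult.commute)
    qed
  qed
qed

theorem theorem4p2:
  fixes \<Omega> \<Gamma>D \<Gamma>N :: "(real^'n) set"
    and T :: "(real^'n) set set"
    and k :: nat
    and p p' :: real
    and h \<eta> :: "(real^'n) set \<Rightarrow> real"
    and C12 :: "(real^'n) set \<Rightarrow> real^'n"
    and f gD :: "real^'n \<Rightarrow> real"
    and gN :: "real^'n \<Rightarrow> real^'n"
  assumes "1 < p" and "1/p + 1/p' = 1"
    and "polyhedral_domain \<Omega>"
    and "frontier \<Omega> = \<Gamma>D \<union> \<Gamma>N" and "\<Gamma>D \<inter> \<Gamma>N = {}"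
    and "dg_mesh \<Omega> \<Gamma>D \<Gamma>N T"
    and "boundary_area T \<Omega> \<Gamma>D > 0"
    and "\<forall>e \<in> interior_faces T \<Omega> \<union> snd ` boundary_faces T (frontier \<Omega>). 0 < h e \<and> 0 < \<eta> e"
    and "in_Lp (lebesgue_on \<Omega>) p' f" and "in_W_dual \<Omega> p f"
    and "in_Wsp_faces (boundary_faces T \<Gamma>D) (1/p') p gD"
    and "\<forall>(K, F)\<in>boundary_faces T \<Gamma>N. in_Lp (face_measure F) p' (\<lambda>x. gN x \<bullet> outward_normal K F)"
    and "normal_in_Wsp_faces_dual (boundary_faces T \<Gamma>N) (1/p') p gN"
  shows "\<exists>!u. u \<in> V_h k T \<and>
           (\<forall>v\<in>V_h k T. J_h k T \<Omega> \<Gamma>D \<Gamma>N p h \<eta> C12 f gD gN u \<le> J_h k T \<Omega> \<Gamma>D \<Gamma>N p h \<eta> C12 f gD gN v)"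
proof -
  note p = assms(1) and bd = assms(4,5) and mesh = assms(6)
  have \<Omega>: "open \<Omega>" "bounded \<Omega>" "connected \<Omega>" using assms(3) by (auto simp: polyhedral_domain_def)
  have p': "1 \<le> p'"
  proof -
    have "0 < 1/p" "1/p < 1" using p by auto
    then have "0 < 1/p'" "1/p' < 1" using assms(2) by linarith+
    then show ?thesis by (simp add: divide_less_eq zero_less_divide_iff split: if_splits)
  qed
  obtain K0 F0 where KF0: "(K0, F0) \<in> boundary_faces T \<Gamma>D"
    using ex_Dirichlet_face[OF mesh \<Omega>(1) bd assms(7)] by blast
  have gD_Lp: "in_Lp (face_measure F) p gD" if "(K, F) \<in> boundary_faces T \<Gamma>D" for K F
    using assms(11) that unfolding in_Wsp_faces_def by blast
  have gD_int: "integrable (face_measure F) gD" if KF: "(K, F) \<in> boundary_faces T \<Gamma>D" for K F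
    using integrable_in_Lp[OF finite_measure_face_measure[OF boundary_face(3)[OF mesh KF]] gD_Lp[OF KF]] p by simp
  let ?W = "mesh_family T (poly_fun k :: (real^'n \<Rightarrow> real) set)"
  let ?dG = "discrete_gradient \<Omega> \<Gamma>D T k gD C12"
  let ?IF = "interior_faces T \<Omega>" and ?BF = "boundary_faces T \<Gamma>D"
  have sub: "subspace ?W" by (intro subspace_mesh_family subspace_poly_fun)
  have "finite (monom_fun ` {\<alpha> :: 'n \<Rightarrow> nat. (\<Sum>i\<in>UNIV. \<alpha> i) \<le> k})"
    using finite_multi_indices by blast
  then obtain G where G: "finite G" "?W \<subseteq> span G"
    using mesh_family_span[OF finite_mesh[OF mesh]] poly_fun_eq_span[of k, where 'n = 'n] by (metis subset_refl)
  have W_cont: "continuous_on UNIV (w K)" if "w \<in> ?W" "K \<in> T" for w K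
    using that by (auto simp: mesh_family_def intro: continuous_on_poly_fun)
  \<comment> \<open>One index set for the three kinds of energy terms: elements, interior faces,
    Dirichlet faces. The last are paired with their element, which provides the trace.\<close>
  define M where "M j = (case j of Inl K \<Rightarrow> lebesgue_on K | Inr (Inl e) \<Rightarrow> face_measure e | Inr (Inr (K, F)) \<Rightarrow> face_measure F)"
    for j :: "(real^'n) set + (real^'n) set + (real^'n) set \<times> (real^'n) set"
  \<comment> \<open>The unit vector \<open>b\<close> turns scalar traces into vectors, so that all three energies have one codomain.\<close>
  define b :: "real^'n" where "b = axis undefined 1"
  define a where "a j w x = (case j of Inl K \<Rightarrow> ?dG w K x | Inr (Inl e) \<Rightarrow> jump T w e x
      | Inr (Inr (K, F)) \<Rightarrow> (w K x - gD x) *\<^sub>R b)"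
    for j :: "(real^'n) set + (real^'n) set + (real^'n) set \<times> (real^'n) set" and w x
  define c where "c j = (1/p) * (case j of Inl K \<Rightarrow> 1 | Inr (Inl e) \<Rightarrow> \<eta> e * h e powr (1 - p)
      | Inr (Inr (K, F)) \<Rightarrow> \<eta> F * h F powr (1 - p))"
    for j :: "(real^'n) set + (real^'n) set + (real^'n) set \<times> (real^'n) set"
  define I where "I = T <+> (?IF <+> ?BF)"
  define L where "L w = (\<Sum>K\<in>T. \<integral>x. f x * w K x \<partial>lebesgue_on K) +
      (\<Sum>(K, F)\<in>boundary_faces T \<Gamma>N. \<integral>x. (gN x \<bullet> outward_normal K F) * w K x \<partial>face_measure F)"
    for w :: "(real^'n) set \<Rightarrow> real^'n \<Rightarrow> real"
  have M_simps: "M (Inl K) = lebesgue_on K" "M (Inr (Inl e)) = face_measure e"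
    "M (Inr (Inr (K, F))) = face_measure F" for K e F
    by (simp_all add: M_def)
  have b1: "norm b = 1" "b \<noteq> 0" by (auto simp: b_def)
  have fin: "finite T" "finite ?IF" "finite ?BF"
    using finite_mesh[OF mesh] finite_interior_faces finite_boundary_faces[OF mesh] by auto
  have I_cases: thesis
    if "j \<in> I" "\<And>K. j = Inl K \<Longrightarrow> K \<in> T \<Longrightarrow> thesis" "\<And>e. j = Inr (Inl e) \<Longrightarrow> e \<in> ?IF \<Longrightarrow> thesis"
      "\<And>K F. j = Inr (Inr (K, F)) \<Longrightarrow> (K, F) \<in> ?BF \<Longrightarrow> thesis" for j thesis
    using that(1) unfolding I_def
  proof (elim PlusE)
    fix q r assume "j = Inr r" "r = Inr q" "q \<in> ?BF"
    then show thesis using that(4)[of "fst q" "snd q"] by simp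
  qed (use that(2,3) in blast)+
  have dG_in: "?dG w \<in> mesh_family T (vec_poly_fun k)" if "w \<in> ?W" for w
    by (rule discrete_gradient(1)[OF mesh gD_int that])
  have dG_affine: "?dG ((1 - s) *\<^sub>R u + s *\<^sub>R v) = (1 - s) *\<^sub>R ?dG u + s *\<^sub>R ?dG v"
    if "u \<in> ?W" "v \<in> ?W" for u v s
    by (rule discrete_gradient_affine[OF mesh gD_int that])
  have dG_eq: "D_DG k T \<Omega> \<Gamma>D C12 (restrict_family T w) gD = restrict_family T (?dG w)" if "w \<in> ?W" for w
    by (rule D_DG_restrict_family[OF mesh gD_int that])
  have dG_cont: "continuous_on UNIV (?dG w K)" if "w \<in> ?W" "K \<in> T" for w K
    using dG_in[OF that(1)] that(2) by (auto simp: mesh_family_def intro: continuous_on_vec_poly_fun)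
  have f_int: "integrable (lebesgue_on K) (\<lambda>x. f x * w K x)" if "w \<in> ?W" "K \<in> T" for w K
    using mesh_element[OF mesh that(2)] W_cont[OF that]
    by (intro integrable_on_element[OF \<Omega>(1,2) assms(9) p'])
  have gN_int: "integrable (face_measure F) (\<lambda>x. (gN x \<bullet> outward_normal K F) * w K x)"
    if w: "w \<in> ?W" and KF: "(K, F) \<in> boundary_faces T \<Gamma>N" for w K F
  proof -
    note face = boundary_face[OF mesh KF]
    have "in_Lp (face_measure F) p' (\<lambda>x. gN x \<bullet> outward_normal K F)" using assms(12) KF by blast
    then have "integrable (face_measure F) (\<lambda>x. gN x \<bullet> outward_normal K F)"
      using integrable_in_Lp[OF finite_measure_face_measure[OF face(3)]] p' by blast
    then show ?thesis by (intro integrable_face_measure_mult[OF face(3)] W_cont[OF w face(1)])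
  qed
  \<comment> \<open>The problem is solved on polynomial families first; at the end it is carried to
    \<open>V_h\<close>, which is the image of \<open>?W\<close> under restriction.\<close>
  have "\<exists>!u. u \<in> ?W \<and> (\<forall>v\<in>?W. J_h k T \<Omega> \<Gamma>D \<Gamma>N p h \<eta> C12 f gD gN (restrict_family T u) \<le>
      J_h k T \<Omega> \<Gamma>D \<Gamma>N p h \<eta> C12 f gD gN (restrict_family T v))"
  proof (rule ex1_minimizer_p_energy[OF sub G _ p])
    show "finite I" unfolding I_def using fin by simp
    show "0 < c j" if "j \<in> I" for j
      using that
    proof (rule I_cases)
      fix K F assume j: "j = Inr (Inr (K, F))" "(K, F) \<in> ?BF"
      \<comment> \<open>Positivity of \<open>h\<close> and \<open>\<eta>\<close> is given for faces
        in the whole boundary, of which \<open>\<Gamma>D\<close> is a part.\<close>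
      then have "(K, F) \<in> boundary_faces T (frontier \<Omega>)" using bd(1) by (auto simp: boundary_faces_def)
      then have "0 < h F \<and> 0 < \<eta> F" using assms(8) by force
      then show ?thesis using p j by (simp add: c_def)
    next
      fix e assume j: "j = Inr (Inl e)" "e \<in> ?IF"
      then have "0 < h e \<and> 0 < \<eta> e" using assms(8) by simp
      then show ?thesis using p j by (simp add: c_def)
    qed (use p in \<open>simp add: c_def\<close>)
    show "a j ((1 - s) *\<^sub>R u + s *\<^sub>R v) x = (1 - s) *\<^sub>R a j u x + s *\<^sub>R a j v x"
      if "j \<in> I" "u \<in> ?W" "v \<in> ?W" for j u v s x
      using that(1)
    proof (rule I_cases)
      fix K F assume "j = Inr (Inr (K, F))"
      then show ?thesis by (simp add: a_def algebra_simps)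
    qed (simp_all add: a_def dG_affine[OF that(2,3)] face_terms_linear)
    show meas: "a j v \<in> borel_measurable (M j)" if "j \<in> I" "v \<in> ?W" for j v
      using that(1)
    proof (rule I_cases)
      fix K assume j: "j = Inl K" "K \<in> T"
      then show ?thesis
        using borel_measurable_integrable[OF element_integrable[OF mesh j(2) dG_cont[OF that(2) j(2)]]]
        by (simp add: a_def[abs_def] M_def)
    next
      fix e assume j: "j = Inr (Inl e)" "e \<in> ?IF"
      then show ?thesis
        using borel_measurable_face_measure[OF borel_measurable_continuous_onI[OF jump_continuous[OF mesh that(2)]]]
        by (simp add: a_def[abs_def] M_def)
    next
      fix K F assume j: "j = Inr (Inr (K, F))" "(K, F) \<in> ?BF"
      have "v K \<in> borel_measurable (face_measure F)"
        using W_cont[OF that(2)] boundary_face(1)[OF mesh j(2)]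
        by (intro borel_measurable_face_measure borel_measurable_continuous_onI) auto
      moreover have "gD \<in> borel_measurable (face_measure F)" using gD_Lp[OF j(2)] by (simp add: in_Lp_def)
      ultimately show ?thesis using j by (simp add: a_def[abs_def] M_def)
    qed
    show "integrable (M j) (\<lambda>x. norm (a j v x) powr p)" if "j \<in> I" "v \<in> ?W" for j v
      using that(1)
    proof (rule I_cases)
      fix K assume j: "j = Inl K" "K \<in> T"
      have "continuous_on UNIV (\<lambda>x. norm (?dG v K x) powr p)"
        using dG_cont[OF that(2) j(2)] p by (intro continuous_on_powr' continuous_intros) auto
      then show ?thesis using element_integrable[OF mesh j(2)] j by (simp add: a_def M_def)
    next
      fix e assume j: "j = Inr (Inl e)" "e \<in> ?IF"
      have "continuous_on UNIV (\<lambda>x. norm (jump T v e x) powr p)"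
        using jump_continuous[OF mesh that(2)] p by (intro continuous_on_powr' continuous_intros) auto
      then show ?thesis
        using integrable_face_measure_continuous[OF interior_face_flat[OF mesh j(2)]] j by (simp add: a_def M_def)
    next
      fix K F assume j: "j = Inr (Inr (K, F))" "(K, F) \<in> ?BF"
      note face = boundary_face[OF mesh j(2)]
      have "continuous_on UNIV (\<lambda>x. norm (v K x) powr p)"
        using W_cont[OF that(2) face(1)] p by (intro continuous_on_powr' continuous_intros) auto
      then have v_int: "integrable (face_measure F) (\<lambda>x. norm (v K x) powr p)"
        by (rule integrable_face_measure_continuous[OF face(3)])
      \<comment> \<open>The datum \<open>gD\<close> is only in \<open>L\<^sup>p\<close>, so
        continuity does not help here; the difference is dominated by the separate
        \<open>p\<close>-th powers.\<close>
      have "integrable (face_measure F) (\<lambda>x. norm (v K x - gD x) powr p)"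
      proof (rule Bochner_Integration.integrable_bound)
        show "integrable (face_measure F) (\<lambda>x. 2 powr p * (norm (v K x) powr p + norm (gD x) powr p))"
          using v_int gD_Lp[OF j(2)] by (simp add: in_Lp_def)
        have "v K \<in> borel_measurable (face_measure F)"
          using W_cont[OF that(2) face(1)] by (intro borel_measurable_face_measure borel_measurable_continuous_onI)
        moreover have "gD \<in> borel_measurable (face_measure F)" using gD_Lp[OF j(2)] by (simp add: in_Lp_def)
        ultimately show "(\<lambda>x. norm (v K x - gD x) powr p) \<in> borel_measurable (face_measure F)" by measurable
        show "AE x in face_measure F. norm (norm (v K x - gD x) powr p) \<le>
            norm (2 powr p * (norm (v K x) powr p + norm (gD x) powr p))"
        proof (rule AE_I2)
          fix x
          show "norm (norm (v K x - gD x) powr p) \<le> norm (2 powr p * (norm (v K x) powr p + norm (gD x) powr p))"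
            using norm_diff_powr_le[of p "v K x" "gD x"] p by simp
        qed
      qed
      then show ?thesis using j b1 by (simp add: a_def M_def)
    qed
    show "u = v" if "u \<in> ?W" "v \<in> ?W" and ae: "\<And>j. j \<in> I \<Longrightarrow> AE x in M j. a j u x = a j v x" for u v
    proof (rule broken_function_eqI[OF mesh \<Omega>(1,3) bd(1) KF0 gD_int that(1,2)])
      show "AE x in lebesgue_on K. ?dG u K x = ?dG v K x" if "K \<in> T" for K
        using ae[of "Inl K"] that unfolding M_simps by (simp add: a_def I_def InlI)
      show "AE x in face_measure e. jump T u e x = jump T v e x" if "e \<in> ?IF" for e
        using ae[of "Inr (Inl e)"] that unfolding M_simps by (simp add: a_def I_def InlI InrI)
      show "AE x in face_measure F. u K x = v K x" if "(K, F) \<in> ?BF" for K F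
        using ae[of "Inr (Inr (K, F))"] that b1(2) unfolding M_simps by (simp add: a_def I_def InrI)
    qed
    have L_lincomb: "L (s *\<^sub>R u + t *\<^sub>R v) = s * L u + t * L v" if "u \<in> ?W" "v \<in> ?W" for s t u v
    proof -
      have "(\<integral>x. f x * (s *\<^sub>R u + t *\<^sub>R v) K x \<partial>lebesgue_on K) =
          s * (\<integral>x. f x * u K x \<partial>lebesgue_on K) + t * (\<integral>x. f x * v K x \<partial>lebesgue_on K)" if "K \<in> T" for K
        using f_int \<open>u \<in> ?W\<close> \<open>v \<in> ?W\<close> that by (intro integral_lincomb) (simp_all add: algebra_simps)
      moreover have "(\<integral>x. (gN x \<bullet> outward_normal K F) * (s *\<^sub>R u + t *\<^sub>R v) K x \<partial>face_measure F) =
          s * (\<integral>x. (gN x \<bullet> outward_normal K F) * u K x \<partial>face_measure F) +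
          t * (\<integral>x. (gN x \<bullet> outward_normal K F) * v K x \<partial>face_measure F)"
        if "(K, F) \<in> boundary_faces T \<Gamma>N" for K F
        using gN_int[OF \<open>u \<in> ?W\<close> that] gN_int[OF \<open>v \<in> ?W\<close> that]
        by (intro integral_lincomb) (simp_all add: algebra_simps)
      ultimately show ?thesis
        unfolding L_def by (simp add: case_prod_unfold sum.distrib algebra_simps flip: sum_distrib_left cong: sum.cong)
    qed
    show "L (u + v) = L u + L v" if "u \<in> ?W" "v \<in> ?W" for u v
      using L_lincomb[OF that, of 1 1] by simp
    show "L (s *\<^sub>R u) = s * L u" if "u \<in> ?W" for s u
      using L_lincomb[OF that that, of s 0] by simp
    show "J_h k T \<Omega> \<Gamma>D \<Gamma>N p h \<eta> C12 f gD gN (restrict_family T v) =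
        (\<Sum>j\<in>I. c j * (\<integral>x. norm (a j v x) powr p \<partial>M j)) - L v" if v: "v \<in> ?W" for v
    proof -
      have 1: "(\<integral>x. norm (D_DG k T \<Omega> \<Gamma>D C12 (restrict_family T v) gD K x) powr p \<partial>lebesgue_on K) =
          (\<integral>x. norm (?dG v K x) powr p \<partial>lebesgue_on K)" if "K \<in> T" for K
        using that by (intro Bochner_Integration.integral_cong)
          (simp_all add: dG_eq[OF v])
      have 2: "(\<integral>x. norm (jump T (restrict_family T v) e x) powr p \<partial>face_measure e) =
          (\<integral>x. norm (jump T v e x) powr p \<partial>face_measure e)" if "e \<in> ?IF" for e
        by (rule integral_face_measure_cong[OF interior_face_flat[OF mesh that]])
          (simp add: face_terms_restrict_family)
      have 3: "(\<integral>x. \<bar>restrict_family T v K x - gD x\<bar> powr p \<partial>face_measure F) =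
          (\<integral>x. \<bar>v K x - gD x\<bar> powr p \<partial>face_measure F)" if "(K, F) \<in> ?BF" for K F
        using boundary_face[OF mesh that] by (intro integral_face_measure_cong) (auto simp: subset_iff)
      have 4: "(\<integral>x. f x * restrict_family T v K x \<partial>lebesgue_on K) = (\<integral>x. f x * v K x \<partial>lebesgue_on K)"
        if "K \<in> T" for K
        using that by (intro Bochner_Integration.integral_cong) simp_all
      have 5: "(\<integral>x. (gN x \<bullet> outward_normal K F) * restrict_family T v K x \<partial>face_measure F) =
          (\<integral>x. (gN x \<bullet> outward_normal K F) * v K x \<partial>face_measure F)"
        if "(K, F) \<in> boundary_faces T \<Gamma>N" for K F
        using boundary_face[OF mesh that] by (intro integral_face_measure_cong) (auto simp: subset_iff)
      have "(\<Sum>j\<in>I. c j * (\<integral>x. norm (a j v x) powr p \<partial>M j)) =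
          (\<Sum>K\<in>T. (1/p) * (\<integral>x. norm (?dG v K x) powr p \<partial>lebesgue_on K)) +
          (\<Sum>e\<in>?IF. (1/p) * ((\<integral>x. norm (jump T v e x) powr p \<partial>face_measure e) * (\<eta> e * h e powr (1 - p)))) +
          (\<Sum>(K, F)\<in>?BF. (1/p) * ((\<integral>x. \<bar>v K x - gD x\<bar> powr p \<partial>face_measure F) * (\<eta> F * h F powr (1 - p))))"
        unfolding I_def using fin
        by (simp add: sum.Plus o_def a_def M_def c_def b1 case_prod_unfold mult_ac)
      moreover have "J_h k T \<Omega> \<Gamma>D \<Gamma>N p h \<eta> C12 f gD gN (restrict_family T v) =
          (\<Sum>K\<in>T. (1/p) * (\<integral>x. norm (?dG v K x) powr p \<partial>lebesgue_on K)) +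
          (\<Sum>e\<in>?IF. (1/p) * ((\<integral>x. norm (jump T v e x) powr p \<partial>face_measure e) * (\<eta> e * h e powr (1 - p)))) +
          (\<Sum>(K, F)\<in>?BF. (1/p) * ((\<integral>x. \<bar>v K x - gD x\<bar> powr p \<partial>face_measure F) * (\<eta> F * h F powr (1 - p)))) -
          L v"
        unfolding J_h_def L_def sum_distrib_left
        by (simp add: 1 2 3 4 5 case_prod_unfold cong: sum.cong)
      ultimately show ?thesis by simp
    qed
  qed
  then obtain u where u: "u \<in> ?W"
    "\<And>v. v \<in> ?W \<Longrightarrow> J_h k T \<Omega> \<Gamma>D \<Gamma>N p h \<eta> C12 f gD gN (restrict_family T u) \<le>
      J_h k T \<Omega> \<Gamma>D \<Gamma>N p h \<eta> C12 f gD gN (restrict_family T v)"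
    and uniq: "\<And>u'. u' \<in> ?W \<Longrightarrow> (\<And>v. v \<in> ?W \<Longrightarrow> J_h k T \<Omega> \<Gamma>D \<Gamma>N p h \<eta> C12 f gD gN (restrict_family T u') \<le>
      J_h k T \<Omega> \<Gamma>D \<Gamma>N p h \<eta> C12 f gD gN (restrict_family T v)) \<Longrightarrow> u' = u"
    by (elim ex1E) metis
  show ?thesis
    unfolding V_h_eq
  proof (rule ex1I[of _ "restrict_family T u"])
    show "restrict_family T u \<in> restrict_family T ` ?W \<and> (\<forall>v\<in>restrict_family T ` ?W.
        J_h k T \<Omega> \<Gamma>D \<Gamma>N p h \<eta> C12 f gD gN (restrict_family T u) \<le> J_h k T \<Omega> \<Gamma>D \<Gamma>N p h \<eta> C12 f gD gN v)"
      using u by blast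
    fix u' assume u': "u' \<in> restrict_family T ` ?W \<and> (\<forall>v\<in>restrict_family T ` ?W.
        J_h k T \<Omega> \<Gamma>D \<Gamma>N p h \<eta> C12 f gD gN u' \<le> J_h k T \<Omega> \<Gamma>D \<Gamma>N p h \<eta> C12 f gD gN v)"
    then obtain w where "w \<in> ?W" "u' = restrict_family T w" by blast
    then show "u' = restrict_family T u" using uniq[of w] u' by blast
  qed
qed

end
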